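(* Let $\mathcal{X}\in\mathfrak{Ghol}$ and let $M=\begin{pmatrix} A_1 & A_2 \\ A_3 & A_4 \end{pmatrix}\in\mathrm{Aut}\,\mathcal{X}$ be an element of Type III. (1) Suppose $A_1$ is not a scalar multiple of $I$. Then the cusp shapes of $\mathcal{X}$ are contained in $\mathbb{Q}(\sqrt{-3})$, $\mathbb{Q}(\sqrt{-2})$ or $\mathbb{Q}(\sqrt{-1})$. More specifically (in each item, $\pm$ signs correspond to each other, and $A_1,A_2\in\mathrm{GL}_2(\mathbb{Q})$): (a) Suppose the cusp shapes are contained in $\mathbb{Q}(\sqrt{-3})$. (i) If $\mathfrak{m}_M(x)=x^2+1$ (resp. $\mathfrak{m}_M(x)=x^4+x^2+1$ and $M^2$ is of Type III), then $M$ is of the form $\begin{pmatrix} A_1 & A_2 \\ -\frac14A_2^{-1} & -A_2^{-1}A_1A_2 \end{pmatrix}$ (resp. $\begin{pmatrix} A_1 & A_2 \\ \frac14A_2^{-1} & A_2^{-1}A_1A_2 \end{pmatrix}$) with $\mathfrak{m}_{A_1}(x)=x^2+\frac34$. (ii) If $\mathfrak{m}_M(x)=x^3\pm1$ (resp. $\mathfrak{m}_M(x)=x^4+x^2+1$ and $M^2$ is of Type I), then $M$ is of the form $\begin{pmatrix} A_1 & A_2 \\ -3A_2^{-1}A_1^2 & A_2^{-1}A_1A_2 \end{pmatrix}$ (resp. $\begin{pmatrix} A_1 & A_2 \\ 3A_2^{-1}A_1^2 & -A_2^{-1}A_1A_2 \end{pmatrix}$) with $\mathfrak{m}_{A_1}(x)=x^2\pm\frac12x+\frac14$.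 (iii) If $\mathfrak{m}_M(x)=x^3\pm2x^2+2x\pm1$ (resp. $\mathfrak{m}_M(x)=x^4-x^2+1$ and $M^2$ is of Type I), then $M$ is of the form $\begin{pmatrix} A_1 & A_2 \\ -\frac13A_2^{-1}A_1^2 & A_2^{-1}A_1A_2 \end{pmatrix}$ (resp. $\begin{pmatrix} A_1 & A_2 \\ \frac13A_2^{-1}A_1^2 & -A_2^{-1}A_1A_2 \end{pmatrix}$) with $\mathfrak{m}_{A_1}(x)=x^2\pm\frac32x+\frac34$. (b) Suppose the cusp shapes are contained in $\mathbb{Q}(\sqrt{-2})$. (i) If $\mathfrak{m}_M(x)=x^2+1$ (resp. $\mathfrak{m}_M(x)=x^4+1$ and $M^2$ is of Type II), then $M$ is of the form $\begin{pmatrix} A_1 & A_2 \\ -\frac12A_2^{-1} & -A_2^{-1}A_1A_2 \end{pmatrix}$ (resp. $\begin{pmatrix} A_1 & A_2 \\ \frac12A_2^{-1} & A_2^{-1}A_1A_2 \end{pmatrix}$) with $\mathfrak{m}_{A_1}(x)=x^2+\frac12$. (ii) If $\mathfrak{m}_M(x)=x^2\pm x+1$ (resp. $\mathfrak{m}_M(x)=x^4+1$ and $M^2$ is of Type III), then $M$ is of the form $\begin{pmatrix} A_1 & A_2 \\ -\frac14A_2^{-1} & \frac34A_2^{-1}A_1^{-1}A_2 \end{pmatrix}$ (resp. $\begin{pmatrix} A_1 & A_2 \\ \frac14A_2^{-1} & -\frac34A_2^{-1}A_1^{-1}A_2 \end{pmatrix}$) with $\mathfrak{m}_{A_1}(x)=x^2\pm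 x+\frac34$. (c) Suppose the cusp shapes are contained in $\mathbb{Q}(\sqrt{-1})$. (i) If $\mathfrak{m}_M(x)=x^2+1$ (resp. $\mathfrak{m}_M(x)=x^4-x^2+1$ and $M^2$ is of Type III with $\mathfrak{m}_{\iota M^2}(x)=x^2-1$), then $M$ is of the form $\begin{pmatrix} A_1 & A_2 \\ -\frac34A_2^{-1} & -A_2^{-1}A_1A_2 \end{pmatrix}$ (resp. $\begin{pmatrix} A_1 & A_2 \\ \frac34A_2^{-1} & A_2^{-1}A_1A_2 \end{pmatrix}$) with $\mathfrak{m}_{A_1}(x)=x^2+\frac14$. (ii) If $\mathfrak{m}_M(x)=x^3\pm x^2+x\pm1$ (resp. $\mathfrak{m}_M(x)=x^4+1$ and $M^2$ is of Type I), then $M$ is of the form $\begin{pmatrix} A_1 & A_2 \\ -A_2^{-1}A_1^2 & A_2^{-1}A_1A_2 \end{pmatrix}$ (resp. $\begin{pmatrix} A_1 & A_2 \\ A_2^{-1}A_1^2 & -A_2^{-1}A_1A_2 \end{pmatrix}$) with $\mathfrak{m}_{A_1}(x)=x^2\pm x+\frac12$. (iii) If $\mathfrak{m}_M(x)=x^2\pm x+1$ (resp. $\mathfrak{m}_M(x)=x^4-x^2+1$ and $M^2$ is of Type III with $\mathfrak{m}_{\iota M^2}(x)=x^4-x^2+1$), then $M$ is of the form $\begin{pmatrix} A_1 & A_2 \\ -\frac12A_2^{-1} & \frac12A_2^{-1}A_1^{-1}A_2 \end{pmatrix}$ (resp. $\begin{pmatrix} A_1 & A_2 \\ \frac12A_2^{-1}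 & -\frac12A_2^{-1}A_1^{-1}A_2 \end{pmatrix}$) with $\mathfrak{m}_{A_1}(x)=x^2\pm x+\frac12$. (In the "resp." cases where $\mathfrak{m}_M$ carries no sign, $\pm$ in $\mathfrak{m}_{A_1}$ means one of the two signs.) (2) Suppose $A_1$ is a scalar multiple of $I$. Then $\mathfrak{m}_M(x)$ is $x^2-1$, $x^2+x+1$ or $x^2-x+1$, and $M$ is of the form, respectively, $$\begin{pmatrix} \pm\frac12I & A_2 \\ \frac34A_2^{-1} & \mp\frac12I \end{pmatrix},\qquad\begin{pmatrix} -\frac12I & A_2 \\ -\frac34A_2^{-1} & -\frac12I \end{pmatrix},\qquad\begin{pmatrix} \frac12I & -A_2 \\ \frac34A_2^{-1} & \frac12I \end{pmatrix}$$ for some $A_2\in\mathrm{GL}_2(\mathbb{Q})$ with $\det A_2=\frac34$.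
   Context: Generalized analytic holonomy sets: $\mathfrak{Ghol}$ is the set of analytic sets (germs at $0$) $\mathcal{X}\subset\mathbb{C}^4$, coordinates $(u_1,v_1,u_2,v_2)$, defined by holomorphic functions $v_i(u_1,u_2)=\tau_iu_i+(\text{terms of odd total degree}\ge3)$, $i=1,2$, such that: $\tau_i\in\mathbb{C}\setminus\mathbb{R}$ with $\mathrm{Im}\,\tau_i>0$; $v_1(u_1,0)\ne\tau_1u_1$ and $v_2(0,u_2)\neq\tau_2u_2$ as functions; $v_1$ is odd in $u_1$ and even in $u_2$, $v_2$ is even in $u_1$ and odd in $u_2$; $\frac{\partial v_1}{\partial u_2}=a\frac{\partial v_2}{\partial u_1}$ for some $a\in\mathbb{C}$; every subgroup of $\mathrm{Aut}\,\mathcal{X}$ contained in $\mathrm{GL}_4(\mathbb{Q})$ is finite. The numbers $\tau_1,\tau_2$ are called the cusp shapes of $\mathcal{X}$; standing assumption: they belong to the same quadratic field. A matrix $M\in\mathrm{GL}_4(\mathbb{Q})$ belongs to $\mathrm{Aut}\,\mathcal{X}$ if $\mathbf{x}\mapsto M\mathbf{x}$, $\mathbf{x}=(u_1,v_1,u_2,v_2)^T$, maps (the germ at $0$ of) $\mathcal{X}$ to itself. Write $M\in\mathrm{GL}_4(\mathbb{Q})$ in $2\times2$ blocks as $\begin{pmatrix} A_1 & A_2 \\ A_3 & A_4 \end{pmatrix}$. $M$ is of Type I if $A_2=A_3=0$ and $\det A_1=\det A_4=1$; of Type II if $A_1=A_4=0$ and $\det A_2=\det A_3=1$; of Type III if all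 $\det A_j\neq0$ and $\det A_1=\det A_4$, $\det A_2=\det A_3$, $\det A_1+\det A_3=1$, $(\det A_1)A_1^{-1}A_2=-(\det A_3)A_3^{-1}A_4$. $\iota:=\begin{pmatrix} I & 0 \\ 0 & -I \end{pmatrix}$ with $I$ the $2\times2$ identity. $\mathfrak{m}_A(x)$ is the minimal polynomial of $A$ over $\mathbb{Q}$. *)

theory Defs
  imports
    "HOL-Analysis.Analysis"
    "HOL-Computational_Algebra.Polynomial"
    "HOL-Algebra.Group"
begin

section \<open>Quadratic fields\<close>

definition complex_subfield :: "complex set \<Rightarrow> bool" where
  "complex_subfield K \<longleftrightarrow>
     0 \<in> K \<and> 1 \<in> K \<and>
     (\<forall>x\<in>K. \<forall>y\<in>K. x + y \<in> K \<and> x * y \<in> K) \<and>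
     (\<forall>x\<in>K. - x \<in> K \<and> inverse x \<in> K)"

definition rat_adjoin :: "complex \<Rightarrow> complex set" where
  "rat_adjoin z = \<Inter> {K. complex_subfield K \<and> z \<in> K}"

definition quadratic_field :: "complex set \<Rightarrow> bool" where
  "quadratic_field K \<longleftrightarrow>
     complex_subfield K \<and> vector_space.dim (\<lambda>(q::rat) (z::complex). of_rat q * z) K = 2"


section \<open>Rational matrices\<close>

definition smult_matrix :: "'a::times \<Rightarrow> 'a^'n^'m \<Rightarrow> 'a^'n^'m"  (infixr "\<cdot>" 75) where
  "c \<cdot> A = map_matrix (\<lambda>x. c * x) A"

definition block :: "rat^2^2 \<Rightarrow> rat^2^2 \<Rightarrow> rat^2^2 \<Rightarrow> rat^2^2 \<Rightarrow> rat^4^4" where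
  "block A1 A2 A3 A4 = vector
     [vector [A1 $ 1 $ 1, A1 $ 1 $ 2, A2 $ 1 $ 1, A2 $ 1 $ 2],
      vector [A1 $ 2 $ 1, A1 $ 2 $ 2, A2 $ 2 $ 1, A2 $ 2 $ 2],
      vector [A3 $ 1 $ 1, A3 $ 1 $ 2, A4 $ 1 $ 1, A4 $ 1 $ 2],
      vector [A3 $ 2 $ 1, A3 $ 2 $ 2, A4 $ 2 $ 1, A4 $ 2 $ 2]]"

definition iota :: "rat^4^4" where
  "iota = block (mat 1) 0 0 (- mat 1)"

definition type_I :: "rat^4^4 \<Rightarrow> bool" where
  "type_I M \<longleftrightarrow> (\<exists>A1 A4. M = block A1 0 0 A4 \<and> det A1 = 1 \<and> det A4 = 1)"

definition type_II :: "rat^4^4 \<Rightarrow> bool" where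
  "type_II M \<longleftrightarrow> (\<exists>A2 A3. M = block 0 A2 A3 0 \<and> det A2 = 1 \<and> det A3 = 1)"

definition type_III :: "rat^4^4 \<Rightarrow> bool" where
  "type_III M \<longleftrightarrow> (\<exists>A1 A2 A3 A4. M = block A1 A2 A3 A4 \<and>
     det A1 \<noteq> 0 \<and> det A2 \<noteq> 0 \<and> det A3 \<noteq> 0 \<and> det A4 \<noteq> 0 \<and>
     det A1 = det A4 \<and> det A2 = det A3 \<and> det A1 + det A3 = 1 \<and>
     det A1 \<cdot> (matrix_inv A1 ** A2) = - (det A3 \<cdot> (matrix_inv A3 ** A4)))"

definition matrix_poly :: "rat poly \<Rightarrow> rat^'n^'n \<Rightarrow> rat^'n^'n" where
  "matrix_poly p A = (\<Sum>i\<le>degree p. coeff p i \<cdot> (((**) A ^^ i) (mat 1)))"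

definition minpoly :: "rat^'n^'n \<Rightarrow> rat poly" where
  "minpoly A = (THE p. lead_coeff p = 1 \<and> matrix_poly p A = 0 \<and>
     (\<forall>q. q \<noteq> 0 \<and> matrix_poly q A = 0 \<longrightarrow> degree p \<le> degree q))"

definition GL4 :: "(rat^4^4) monoid" where
  "GL4 = \<lparr>carrier = {M. invertible M}, monoid.mult = (**), one = mat 1\<rparr>"


section \<open>Generalized analytic holonomy sets\<close>

text \<open>
  Holomorphic germs at the origin of two complex variables are given by their convergent power
  series. The expansion below says that \<open>v\<close> is \<open>\<tau>\<close> times the monomial with exponent \<open>e\<close>
  (which is \<open>u\<^sub>1\<close> for \<open>e = (1,0)\<close> and \<open>u\<^sub>2\<close> for \<open>e = (0,1)\<close>) plus terms of odd total
  degree at least \<open>3\<close>.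
\<close>

definition power_series_at_0 ::
    "(nat \<times> nat \<Rightarrow> complex) \<Rightarrow> (complex \<times> complex \<Rightarrow> complex) \<Rightarrow> bool" where
  "power_series_at_0 c v \<longleftrightarrow> (\<exists>r>0. \<forall>u1 u2. norm u1 < r \<and> norm u2 < r \<longrightarrow>
     ((\<lambda>(j, k). c (j, k) * u1 ^ j * u2 ^ k) has_sum v (u1, u2)) UNIV)"

definition cusp_expansion ::
    "complex \<Rightarrow> nat \<times> nat \<Rightarrow> (complex \<times> complex \<Rightarrow> complex) \<Rightarrow> bool" where
  "cusp_expansion \<tau> e v \<longleftrightarrow> (\<exists>c. power_series_at_0 c v \<and> c e = \<tau> \<and>
     (\<forall>j k. (j, k) \<noteq> e \<and> c (j, k) \<noteq> 0 \<longrightarrow> odd (j + k) \<and> j + k \<ge> 3))"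

text \<open>
  Germs at \<open>0\<close> of subsets of \<open>\<complex>\<^sup>4\<close> are represented by sets, equality of germs by
  \<open>germ_eq\<close>. The entries of \<open>x :: complex^4\<close> are \<open>(u\<^sub>1, v\<^sub>1, u\<^sub>2, v\<^sub>2)\<close>.
\<close>

definition germ_eq :: "(complex^4) set \<Rightarrow> (complex^4) set \<Rightarrow> bool" where
  "germ_eq X Y \<longleftrightarrow> (\<forall>\<^sub>F x in nhds 0. x \<in> X \<longleftrightarrow> x \<in> Y)"

definition Aut :: "(complex^4) set \<Rightarrow> (rat^4^4) set" where
  "Aut X = {M. invertible M \<and> germ_eq ((\<lambda>x. map_matrix of_rat M *v x) ` X) X}"

text \<open>
  \<open>Ghol X \<tau>1 \<tau>2\<close>: the germ \<open>X\<close> is a generalized analytic holonomy set with cusp shapes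
  \<open>\<tau>1\<close> and \<open>\<tau>2\<close>. The cusp shapes are determined by the germ, which is the graph of
  \<open>(v\<^sub>1, v\<^sub>2)\<close>.
\<close>

definition Ghol :: "(complex^4) set \<Rightarrow> complex \<Rightarrow> complex \<Rightarrow> bool" where
  "Ghol X \<tau>1 \<tau>2 \<longleftrightarrow>
     Im \<tau>1 > 0 \<and> Im \<tau>2 > 0 \<and>
     (\<exists>v1 v2 :: complex \<times> complex \<Rightarrow> complex.
        germ_eq X {x. x $ 2 = v1 (x $ 1, x $ 3) \<and> x $ 4 = v2 (x $ 1, x $ 3)} \<and>
        cusp_expansion \<tau>1 (1, 0) v1 \<and> cusp_expansion \<tau>2 (0, 1) v2 \<and>
        \<not> (\<forall>\<^sub>F u in nhds 0. v1 (u, 0) = \<tau>1 * u) \<and>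
        \<not> (\<forall>\<^sub>F u in nhds 0. v2 (0, u) = \<tau>2 * u) \<and>
        (\<forall>\<^sub>F (u1, u2) in nhds (0, 0).
           v1 (- u1, u2) = - v1 (u1, u2) \<and> v1 (u1, - u2) = v1 (u1, u2) \<and>
           v2 (- u1, u2) = v2 (u1, u2) \<and> v2 (u1, - u2) = - v2 (u1, u2)) \<and>
        (\<exists>a. \<forall>\<^sub>F (u1, u2) in nhds (0, 0).
           deriv (\<lambda>w. v1 (u1, w)) u2 = a * deriv (\<lambda>w. v2 (w, u2)) u1)) \<and>
     (\<forall>H. subgroup H GL4 \<and> H \<subseteq> Aut X \<longrightarrow> finite H)"

end

(*
  An automorphism M preserves the tangent plane of X at 0, on which it acts by a complex 2x2 matrix
  with entries l1, l2, l3, l4 in the field of the cusp shapes; a rational matrix is determined by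
  this action because the cusp shapes are nonreal.  The Type III conditions say that the action
  is unitary up to scaling: with p = |l1|^2 = det A1 and q = det A2 = 1 - p there is u with |u| = 1,
  l2 l3 = q u and l4 = - u conj(l1).

  By the parity of v1 and v2 the matrix iota is an automorphism too, and Aut X is finite.  Hence M
  and iota M have finite order, and the ratios of their eigenvalues are roots of unity with rational
  real part.  This forces a = - (tr M)^2 / u and b = (tr iota M)^2 / u to be integers, where
  a + b = 4p, so that p is 1/4, 1/2 or 3/4; and ab = 4 (Im (u conj(l1)^2))^2 together with the
  irrationality of the square roots of 2, 3 and 6 ties a and b to the field.  The minimal polynomial
  of M fixes tr M and u, and the normal forms are then read off.
*)

theory Submission
  imports Defs
begin

text \<open>Why ratios of eigenvalues: the eigenvalues of the action need not lie in the field of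
  the cusp shapes, and their sum \<open>t\<close> need not be rational; but the quotient of
  \<open>t\<^sup>2\<close> by the determinant is rational, and it equals
  \<open>z + 1 / z + 2\<close> for the ratio \<open>z\<close>. Rationality comes from the diagonal
  blocks: a rational 2 by 2 matrix with eigenvector \<open>(1, \<tau>)\<close> has trace
  \<open>2 * Re z\<close>, so multipliers have rational real parts, and their imaginary parts are
  rational multiples of one number. A rational \<open>z + 1 / z\<close> is integral because squaring
  \<open>z\<close> squares its denominator, while a root of unity has only finitely many powers.

  The numbers \<open>l2\<close> and \<open>l3\<close> relate two different lines and matter only
  through their product. So the normal forms express \<open>A3\<close> and \<open>A4\<close> through
  \<open>A1\<close> and \<open>A2\<close>.

  As the action is a nonscalar 2 by 2 matrix, a rational polynomial in \<open>M\<close> vanishes iff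
  two complex equations in \<open>t\<close> and \<open>u\<close> hold. These have spurious solutions
  with \<open>t\<close> and \<open>u\<close> rational, for which the minimal polynomial of
  \<open>M\<close> would have degree at most 2; a given cubic or quartic minimal polynomial excludes
  them.\<close>

section \<open>Rational matrices acting on the tangent plane\<close>

lemma vector_4 [simp]:
  "(vector [a,b,c,d] :: 'a::zero^4) $ 1 = a" "(vector [a,b,c,d] :: 'a::zero^4) $ 2 = b"
  "(vector [a,b,c,d] :: 'a::zero^4) $ 3 = c" "(vector [a,b,c,d] :: 'a::zero^4) $ 4 = d"
  unfolding vector_def by simp_all

lemma block_nth [simp]:
  "block A1 A2 A3 A4 $ 1 $ 1 = A1 $ 1 $ 1" "block A1 A2 A3 A4 $ 1 $ 2 = A1 $ 1 $ 2"
  "block A1 A2 A3 A4 $ 1 $ 3 = A2 $ 1 $ 1" "block A1 A2 A3 A4 $ 1 $ 4 = A2 $ 1 $ 2"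
  "block A1 A2 A3 A4 $ 2 $ 1 = A1 $ 2 $ 1" "block A1 A2 A3 A4 $ 2 $ 2 = A1 $ 2 $ 2"
  "block A1 A2 A3 A4 $ 2 $ 3 = A2 $ 2 $ 1" "block A1 A2 A3 A4 $ 2 $ 4 = A2 $ 2 $ 2"
  "block A1 A2 A3 A4 $ 3 $ 1 = A3 $ 1 $ 1" "block A1 A2 A3 A4 $ 3 $ 2 = A3 $ 1 $ 2"
  "block A1 A2 A3 A4 $ 3 $ 3 = A4 $ 1 $ 1" "block A1 A2 A3 A4 $ 3 $ 4 = A4 $ 1 $ 2"
  "block A1 A2 A3 A4 $ 4 $ 1 = A3 $ 2 $ 1" "block A1 A2 A3 A4 $ 4 $ 2 = A3 $ 2 $ 2"
  "block A1 A2 A3 A4 $ 4 $ 3 = A4 $ 2 $ 1" "block A1 A2 A3 A4 $ 4 $ 4 = A4 $ 2 $ 2"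
  unfolding block_def by simp_all

lemma block_eq_iff:
  "block A1 A2 A3 A4 = block B1 B2 B3 B4 \<longleftrightarrow> A1 = B1 \<and> A2 = B2 \<and> A3 = B3 \<and> A4 = B4"
  by (auto simp: vec_eq_iff forall_4 forall_2)

lemma block_mult:
  "block A1 A2 A3 A4 ** block B1 B2 B3 B4 =
     block (A1 ** B1 + A2 ** B3) (A1 ** B2 + A2 ** B4) (A3 ** B1 + A4 ** B3) (A3 ** B2 + A4 ** B4)"
  by (simp add: vec_eq_iff forall_4 forall_2 matrix_matrix_mult_def sum_4 sum_2)

text \<open>
  The tangent plane of the holonomy set at the origin is spanned by \<open>(1, \<tau>\<^sub>1, 0, 0)\<close> and
  \<open>(0, 0, 1, \<tau>\<^sub>2)\<close>, so each block of an automorphism sends some \<open>(1, \<sigma>)\<close> to a multiple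
  \<open>z\<close> of some \<open>(1, \<tau>)\<close>.
\<close>

definition acts :: "complex \<Rightarrow> complex \<Rightarrow> rat^2^2 \<Rightarrow> complex \<Rightarrow> bool" where
  "acts \<sigma> \<tau> A z \<longleftrightarrow>
     of_rat (A $ 1 $ 1) + of_rat (A $ 1 $ 2) * \<sigma> = z \<and>
     of_rat (A $ 2 $ 1) + of_rat (A $ 2 $ 2) * \<sigma> = z * \<tau>"

lemma complex_of_rat_eq: "of_rat x = complex_of_real (of_rat x)"
  by (cases x) (simp add: of_rat_rat)

text \<open>Comparing imaginary parts, 1 and the nonreal \<open>\<sigma>\<close> are independent
  over the rationals. Every return from complex multipliers to rational matrices rests on
  this.\<close>

lemma of_rat_add_mult_eq_0:
  assumes "Im \<sigma> \<noteq> 0"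
  shows "of_rat a + of_rat b * \<sigma> = 0 \<longleftrightarrow> a = 0 \<and> b = 0"
proof
  assume h: "of_rat a + of_rat b * \<sigma> = 0"
  note of_rat = complex_of_rat_eq
  have "Im (of_rat a + of_rat b * \<sigma>) = of_rat b * Im \<sigma>"
    unfolding of_rat by simp
  with h assms have "b = 0" by simp
  with h show "a = 0 \<and> b = 0" by simp
qed simp

lemma of_rat_add_mult_eq_iff:
  assumes "Im \<sigma> \<noteq> 0"
  shows "of_rat a + of_rat b * \<sigma> = of_rat c + of_rat d * \<sigma> \<longleftrightarrow> a = c \<and> b = d"
  using of_rat_add_mult_eq_0[OF assms, of "a - c" "b - d"]
  by (auto simp: of_rat_diff algebra_simps)

text \<open>Both rows are rational combinations of 1 and \<open>\<sigma>\<close>. Equalities of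
  blocks are later proved by computing one complex number on each side.\<close>

lemma acts_inj:
  assumes "Im \<sigma> \<noteq> 0" "acts \<sigma> \<tau> A z" "acts \<sigma> \<tau> B z"
  shows "A = B"
proof -
  have "of_rat (A $ 1 $ 1) + of_rat (A $ 1 $ 2) * \<sigma> = of_rat (B $ 1 $ 1) + of_rat (B $ 1 $ 2) * \<sigma>"
    "of_rat (A $ 2 $ 1) + of_rat (A $ 2 $ 2) * \<sigma> = of_rat (B $ 2 $ 1) + of_rat (B $ 2 $ 2) * \<sigma>"
    using assms(2,3) by (simp_all add: acts_def)
  then show ?thesis
    unfolding of_rat_add_mult_eq_iff[OF assms(1)] by (simp add: vec_eq_iff forall_2)
qed

lemma acts_unique: "acts \<sigma> \<tau> A z \<Longrightarrow> acts \<sigma> \<tau> A w \<Longrightarrow> z = w"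
  by (simp add: acts_def)

lemma acts_mult:
  assumes "acts \<sigma> \<tau> A z" "acts \<rho> \<sigma> B w"
  shows "acts \<rho> \<tau> (A ** B) (z * w)"
proof -
  define a b c d where "a = (of_rat (A $ 1 $ 1) :: complex)" "b = (of_rat (A $ 1 $ 2) :: complex)"
    "c = (of_rat (A $ 2 $ 1) :: complex)" "d = (of_rat (A $ 2 $ 2) :: complex)"
  define e f g h where "e = (of_rat (B $ 1 $ 1) :: complex)" "f = (of_rat (B $ 1 $ 2) :: complex)"
    "g = (of_rat (B $ 2 $ 1) :: complex)" "h = (of_rat (B $ 2 $ 2) :: complex)"
  note defs = a_b_c_d_def e_f_g_h_def
  have 1: "a + b * \<sigma> = z" "c + d * \<sigma> = z * \<tau>" "e + f * \<rho> = w" "g + h * \<rho> = w * \<sigma>"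
    using assms unfolding acts_def defs by auto
  have "(a * e + b * g) + (a * f + b * h) * \<rho> = a * (e + f * \<rho>) + b * (g + h * \<rho>)"
    by (simp add: algebra_simps)
  also have "\<dots> = (a + b * \<sigma>) * w"
    unfolding 1(3,4) by (simp add: algebra_simps)
  finally have 2: "(a * e + b * g) + (a * f + b * h) * \<rho> = z * w" unfolding 1 .
  have "(c * e + d * g) + (c * f + d * h) * \<rho> = c * (e + f * \<rho>) + d * (g + h * \<rho>)"
    by (simp add: algebra_simps)
  also have "\<dots> = (c + d * \<sigma>) * w"
    unfolding 1(3,4) by (simp add: algebra_simps)
  finally have 3: "(c * e + d * g) + (c * f + d * h) * \<rho> = z * \<tau> * w" unfolding 1 .
  show ?thesis
    using 2 3 unfolding acts_def defs
    by (simp add: matrix_matrix_mult_def sum_2 of_rat_add of_rat_mult mult_ac)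
qed

lemma acts_add:
  "acts \<sigma> \<tau> A z \<Longrightarrow> acts \<sigma> \<tau> B w \<Longrightarrow> acts \<sigma> \<tau> (A + B) (z + w)"
  by (auto simp: acts_def of_rat_add algebra_simps)

lemma acts_minus: "acts \<sigma> \<tau> A z \<Longrightarrow> acts \<sigma> \<tau> (- A) (- z)"
  by (auto simp: acts_def of_rat_minus algebra_simps)

lemma smult_matrix_nth [simp]: "(c \<cdot> A) $ i $ j = c * A $ i $ j"
  by (simp add: smult_matrix_def)

lemma acts_smult: "acts \<sigma> \<tau> A z \<Longrightarrow> acts \<sigma> \<tau> (c \<cdot> A) (of_rat c * z)"
  by (auto simp: acts_def of_rat_mult mult.assoc simp flip: distrib_left)

lemma acts_mat: "acts \<tau> \<tau> (mat c) (of_rat c)"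
  by (auto simp: acts_def mat_def)

lemma acts_zero: "acts \<sigma> \<tau> 0 0"
  by (auto simp: acts_def)

text \<open>With \<open>z = a + b * \<tau>\<close> and \<open>a\<close>, \<open>b\<close> rational,
  a real \<open>z\<close> forces \<open>b = 0\<close>. This turns the condition that
  \<open>A1\<close> is not scalar into \<open>Im l1 \<noteq> 0\<close>.\<close>

lemma acts_scalar_iff:
  assumes "Im \<tau> \<noteq> 0" "acts \<tau> \<tau> A z"
  shows "(\<exists>c. A = mat c) \<longleftrightarrow> Im z = 0"
proof
  assume "\<exists>c. A = mat c"
  then obtain c where "A = mat c" by auto
  with acts_mat[of \<tau> c] assms have "z = of_rat c"
    using acts_unique by metis
  also have "of_rat c = complex_of_real (of_rat c)" by (rule complex_of_rat_eq)
  finally show "Im z = 0" by simp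
next
  assume "Im z = 0"
  note of_rat = complex_of_rat_eq
  have "z = of_rat (A $ 1 $ 1) + of_rat (A $ 1 $ 2) * \<tau>"
    using assms by (simp add: acts_def)
  then have "Im z = of_rat (A $ 1 $ 2) * Im \<tau>" unfolding of_rat by simp
  with \<open>Im z = 0\<close> assms have "z = of_rat (A $ 1 $ 1)"
    using \<open>z = _\<close> by simp
  with acts_mat[of \<tau> "A $ 1 $ 1"] acts_inj assms show "\<exists>c. A = mat c" by metis
qed

text \<open>On vectors \<open>(x, y)\<close> the number \<open>Im (cnj x * y)\<close> is an area
  form, multiplied by \<open>det A\<close> under a real matrix. It is \<open>Im \<sigma>\<close> on
  \<open>(1, \<sigma>)\<close> and \<open>(cmod z)\<^sup>2 * Im \<tau>\<close> on \<open>z\<close>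
  times \<open>(1, \<tau>)\<close>.\<close>

lemma acts_det:
  assumes "acts \<sigma> \<tau> A z"
  shows "of_rat (det A) * Im \<sigma> = (cmod z)\<^sup>2 * Im \<tau>"
proof -
  note of_rat = complex_of_rat_eq
  define a b c d where "a = (of_rat (A $ 1 $ 1) :: real)" "b = (of_rat (A $ 1 $ 2) :: real)"
    "c = (of_rat (A $ 2 $ 1) :: real)" "d = (of_rat (A $ 2 $ 2) :: real)"
  have 1: "a + b * \<sigma> = z" "c + d * \<sigma> = z * \<tau>"
    using assms unfolding acts_def a_b_c_d_def of_rat by auto
  have "(cmod z)\<^sup>2 * Im \<tau> = Im (cnj z * (z * \<tau>))"
    unfolding cmod_power2 by (simp add: power2_eq_square algebra_simps)
  also have "\<dots> = Im (cnj (a + b * \<sigma>) * (c + d * \<sigma>))"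
    by (simp only: 1)
  also have "\<dots> = (a * d - b * c) * Im \<sigma>"
    by (simp add: algebra_simps)
  also have "a * d - b * c = of_rat (det A)"
    unfolding a_b_c_d_def by (simp add: det_2 of_rat_diff of_rat_mult)
  finally show ?thesis by simp
qed

text \<open>The vector \<open>(1, \<tau>)\<close> and its conjugate are eigenvectors of the rational
  matrix \<open>A\<close>, with eigenvalues \<open>z\<close> and \<open>cnj z\<close>.\<close>

lemma acts_trace:
  assumes "acts \<tau> \<tau> A z" "Im \<tau> \<noteq> 0"
  shows "2 * Re z = of_rat (A $ 1 $ 1 + A $ 2 $ 2)"
proof -
  note of_rat = complex_of_rat_eq
  define a b c d where "a = (of_rat (A $ 1 $ 1) :: real)" "b = (of_rat (A $ 1 $ 2) :: real)"
    "c = (of_rat (A $ 2 $ 1) :: real)" "d = (of_rat (A $ 2 $ 2) :: real)"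
  have 1: "a + b * \<tau> = z" "c + d * \<tau> = z * \<tau>"
    using assms unfolding acts_def a_b_c_d_def of_rat by auto
  from 1(1) have im: "Im z = b * Im \<tau>" and re: "Re z = a + b * Re \<tau>" by auto
  from 1(2) have "Im (c + d * \<tau>) = Im (z * \<tau>)" by simp
  then have "d * Im \<tau> = Re z * Im \<tau> + b * Im \<tau> * Re \<tau>" by (simp add: im)
  then have "Im \<tau> * (d - (Re z + b * Re \<tau>)) = 0" by (simp add: algebra_simps)
  with assms have "d = Re z + b * Re \<tau>" by simp
  with re have "2 * Re z = a + d" by simp
  then show ?thesis by (simp add: a_b_c_d_def of_rat_add)
qed

lemma acts_ne_0:
  assumes "acts \<sigma> \<tau> A z" "Im \<sigma> \<noteq> 0" "A \<noteq> 0"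
  shows "z \<noteq> 0"
  using assms acts_inj acts_zero by blast

lemma acts_matrix_inv:
  assumes "acts \<sigma> \<tau> A z" "det A \<noteq> 0" "z \<noteq> 0"
  shows "acts \<tau> \<sigma> (matrix_inv A) (inverse z)"
proof -
  define B where "B = matrix_inv A"
  have "invertible A" using assms(2) by (simp add: invertible_det_nz)
  then have BA: "B ** A = mat 1"
    unfolding B_def matrix_inv_def invertible_def by (rule someI2_ex) simp
  then have 0: "(B ** A) $ i $ j = (mat 1 :: rat^2^2) $ i $ j" for i j by simp
  have 1: "of_rat (B $ i $ 1) * of_rat (A $ 1 $ j) + of_rat (B $ i $ 2) * of_rat (A $ 2 $ j)
      = (if i = j then 1 else 0 :: complex)" for i j
  proof -
    have "of_rat ((B ** A) $ i $ j) = (of_rat ((mat 1 :: rat^2^2) $ i $ j) :: complex)"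
      by (simp only: 0)
    then show ?thesis
      by (simp add: matrix_matrix_mult_def sum_2 mat_def of_rat_add of_rat_mult split: if_splits)
  qed
  define a b c d where "a = (of_rat (A $ 1 $ 1) :: complex)" "b = (of_rat (A $ 1 $ 2) :: complex)"
    "c = (of_rat (A $ 2 $ 1) :: complex)" "d = (of_rat (A $ 2 $ 2) :: complex)"
  define e f g h where "e = (of_rat (B $ 1 $ 1) :: complex)" "f = (of_rat (B $ 1 $ 2) :: complex)"
    "g = (of_rat (B $ 2 $ 1) :: complex)" "h = (of_rat (B $ 2 $ 2) :: complex)"
  have 2: "e * a + f * c = 1" "e * b + f * d = 0" "g * a + h * c = 0" "g * b + h * d = 1"
    using 1[of 1 1] 1[of 1 2] 1[of 2 1] 1[of 2 2] by (auto simp: a_b_c_d_def e_f_g_h_def)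
  have 3: "a + b * \<sigma> = z" "c + d * \<sigma> = z * \<tau>"
    using assms unfolding acts_def a_b_c_d_def by auto
  have "z * (e + f * \<tau>) = e * (a + b * \<sigma>) + f * (c + d * \<sigma>)"
    unfolding 3 by (simp add: algebra_simps)
  also have "\<dots> = (e * a + f * c) + (e * b + f * d) * \<sigma>" by (simp add: algebra_simps)
  finally have 4: "z * (e + f * \<tau>) = 1" unfolding 2 by simp
  have "z * (g + h * \<tau>) = g * (a + b * \<sigma>) + h * (c + d * \<sigma>)"
    unfolding 3 by (simp add: algebra_simps)
  also have "\<dots> = (g * a + h * c) + (g * b + h * d) * \<sigma>" by (simp add: algebra_simps)
  finally have 5: "z * (g + h * \<tau>) = \<sigma>" unfolding 2 by simp
  have "e + f * \<tau> = inverse z" "g + h * \<tau> = inverse z * \<sigma>"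
    using 4 5 assms(3) by (auto simp: field_simps)
  then show ?thesis unfolding acts_def B_def[symmetric] a_b_c_d_def e_f_g_h_def by simp
qed

lemma smult_matrix_distrib [simp]:
  fixes A B :: "'a::comm_ring_1^'n^'m"
  shows "(a + b) \<cdot> A = a \<cdot> A + b \<cdot> A" "(a - b) \<cdot> A = a \<cdot> A - b \<cdot> A"
    "a \<cdot> (A + B) = a \<cdot> A + a \<cdot> B"
    "0 \<cdot> A = 0" "1 \<cdot> A = A" "a \<cdot> (0 :: 'a^'n^'m) = 0"
    "a \<cdot> (b \<cdot> A) = (a * b) \<cdot> A"
  by (simp_all add: vec_eq_iff algebra_simps)

lemma smult_matrix_sum: "(a :: 'a::comm_ring_1) \<cdot> sum f S = (\<Sum>i\<in>S. a \<cdot> f i)"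
  by (simp add: vec_eq_iff sum_distrib_left)

lemma smult_matrix_mult_right:
  fixes A :: "'a::comm_ring_1^'n^'m" and B :: "'a^'k^'n"
  shows "A ** (a \<cdot> B) = a \<cdot> (A ** B)"
  by (simp add: vec_eq_iff matrix_matrix_mult_def sum_distrib_left mult_ac)

section \<open>Minimal polynomials of rational matrices\<close>

text \<open>Padding with zero coefficients gives polynomials of different degrees a common summation
  range, and lets \<open>[:c, b, 1:]\<close> be read as \<open>[:c, b, 1, 0, 0:]\<close>.\<close>

lemma matrix_poly_altdef:
  assumes "degree p \<le> n"
  shows "matrix_poly p A = (\<Sum>i\<le>n. coeff p i \<cdot> (((**) A ^^ i) (mat 1)))"
  unfolding matrix_poly_def
  by (rule sum.mono_neutral_left) (use assms in \<open>auto simp: coeff_eq_0\<close>)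

lemma matrix_poly_diff: "matrix_poly (p - q) A = matrix_poly p A - matrix_poly q A"
proof -
  define n where "n = max (degree p) (degree q)"
  have "degree p \<le> n" "degree q \<le> n" "degree (p - q) \<le> n"
    using degree_diff_le_max[of p q] by (auto simp: n_def)
  then show ?thesis
    by (simp add: matrix_poly_altdef sum_subtractf)
qed

lemma matrix_poly_smult: "matrix_poly (smult c p) A = c \<cdot> matrix_poly p A"
proof -
  have "matrix_poly (smult c p) A = (\<Sum>i\<le>degree p. coeff (smult c p) i \<cdot> (((**) A ^^ i) (mat 1)))"
    by (rule matrix_poly_altdef) (rule degree_smult_le)
  then show ?thesis by (simp add: matrix_poly_def smult_matrix_sum)
qed

definition is_minpoly :: "rat poly \<Rightarrow> rat^'n^'n \<Rightarrow> bool" where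
  "is_minpoly p A \<longleftrightarrow> lead_coeff p = 1 \<and> matrix_poly p A = 0 \<and>
     (\<forall>q. q \<noteq> 0 \<and> matrix_poly q A = 0 \<longrightarrow> degree p \<le> degree q)"

text \<open>The difference of two monic annihilators of the same least degree would be an
  annihilator of smaller degree.\<close>

lemma is_minpoly_unique:
  assumes "is_minpoly p A" "is_minpoly q A"
  shows "p = q"
proof (rule ccontr)
  assume "p \<noteq> q"
  have nz: "p \<noteq> 0" "q \<noteq> 0" using assms by (auto simp: is_minpoly_def)
  have deg: "degree p = degree q"
    using assms nz by (auto simp: is_minpoly_def intro: order.antisym)
  have "degree (p - q) \<le> degree p" using degree_diff_le_max[of p q] deg by simp
  moreover have "coeff (p - q) (degree p) = 0"
    using assms deg by (simp add: is_minpoly_def)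
  ultimately have "degree (p - q) < degree p"
    using \<open>p \<noteq> q\<close> by (metis eq_iff_diff_eq_0 leading_coeff_0_iff order_le_less)
  moreover have "degree p \<le> degree (p - q)"
    using assms \<open>p \<noteq> q\<close> by (auto simp: is_minpoly_def matrix_poly_diff)
  ultimately show False by simp
qed

lemma minpoly_eqI: "is_minpoly p A \<Longrightarrow> minpoly A = p"
  using is_minpoly_unique unfolding minpoly_def is_minpoly_def by (intro the_equality) blast+

text \<open>The definite description in \<open>minpoly\<close> only has content once some nonzero
  annihilator is known; finite order will supply \<open>monom 1 n - 1\<close>.\<close>

lemma is_minpoly_minpoly:
  assumes "q \<noteq> 0" "matrix_poly q A = 0"
  shows "is_minpoly (minpoly A) A"
proof -
  obtain p where p: "p \<noteq> 0 \<and> matrix_poly p A = 0"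
      "\<And>r. r \<noteq> 0 \<and> matrix_poly r A = 0 \<Longrightarrow> degree p \<le> degree r"
    using ex_has_least_nat[of "\<lambda>p. p \<noteq> 0 \<and> matrix_poly p A = 0" q degree] assms by metis
  have "is_minpoly (smult (inverse (lead_coeff p)) p) A"
    unfolding is_minpoly_def using p by (auto simp: matrix_poly_smult)
  then show ?thesis using minpoly_eqI by metis
qed

text \<open>Five coefficients suffice, as no minimal polynomial in the theorem has degree above
  4.\<close>

lemma matrix_poly_pCons_4:
  "matrix_poly [:c0, c1, c2, c3, c4:] A = c0 \<cdot> mat 1 + c1 \<cdot> A + c2 \<cdot> (A ** A) +
     c3 \<cdot> (A ** (A ** A)) + c4 \<cdot> (A ** (A ** (A ** A)))"
proof -
  have "degree [:c0, c1, c2, c3, c4:] \<le> 4"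
    by (intro degree_pCons_le[THEN order.trans]) simp_all
  from matrix_poly_altdef[OF this] show ?thesis
    by (simp add: numeral_eq_Suc)
qed

lemma matrix_poly_annihilator_of_order:
  assumes "((**) A ^^ n) (mat 1) = mat 1" "n > 0"
  shows "matrix_poly (monom 1 n - 1) A = 0" "monom 1 n - 1 \<noteq> (0 :: rat poly)"
proof -
  have "matrix_poly (monom 1 n) A = (\<Sum>i\<le>n. coeff (monom 1 n) i \<cdot> (((**) A ^^ i) (mat 1)))"
    by (rule matrix_poly_altdef) (simp add: degree_monom_le)
  also have "\<dots> = ((**) A ^^ n) (mat 1)"
    by (subst sum.remove[of _ n]) (auto intro!: sum.neutral)
  finally have "matrix_poly (monom 1 n) A = mat 1" using assms by simp
  moreover have "matrix_poly 1 A = mat 1" by (simp add: matrix_poly_def)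
  ultimately show "matrix_poly (monom 1 n - 1) A = 0" by (simp add: matrix_poly_diff)
  have "coeff (monom 1 n - 1) n \<noteq> (0 :: rat)" using assms(2) by simp
  then show "monom 1 n - 1 \<noteq> (0 :: rat poly)" by (metis coeff_0)
qed

lemma minpoly_quadratic:
  assumes "\<nexists>c. A = mat c" "A ** A + b \<cdot> A + c \<cdot> mat 1 = 0"
  shows "minpoly A = [:c, b, 1:]"
proof (rule minpoly_eqI, unfold is_minpoly_def, intro conjI allI impI)
  have "matrix_poly [:c, b, 1:] A = matrix_poly [:c, b, 1, 0, 0:] A" by simp
  also have "\<dots> = 0" unfolding matrix_poly_pCons_4 using assms(2) by (simp add: add_ac)
  finally show "matrix_poly [:c, b, 1:] A = 0" .
next
  fix q assume q: "q \<noteq> 0 \<and> matrix_poly q A = 0"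
  show "degree [:c, b, 1:] \<le> degree q"
  proof (rule ccontr)
    assume "\<not> ?thesis"
    then have "degree q \<le> 1" by simp
    from matrix_poly_altdef[OF this, of A] q
    have eq: "coeff q 0 \<cdot> mat 1 + coeff q 1 \<cdot> A = 0" by simp
    have "coeff q 1 \<noteq> 0"
    proof
      assume "coeff q 1 = 0"
      \<comment> \<open>Any diagonal entry will do; \<open>undefined\<close> names some element of
        the index type.\<close>
      with eq have "(coeff q 0 \<cdot> (mat 1 :: rat^'a^'a)) $ undefined $ undefined = 0" by simp
      then have "coeff q 0 = 0" by (simp add: mat_def)
      with \<open>coeff q 1 = 0\<close> have "coeff q i = 0" for i
        using \<open>degree q \<le> 1\<close> by (cases "i = 0"; cases "i = 1") (auto simp: coeff_eq_0)
      with q show False by (simp add: poly_eq_iff)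
    qed
    have "A = mat (- coeff q 0 / coeff q 1)"
      unfolding vec_eq_iff
    proof (intro allI)
      fix i j
      have "coeff q 0 * mat 1 $ i $ j + coeff q 1 * A $ i $ j = 0"
        using arg_cong[OF eq, of "\<lambda>B. B $ i $ j"] by simp
      then show "A $ i $ j = mat (- coeff q 0 / coeff q 1) $ i $ j"
        using \<open>coeff q 1 \<noteq> 0\<close> by (auto simp: mat_def field_simps split: if_splits)
    qed
    with assms(1) show False by blast
  qed
qed simp

section \<open>The action on the tangent plane\<close>

definition emb :: "complex \<Rightarrow> complex \<Rightarrow> complex^2 \<Rightarrow> complex^4" where
  "emb \<sigma> \<tau> v = vector [v $ 1, \<sigma> * v $ 1, v $ 2, \<tau> * v $ 2]"

text \<open>Restriction to an invariant plane, \<open>N\<close> being the matrix in the coordinates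
  of \<open>emb\<close>. A relation needs no inverse of \<open>emb\<close> and does not presuppose
  that \<open>M\<close> preserves the plane.\<close>

definition rep :: "complex \<Rightarrow> complex \<Rightarrow> rat^4^4 \<Rightarrow> complex^2^2 \<Rightarrow> bool" where
  "rep \<sigma> \<tau> M N \<longleftrightarrow> (\<forall>v. map_matrix of_rat M *v emb \<sigma> \<tau> v = emb \<sigma> \<tau> (N *v v))"

lemma emb_linear:
  "emb \<sigma> \<tau> (v + w) = emb \<sigma> \<tau> v + emb \<sigma> \<tau> w" "emb \<sigma> \<tau> (c *s v) = c *s emb \<sigma> \<tau> v"
  by (simp_all add: emb_def vec_eq_iff forall_4 algebra_simps)

lemma emb_inj: "emb \<sigma> \<tau> v = emb \<sigma> \<tau> w \<Longrightarrow> v = w"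
  by (simp add: emb_def vec_eq_iff forall_4 forall_2)

lemma map_matrix_mult:
  "map_matrix of_rat (A ** B) = map_matrix of_rat A ** (map_matrix of_rat B :: 'a::field_char_0^'k^'n)"
  by (simp add: vec_eq_iff matrix_matrix_mult_def of_rat_sum of_rat_mult)

lemma map_matrix_mat: "map_matrix of_rat (mat 1) = (mat 1 :: 'a::field_char_0^'n^'n)"
  by (simp add: vec_eq_iff mat_def)

lemma rep_mult: "rep \<sigma> \<tau> M N \<Longrightarrow> rep \<sigma> \<tau> M' N' \<Longrightarrow> rep \<sigma> \<tau> (M ** M') (N ** N')"
  by (simp add: rep_def map_matrix_mult matrix_vector_mul_assoc[symmetric])

lemma rep_mat_1: "rep \<sigma> \<tau> (mat 1) (mat 1)"
  by (simp add: rep_def map_matrix_mat)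

lemma rep_zero: "rep \<sigma> \<tau> 0 0"
  by (simp add: rep_def emb_def vec_eq_iff forall_4 matrix_vector_mult_def)

lemma rep_add: "rep \<sigma> \<tau> M N \<Longrightarrow> rep \<sigma> \<tau> M' N' \<Longrightarrow> rep \<sigma> \<tau> (M + M') (N + N')"
proof -
  have "map_matrix of_rat (M + M') = map_matrix of_rat M + (map_matrix of_rat M' :: complex^4^4)"
    by (simp add: vec_eq_iff of_rat_add)
  then show "rep \<sigma> \<tau> M N \<Longrightarrow> rep \<sigma> \<tau> M' N' \<Longrightarrow> rep \<sigma> \<tau> (M + M') (N + N')"
    by (simp add: rep_def matrix_vector_mult_add_rdistrib emb_linear)
qed

lemma rep_smult: "rep \<sigma> \<tau> M N \<Longrightarrow> rep \<sigma> \<tau> (c \<cdot> M) (of_rat c \<cdot> N)"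
proof -
  have "map_matrix of_rat (c \<cdot> M) *v v = of_rat c *s (map_matrix of_rat M *v v :: complex^4)" for v
    by (simp add: vec_eq_iff matrix_vector_mult_def of_rat_mult sum_distrib_left mult.assoc)
  moreover have "(of_rat c \<cdot> N) *v v = of_rat c *s (N *v v)" for v
    by (simp add: vec_eq_iff matrix_vector_mult_def sum_distrib_left mult.assoc)
  ultimately show "rep \<sigma> \<tau> M N \<Longrightarrow> rep \<sigma> \<tau> (c \<cdot> M) (of_rat c \<cdot> N)"
    by (simp add: rep_def emb_linear)
qed

lemma rep_unique: "rep \<sigma> \<tau> M N \<Longrightarrow> rep \<sigma> \<tau> M N' \<Longrightarrow> N = N'"
  unfolding rep_def matrix_eq by (metis emb_inj)

text \<open>On each of the two basis vectors a row of \<open>M\<close> becomes a rational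
  combination of 1 and a nonreal number. Hence a rational polynomial annihilates \<open>M\<close>
  iff it annihilates the 2 by 2 matrix \<open>N\<close>.\<close>

lemma rep_eq_0_iff:
  assumes "Im \<sigma> \<noteq> 0" "Im \<tau> \<noteq> 0" "rep \<sigma> \<tau> M N"
  shows "M = 0 \<longleftrightarrow> N = 0"
proof
  assume "N = 0"
  with assms have 0: "map_matrix of_rat M *v emb \<sigma> \<tau> v = 0" for v
    by (simp add: rep_def emb_def vec_eq_iff forall_4)
  have "(map_matrix of_rat M *v emb \<sigma> \<tau> (vector [1, 0])) $ i = 0"
       "(map_matrix of_rat M *v emb \<sigma> \<tau> (vector [0, 1])) $ i = 0" for i
    using 0 by simp_all
  then have "M $ i $ 1 = 0 \<and> M $ i $ 2 = 0" "M $ i $ 3 = 0 \<and> M $ i $ 4 = 0" for i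
    using of_rat_add_mult_eq_0[OF assms(1), of "M $ i $ 1" "M $ i $ 2"]
      of_rat_add_mult_eq_0[OF assms(2), of "M $ i $ 3" "M $ i $ 4"]
    by (simp_all add: emb_def matrix_vector_mult_def sum_4)
  then show "M = 0" by (simp add: vec_eq_iff forall_4)
qed (use assms rep_zero rep_unique in blast)

lemma rep_block:
  assumes "acts \<sigma> \<sigma> A1 l1" "acts \<tau> \<sigma> A2 l2" "acts \<sigma> \<tau> A3 l3" "acts \<tau> \<tau> A4 l4"
  shows "rep \<sigma> \<tau> (block A1 A2 A3 A4) (vector [vector [l1, l2], vector [l3, l4]])"
proof -
  have 1: "of_rat (A $ 1 $ 1) * x + of_rat (A $ 1 $ 2) * (\<rho> * x) = z * x"
    "of_rat (A $ 2 $ 1) * x + of_rat (A $ 2 $ 2) * (\<rho> * x) = \<rho>' * (z * x)"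
    if "acts \<rho> \<rho>' A z" for A z x \<rho> \<rho>'
  proof -
    have "of_rat (A $ 1 $ 1) * x + of_rat (A $ 1 $ 2) * (\<rho> * x) =
        (of_rat (A $ 1 $ 1) + of_rat (A $ 1 $ 2) * \<rho>) * x"
      "of_rat (A $ 2 $ 1) * x + of_rat (A $ 2 $ 2) * (\<rho> * x) =
        (of_rat (A $ 2 $ 1) + of_rat (A $ 2 $ 2) * \<rho>) * x"
      by (simp_all add: algebra_simps)
    then show "of_rat (A $ 1 $ 1) * x + of_rat (A $ 1 $ 2) * (\<rho> * x) = z * x"
      "of_rat (A $ 2 $ 1) * x + of_rat (A $ 2 $ 2) * (\<rho> * x) = \<rho>' * (z * x)"
      using that by (simp_all add: acts_def)
  qed
  \<comment> \<open>Pairing the four terms lets the equations \<open>1\<close> rewrite the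
    contribution of each block.\<close>
  have sum_4': "sum f (UNIV :: 4 set) = (f 1 + f 2) + (f 3 + f 4)" for f :: "4 \<Rightarrow> complex"
    by (simp add: sum_4 add.assoc)
  show ?thesis
    unfolding rep_def
    by (simp add: vec_eq_iff forall_4 emb_def matrix_vector_mult_def sum_4' sum_2 distrib_left
        1[OF assms(1)] 1[OF assms(2)] 1[OF assms(3)] 1[OF assms(4)])
qed

lemma rep_power: "rep \<sigma> \<tau> M N \<Longrightarrow> rep \<sigma> \<tau> (((**) M ^^ n) (mat 1)) (((**) N ^^ n) (mat 1))"
  by (induction n) (simp_all add: rep_mat_1 rep_mult)

lemma cayley_hamilton_2:
  fixes N :: "complex^2^2"
  shows "N ** N = (N $ 1 $ 1 + N $ 2 $ 2) \<cdot> N + (- det N) \<cdot> mat 1"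
  by (simp add: vec_eq_iff forall_2 matrix_matrix_mult_def sum_2 det_2 mat_def algebra_simps)

text \<open>Cayley-Hamilton, as \<open>N\<^sup>2 = t N + u\<close>, reduces the polynomial to
  \<open>P N + Q\<close>. The nonzero off-diagonal entry makes \<open>N\<close> nonscalar, so both
  coefficients must vanish.\<close>

lemma matrix_poly_eq_0_iff_rep:
  assumes "Im \<sigma> \<noteq> 0" "Im \<tau> \<noteq> 0" "rep \<sigma> \<tau> M N" "N $ 1 $ 2 \<noteq> 0"
  defines "t \<equiv> N $ 1 $ 1 + N $ 2 $ 2" and "u \<equiv> - det N"
  shows "matrix_poly [:c0, c1, c2, c3, c4:] M = 0 \<longleftrightarrow>
    of_rat c1 + of_rat c2 * t + of_rat c3 * (t^2 + u) + of_rat c4 * (t^3 + 2 * t * u) = 0 \<and>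
    of_rat c0 + of_rat c2 * u + of_rat c3 * t * u + of_rat c4 * (t^2 * u + u^2) = 0"
    (is "_ \<longleftrightarrow> ?P = 0 \<and> ?Q = 0")
proof -
  have N2: "N ** N = t \<cdot> N + u \<cdot> mat 1"
    unfolding t_def u_def by (rule cayley_hamilton_2)
  have N3: "N ** (N ** N) = (t^2 + u) \<cdot> N + (t * u) \<cdot> mat 1"
    unfolding N2 matrix_add_ldistrib smult_matrix_mult_right
    by (simp add: N2 vec_eq_iff power2_eq_square algebra_simps)
  have N4: "N ** (N ** (N ** N)) = (t^3 + 2 * t * u) \<cdot> N + (t^2 * u + u^2) \<cdot> mat 1"
    unfolding N3 matrix_add_ldistrib smult_matrix_mult_right
    by (simp add: N2 vec_eq_iff power2_eq_square power3_eq_cube algebra_simps)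
  have "rep \<sigma> \<tau> (matrix_poly [:c0, c1, c2, c3, c4:] M)
     (of_rat c0 \<cdot> mat 1 + of_rat c1 \<cdot> N + of_rat c2 \<cdot> (N ** N) +
     of_rat c3 \<cdot> (N ** (N ** N)) + of_rat c4 \<cdot> (N ** (N ** (N ** N))))"
    unfolding matrix_poly_pCons_4
    by (intro rep_add rep_smult rep_mult rep_mat_1 assms)
  also have "(of_rat c0 \<cdot> mat 1 + of_rat c1 \<cdot> N + of_rat c2 \<cdot> (N ** N) +
     of_rat c3 \<cdot> (N ** (N ** N)) + of_rat c4 \<cdot> (N ** (N ** (N ** N)))) = ?P \<cdot> N + ?Q \<cdot> mat 1"
    by (subst N4, subst N3, subst N2) (simp add: vec_eq_iff algebra_simps)
  finally have rep: "rep \<sigma> \<tau> (matrix_poly [:c0, c1, c2, c3, c4:] M) (?P \<cdot> N + ?Q \<cdot> mat 1)" .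
  have "matrix_poly [:c0, c1, c2, c3, c4:] M = 0 \<longleftrightarrow> ?P \<cdot> N + ?Q \<cdot> mat 1 = 0"
    by (rule rep_eq_0_iff[OF assms(1,2) rep])
  also have "\<dots> \<longleftrightarrow> ?P = 0 \<and> ?Q = 0"
  proof
    assume *: "?P \<cdot> N + ?Q \<cdot> mat 1 = 0"
    have "(?P \<cdot> N + ?Q \<cdot> mat 1) $ 1 $ 2 = 0" by (simp only: *) simp
    then have "?P = 0"
      using assms(4) by (simp add: mat_def del: smult_matrix_distrib)
    have "(?P \<cdot> N + ?Q \<cdot> mat 1) $ 1 $ 1 = 0" by (simp only: *) simp
    then have "?Q = 0" unfolding \<open>?P = 0\<close> by (simp add: mat_def)
    with \<open>?P = 0\<close> show "?P = 0 \<and> ?Q = 0" by blast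
  next
    assume "?P = 0 \<and> ?Q = 0"
    then show "?P \<cdot> N + ?Q \<cdot> mat 1 = 0" by simp
  qed
  finally show ?thesis .
qed

lemma eigenvalue_of_finite_order:
  assumes "rep \<sigma> \<tau> M N" "((**) M ^^ n) (mat 1) = mat 1" "N $ 1 $ 2 \<noteq> 0"
    and "z^2 = (N $ 1 $ 1 + N $ 2 $ 2) * z - det N"
  shows "z ^ n = 1"
proof -
  have "((**) N ^^ n) (mat 1) = mat 1"
    using rep_power[OF assms(1), of n] rep_mat_1 rep_unique unfolding assms(2) by metis
  \<comment> \<open>An eigenvector for \<open>z\<close>: the first row is checked by inspection, the
    second is the characteristic equation, and the first entry is nonzero by assumption.\<close>
  define v :: "complex^2" where "v = vector [N $ 1 $ 2, z - N $ 1 $ 1]"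
  have v: "v $ 1 = N $ 1 $ 2" "v $ 2 = z - N $ 1 $ 1" by (simp_all add: v_def)
  have "N *v v = z *s v"
    using assms(4)
    by (simp add: vec_eq_iff forall_2 matrix_vector_mult_def sum_2 v det_2 power2_eq_square
        algebra_simps)
  have "((**) N ^^ m) (mat 1) *v v = z ^ m *s v" for m
    by (induction m)
      (simp_all add: matrix_vector_mul_assoc[symmetric] vector_scalar_commute
        \<open>N *v v = z *s v\<close> mult.commute)
  from this[of n] have "v = z ^ n *s v" unfolding \<open>((**) N ^^ n) (mat 1) = mat 1\<close> by simp
  then have "v $ 1 = z ^ n * v $ 1" by (metis vector_smult_component)
  with assms(3) v show ?thesis by simp
qed

section \<open>Roots of unity with rational real part\<close>

text \<open>If \<open>a / b\<close> is in lowest terms, so is the fraction of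
  \<open>a\<^sup>2 - 2 * b\<^sup>2\<close> by \<open>b\<^sup>2\<close>. The map
  \<open>c\<^sup>2 - 2\<close> is the effect on \<open>z + 1 / z\<close> of squaring
  \<open>z\<close>.\<close>

lemma denominator_square_minus_2:
  "snd (quotient_of (c\<^sup>2 - 2)) = (snd (quotient_of c))\<^sup>2"
proof -
  obtain a b where q: "quotient_of c = (a, b)" by force
  then have b: "b > 0" and co: "coprime a b" and c: "c = of_int a / of_int b"
    by (auto simp: quotient_of_denom_pos quotient_of_coprime quotient_of_div)
  have "c\<^sup>2 - 2 = of_int (a\<^sup>2 - 2 * b\<^sup>2) / of_int (b\<^sup>2)"
    using b by (simp add: c field_simps)
  then have eq: "c\<^sup>2 - 2 = Fract (a\<^sup>2 - 2 * b\<^sup>2) (b\<^sup>2)"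
    by (simp add: Fract_of_int_quotient)
  have "coprime (a\<^sup>2 - 2 * b\<^sup>2) b"
  proof (rule coprimeI)
    fix d assume d: "d dvd a\<^sup>2 - 2 * b\<^sup>2" "d dvd b"
    then have "d dvd (a\<^sup>2 - 2 * b\<^sup>2) + 2 * b * b" by (intro dvd_add) auto
    then have "d dvd a\<^sup>2" by (simp add: power2_eq_square)
    moreover have "coprime (a\<^sup>2) b" using co by simp
    ultimately show "is_unit d" using d(2) by (meson coprime_common_divisor)
  qed
  then show ?thesis
    using b unfolding eq quotient_of_Fract q by (simp add: normalize_stable)
qed

text \<open>The rational values among \<open>z ^ m + 1 / z ^ m\<close> form a finite set closed
  under \<open>c\<^sup>2 - 2\<close>, which squares denominators. So the largest denominator is 1,
  and an integer that is a sum of two numbers of modulus 1 is at most 2 in absolute value.\<close>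

lemma root_of_unity_rat_trace:
  fixes z :: complex
  assumes "z ^ n = 1" "n > 0" "z + inverse z = of_rat c"
  shows "c \<in> {-2, -1, 0, 1, 2}"
proof -
  define S where "S = {c :: rat. \<exists>m. z ^ m + inverse (z ^ m) = of_rat c}"
  have nz: "z \<noteq> 0" using assms(1,2) by (auto simp: power_0_left)
  have "of_rat ` S \<subseteq> (\<lambda>m. z ^ m + inverse (z ^ m)) ` {..<n}"
  proof safe
    fix d assume "d \<in> S"
    then obtain m where m: "z ^ m + inverse (z ^ m) = of_rat d" by (auto simp: S_def)
    have "z ^ m = z ^ (n * (m div n) + m mod n)" by simp
    also have "\<dots> = z ^ (m mod n)" unfolding power_add power_mult assms(1) by simp
    finally show "of_rat d \<in> (\<lambda>m. z ^ m + inverse (z ^ m)) ` {..<n}"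
      using m assms(2) by (intro image_eqI[of _ _ "m mod n"]) auto
  qed
  then have "finite (complex_of_rat ` S)" by (rule finite_subset) simp
  then have fin: "finite S" by (rule finite_imageD) (simp add: inj_on_def)
  have "c \<in> S" using assms(3) unfolding S_def by (auto intro: exI[of _ 1])
  define D where "D = Max ((snd \<circ> quotient_of) ` S)"
  have "D \<in> (snd \<circ> quotient_of) ` S"
    unfolding D_def using fin \<open>c \<in> S\<close> by (intro Max_in) auto
  then obtain d where d: "d \<in> S" "D = snd (quotient_of d)" by auto
  then obtain m where m: "z ^ m + inverse (z ^ m) = of_rat d" by (auto simp: S_def)
  have "z ^ (m * 2) + inverse (z ^ (m * 2)) = (z ^ m + inverse (z ^ m))\<^sup>2 - 2"
    unfolding power_mult using nz by (simp add: power2_eq_square field_simps)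
  also have "\<dots> = of_rat (d\<^sup>2 - 2)" by (simp add: m of_rat_diff of_rat_power)
  finally have "d\<^sup>2 - 2 \<in> S" unfolding S_def by blast
  then have "snd (quotient_of (d\<^sup>2 - 2)) \<le> D" unfolding D_def using fin by (intro Max_ge) auto
  then have "D\<^sup>2 \<le> D" unfolding denominator_square_minus_2 d(2) .
  moreover have "D > 0" unfolding d(2) by (rule quotient_of_denom_pos')
  ultimately have "D \<le> 1" by (simp add: power2_eq_square)
  moreover have "snd (quotient_of c) \<le> D" unfolding D_def using fin \<open>c \<in> S\<close> by (intro Max_ge) auto
  moreover have "snd (quotient_of c) > 0" by (rule quotient_of_denom_pos')
  ultimately have "snd (quotient_of c) = 1" by simp
  then have c: "c = of_int (fst (quotient_of c))"
    using quotient_of_div[of c "fst (quotient_of c)" 1] by (metis div_by_1 of_int_1 prod.collapse)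
  define k where "k = fst (quotient_of c)"
  have ck: "c = of_int k" using c by (simp add: k_def)
  have "norm z ^ n = 1" using assms(1) by (metis norm_one norm_power)
  then have "norm z = 1" using assms(2) power_eq_imp_eq_base[of "norm z" n 1] by simp
  then have "norm (z + inverse z) \<le> 2"
    using norm_triangle_ineq[of z "inverse z"] by (simp add: norm_inverse)
  also have "norm (z + inverse z) = \<bar>real_of_int k\<bar>" unfolding assms(3) ck by simp
  finally have "\<bar>k\<bar> \<le> 2" by linarith
  then have "k \<in> {-2, -1, 0, 1, 2}" by auto
  then show ?thesis unfolding ck by auto
qed

section \<open>The automorphism group\<close>

lemma tendsto_matrix_vector_mult_0:
  "((\<lambda>x. C *v x) \<longlongrightarrow> 0) (nhds (0 :: complex^'n))" for C :: "complex^'n^'m"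
proof -
  have id: "((\<lambda>x. x) \<longlongrightarrow> 0) (nhds (0 :: complex^'n))" by (rule filterlim_ident)
  have "((\<lambda>x. \<chi> i. \<Sum>j\<in>UNIV. C $ i $ j * x $ j) \<longlongrightarrow> (\<chi> i. \<Sum>j\<in>UNIV. C $ i $ j * (0 :: complex^'n) $ j))
      (nhds 0)"
    by (intro tendsto_vec_lambda tendsto_intros tendsto_vec_nth id)
  then show ?thesis by (simp add: matrix_vector_mult_def zero_vec_def)
qed

text \<open>Replacing the image by a preimage lets statements about germs be pulled back along
  linear maps by continuity at 0.\<close>

lemma mem_Aut_iff:
  assumes "invertible M"
  shows "M \<in> Aut X \<longleftrightarrow> (\<forall>\<^sub>F x in nhds 0. x \<in> X \<longleftrightarrow> map_matrix of_rat M *v x \<in> X)"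
proof -
  obtain M' where M': "M ** M' = mat 1" "M' ** M = mat 1"
    using assms unfolding invertible_def by blast
  define C C' where "C = (map_matrix of_rat M :: complex^4^4)"
    and "C' = (map_matrix of_rat M' :: complex^4^4)"
  have "C ** C' = mat 1" "C' ** C = mat 1"
    unfolding C_def C'_def map_matrix_mult[symmetric] M' map_matrix_mat by (rule refl)+
  then have inv: "C *v (C' *v x) = x" "C' *v (C *v x) = x" for x
    by (simp_all add: matrix_vector_mul_assoc)
  have "x \<in> (\<lambda>x. C *v x) ` X \<longleftrightarrow> C' *v x \<in> X" for x
  proof
    assume "C' *v x \<in> X"
    then show "x \<in> (\<lambda>x. C *v x) ` X"
      by (intro image_eqI[of _ _ "C' *v x"]) (simp_all add: inv)
  qed (auto simp: inv)
  then have "M \<in> Aut X \<longleftrightarrow> (\<forall>\<^sub>F x in nhds 0. C' *v x \<in> X \<longleftrightarrow> x \<in> X)"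
    unfolding Aut_def germ_eq_def mem_Collect_eq C_def[symmetric] using assms by simp
  also have "\<dots> \<longleftrightarrow> (\<forall>\<^sub>F x in nhds 0. x \<in> X \<longleftrightarrow> C *v x \<in> X)"
  proof
    assume "\<forall>\<^sub>F x in nhds 0. C' *v x \<in> X \<longleftrightarrow> x \<in> X"
    from eventually_compose_filterlim[OF this tendsto_matrix_vector_mult_0[of C]]
    show "\<forall>\<^sub>F x in nhds 0. x \<in> X \<longleftrightarrow> C *v x \<in> X" by (simp add: inv)
  next
    assume "\<forall>\<^sub>F x in nhds 0. x \<in> X \<longleftrightarrow> C *v x \<in> X"
    from eventually_compose_filterlim[OF this tendsto_matrix_vector_mult_0[of C']]
    show "\<forall>\<^sub>F x in nhds 0. C' *v x \<in> X \<longleftrightarrow> x \<in> X" by (simp add: inv)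
  qed
  finally show ?thesis unfolding C_def .
qed

lemma invertible_of_Aut: "M \<in> Aut X \<Longrightarrow> invertible M"
  by (simp add: Aut_def)

lemma Aut_mult:
  assumes "M \<in> Aut X" "M' \<in> Aut X"
  shows "M ** M' \<in> Aut X"
proof -
  note inv = assms[THEN invertible_of_Aut]
  have 1: "\<forall>\<^sub>F x in nhds 0. x \<in> X \<longleftrightarrow> map_matrix of_rat M *v x \<in> X"
    and 2: "\<forall>\<^sub>F x in nhds 0. x \<in> X \<longleftrightarrow> map_matrix of_rat M' *v x \<in> X"
    using assms inv mem_Aut_iff by blast+
  have "\<forall>\<^sub>F x in nhds 0. x \<in> X \<longleftrightarrow> map_matrix of_rat (M ** M') *v x \<in> X"
    using 2 eventually_compose_filterlim[OF 1 tendsto_matrix_vector_mult_0[of "map_matrix of_rat M'"]]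
    by eventually_elim (simp add: map_matrix_mult matrix_vector_mul_assoc)
  moreover have "invertible (M ** M')" using inv by (rule invertible_mult)
  ultimately show ?thesis by (simp add: mem_Aut_iff)
qed

lemma Aut_mat_1: "mat 1 \<in> Aut X"
  by (subst mem_Aut_iff) (auto simp: map_matrix_mat invertible_def)

lemma Aut_inverse:
  assumes "M \<in> Aut X" "M ** M' = mat 1" "M' ** M = mat 1"
  shows "M' \<in> Aut X"
proof -
  have 1: "\<forall>\<^sub>F x in nhds 0. x \<in> X \<longleftrightarrow> map_matrix of_rat M *v x \<in> X"
    using assms(1) invertible_of_Aut mem_Aut_iff by blast
  have "map_matrix of_rat M *v (map_matrix of_rat M' *v x) = (x :: complex^4)" for x
    by (simp add: matrix_vector_mul_assoc map_matrix_mult[symmetric] assms map_matrix_mat)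
  then have "\<forall>\<^sub>F x in nhds 0. x \<in> X \<longleftrightarrow> map_matrix of_rat M' *v x \<in> X"
    using eventually_compose_filterlim[OF 1 tendsto_matrix_vector_mult_0[of "map_matrix of_rat M'"]]
    by (auto elim: eventually_mono)
  then show ?thesis using assms by (subst mem_Aut_iff) (auto simp: invertible_def)
qed

lemma group_GL4: "group GL4"
proof (rule groupI)
  show "\<exists>y\<in>carrier GL4. y \<otimes>\<^bsub>GL4\<^esub> x = \<one>\<^bsub>GL4\<^esub>" if "x \<in> carrier GL4" for x
    using that unfolding GL4_def invertible_def by auto
qed (auto simp: GL4_def invertible_mult matrix_mul_assoc, auto simp: invertible_def)

lemma subgroup_Aut: "subgroup (Aut X) GL4"
proof (rule group.subgroupI[OF group_GL4])
  show "Aut X \<subseteq> carrier GL4" by (auto simp: GL4_def invertible_of_Aut)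
  show "Aut X \<noteq> {}" using Aut_mat_1 by blast
  show "inv\<^bsub>GL4\<^esub> M \<in> Aut X" if "M \<in> Aut X" for M
  proof (rule Aut_inverse[OF that])
    have M: "M \<in> carrier GL4" using that by (simp add: GL4_def invertible_of_Aut)
    from group.r_inv[OF group_GL4 M] show "M ** inv\<^bsub>GL4\<^esub> M = mat 1" by (simp add: GL4_def)
    from group.l_inv[OF group_GL4 M] show "inv\<^bsub>GL4\<^esub> M ** M = mat 1" by (simp add: GL4_def)
  qed
  show "M \<otimes>\<^bsub>GL4\<^esub> M' \<in> Aut X" if "M \<in> Aut X" "M' \<in> Aut X" for M M'
    using Aut_mult[OF that] by (simp add: GL4_def)
qed

text \<open>The finiteness condition is applied to the largest admissible subgroup,
  \<open>Aut X\<close> itself. Two powers of \<open>M\<close> then coincide, and cancellation brings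
  one of them to the identity.\<close>

lemma Aut_finite_order:
  assumes "Ghol X \<tau>1 \<tau>2" "M \<in> Aut X"
  obtains n where "n > 0" "((**) M ^^ n) (mat 1) = mat 1"
proof -
  have fin: "finite (Aut X)" using assms(1) subgroup_Aut unfolding Ghol_def by blast
  have "((**) M ^^ n) (mat 1) \<in> Aut X" for n
    by (induction n) (simp_all add: Aut_mat_1 Aut_mult assms(2))
  then have "\<not> inj (\<lambda>n. ((**) M ^^ n) (mat 1))"
    using fin by (metis finite_imageD finite_subset image_subsetI infinite_UNIV_nat)
  then obtain i j where "i < j" and eq: "((**) M ^^ i) (mat 1) = ((**) M ^^ j) (mat 1)"
    unfolding inj_def by (metis nat_neq_iff)
  obtain M' where M': "M' ** M = mat 1"
    using assms(2)[THEN invertible_of_Aut] unfolding invertible_def by blast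
  have cancel: "M ** A = M ** B \<Longrightarrow> A = B" for A B :: "rat^4^4"
    by (metis M' matrix_mul_assoc matrix_mul_lid)
  have "((**) M ^^ (j - i)) (mat 1) = mat 1"
    using eq \<open>i < j\<close>
  proof (induction i arbitrary: j)
    case (Suc i)
    then obtain j' where "j = Suc j'" by (cases j) auto
    with Suc.prems have "((**) M ^^ i) (mat 1) = ((**) M ^^ j') (mat 1)" by (auto intro: cancel)
    with Suc.IH[of j'] Suc.prems \<open>j = Suc j'\<close> show ?case by simp
  qed simp
  with \<open>i < j\<close> show ?thesis by (intro that[of "j - i"]) auto
qed

section \<open>The tangent plane of a holonomy set\<close>

text \<open>A double power series converges absolutely at a radius \<open>r\<close> inside its
  domain. For \<open>m \<le> r\<close>, a term of total degree at least 3 is at most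
  \<open>(m / r) ^ 3\<close> times its absolute value at radius \<open>r\<close>.\<close>

lemma power_series_remainder:
  assumes "power_series_at_0 c v" and "e = (1, 0) \<or> e = (0, 1)"
    and "\<And>j k. (j, k) \<noteq> e \<Longrightarrow> c (j, k) \<noteq> 0 \<Longrightarrow> j + k \<ge> 3"
  obtains B r where "r > 0" "B \<ge> 0"
    "\<And>u1 u2. norm u1 \<le> r \<Longrightarrow> norm u2 \<le> r \<Longrightarrow>
       norm (v (u1, u2) - c e * u1 ^ fst e * u2 ^ snd e) \<le> B * (max (norm u1) (norm u2)) ^ 3"
proof -
  obtain R where "R > 0" and R: "\<And>u1 u2. norm u1 < R \<Longrightarrow> norm u2 < R \<Longrightarrow>
      ((\<lambda>(j, k). c (j, k) * u1 ^ j * u2 ^ k) has_sum v (u1, u2)) UNIV"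
    using assms(1) unfolding power_series_at_0_def by blast
  define r where "r = R / 2"
  have r: "r > 0" "r < R" using \<open>R > 0\<close> by (auto simp: r_def)
  define g where "g = (\<lambda>(j, k). norm (c (j, k)) * r ^ j * r ^ k)"
  have "(\<lambda>(j, k). c (j, k) * of_real r ^ j * of_real r ^ k) summable_on UNIV"
    using R[of "of_real r" "of_real r"] r by (auto simp: summable_on_def)
  then have "(\<lambda>x. norm (case x of (j, k) \<Rightarrow> c (j, k) * of_real r ^ j * of_real r ^ k)) summable_on UNIV"
    by (simp add: summable_on_iff_abs_summable_on_complex)
  also have "(\<lambda>x. norm (case x of (j, k) \<Rightarrow> c (j, k) * of_real r ^ j * of_real r ^ k)) = g"
    using r by (auto simp: g_def norm_mult norm_power)
  finally have g: "g summable_on UNIV" .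
  then have g': "g summable_on (UNIV - {e})" by (rule summable_on_subset) auto
  define B where "B = infsum g (UNIV - {e}) / r ^ 3"
  have g_nonneg: "g x \<ge> 0" for x using r by (auto simp: g_def split: prod.splits)
  show ?thesis
  proof (rule that[of r B])
    show "r > 0" by fact
    show "B \<ge> 0" unfolding B_def using r g_nonneg by (intro divide_nonneg_pos infsum_nonneg) auto
    fix u1 u2 :: complex
    assume u: "norm u1 \<le> r" "norm u2 \<le> r"
    define m where "m = max (norm u1) (norm u2)"
    have m: "0 \<le> m" "m \<le> r" "norm u1 \<le> m" "norm u2 \<le> m" using u by (auto simp: m_def le_max_iff_disj)
    define f where "f = (\<lambda>(j, k). c (j, k) * u1 ^ j * u2 ^ k)"
    have "(f has_sum v (u1, u2)) UNIV" unfolding f_def using R u r by auto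
    then have "(f has_sum (v (u1, u2) - f e)) (UNIV - {e})"
      by (intro has_sum_Diff) (auto simp: has_sum_finiteI)
    then have fs: "infsum f (UNIV - {e}) = v (u1, u2) - f e" by (rule infsumI)
    have bound: "norm (f x) \<le> (m / r) ^ 3 * g x" if "x \<in> UNIV - {e}" for x
    proof (cases x)
      case (Pair j k)
      show ?thesis
      proof (cases "c (j, k) = 0")
        case False
        with assms(3)[of j k] that Pair have jk: "j + k \<ge> 3" by auto
        have "norm (f x) \<le> norm (c (j, k)) * m ^ j * m ^ k"
          unfolding f_def Pair using m
          by (simp add: norm_mult norm_power) (intro mult_mono power_mono mult_nonneg_nonneg; simp)
        also have "\<dots> = norm (c (j, k)) * r ^ (j + k) * (m / r) ^ (j + k)"
          using r by (simp add: power_add power_divide)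
        also have "\<dots> \<le> norm (c (j, k)) * r ^ (j + k) * (m / r) ^ 3"
          using m r jk by (intro mult_left_mono power_decreasing) auto
        finally show ?thesis by (simp add: g_def Pair power_add mult_ac)
      qed (simp add: f_def g_def Pair)
    qed
    have gm: "(\<lambda>x. (m / r) ^ 3 * g x) summable_on (UNIV - {e})"
      by (rule summable_on_cmult_right[OF g'])
    have "norm (infsum f (UNIV - {e})) \<le> infsum (\<lambda>x. (m / r) ^ 3 * g x) (UNIV - {e})"
      unfolding fs
      by (rule norm_infsum_le[OF \<open>(f has_sum (v (u1, u2) - f e)) (UNIV - {e})\<close>
            has_sum_infsum[OF gm] bound])
    also have "\<dots> = B * m ^ 3"
      by (subst infsum_cmult_right) (use g' in \<open>auto simp: B_def power_divide\<close>)
    finally show "norm (v (u1, u2) - c e * u1 ^ fst e * u2 ^ snd e) \<le> B * (max (norm u1) (norm u2)) ^ 3"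
      unfolding fs m_def by (simp add: f_def split: prod.splits)
  qed
qed

text \<open>The cubic remainder divided by \<open>norm y\<close> is at most
  \<open>B * (norm y)\<^sup>2\<close>. Writing the linear term with the exponent \<open>e\<close>
  treats both functions at once.\<close>

lemma cusp_expansion_has_derivative:
  assumes "cusp_expansion \<tau> e v"
  shows "e = (1, 0) \<Longrightarrow> (v has_derivative (\<lambda>h. \<tau> * fst h)) (at (0, 0))"
    and "e = (0, 1) \<Longrightarrow> (v has_derivative (\<lambda>h. \<tau> * snd h)) (at (0, 0))"
    and "e = (1, 0) \<or> e = (0, 1) \<Longrightarrow> v (0, 0) = 0"
proof -
  obtain c where c: "power_series_at_0 c v" "c e = \<tau>"
    "\<And>j k. (j, k) \<noteq> e \<Longrightarrow> c (j, k) \<noteq> 0 \<Longrightarrow> j + k \<ge> 3"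
    using assms unfolding cusp_expansion_def by blast
  have *: "v (0, 0) = 0 \<and> (v has_derivative (\<lambda>h. \<tau> * fst h ^ fst e * snd h ^ snd e)) (at (0, 0))"
    if e: "e = (1, 0) \<or> e = (0, 1)"
  proof -
    obtain B r where "r > 0" "B \<ge> 0" and B: "\<And>u1 u2. norm u1 \<le> r \<Longrightarrow> norm u2 \<le> r \<Longrightarrow>
         norm (v (u1, u2) - c e * u1 ^ fst e * u2 ^ snd e) \<le> B * (max (norm u1) (norm u2)) ^ 3"
      using power_series_remainder[OF c(1) e c(3)] by metis
    have v0: "v (0, 0) = 0" using B[of 0 0] \<open>r > 0\<close> e by auto
    have "(v has_derivative (\<lambda>h. \<tau> * fst h ^ fst e * snd h ^ snd e)) (at (0, 0) within UNIV)"
    proof (rule has_derivativeI_sandwich[of r])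
      show "bounded_linear (\<lambda>h :: complex \<times> complex. \<tau> * fst h ^ fst e * snd h ^ snd e)"
        using e by (auto intro!: bounded_linear_const_mult bounded_linear_fst bounded_linear_snd)
      have "((\<lambda>y :: complex \<times> complex. B * (norm y)\<^sup>2) \<longlongrightarrow> B * (norm ((0, 0) :: complex \<times> complex))\<^sup>2)
          (at (0, 0))"
        by (intro tendsto_intros)
      then show "((\<lambda>y :: complex \<times> complex. B * (norm y)\<^sup>2) \<longlongrightarrow> 0) (at (0, 0))"
        by (simp add: norm_Pair)
      fix y :: "complex \<times> complex"
      assume y: "y \<noteq> (0, 0)" "dist y (0, 0) < r"
      obtain u1 u2 where u: "y = (u1, u2)" by force
      have le: "norm u1 \<le> norm y" "norm u2 \<le> norm y"
        unfolding u using norm_fst_le norm_snd_le by blast+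
      moreover have "norm y < r" using y(2) by (simp add: dist_norm u)
      ultimately have "norm (v y - \<tau> * u1 ^ fst e * u2 ^ snd e) \<le> B * (max (norm u1) (norm u2)) ^ 3"
        using B[of u1 u2] c(2) u by simp
      also have "\<dots> \<le> B * norm y ^ 3"
        using le \<open>B \<ge> 0\<close> by (intro mult_left_mono power_mono) (auto simp: le_max_iff_disj)
      finally show "norm (v y - v (0, 0) - \<tau> * fst (y - (0, 0)) ^ fst e * snd (y - (0, 0)) ^ snd e) /
          norm (y - (0, 0)) \<le> B * (norm y)\<^sup>2"
        using y(1) by (simp add: v0 u divide_le_eq power2_eq_square power3_eq_cube mult.assoc)
    qed (use \<open>r > 0\<close> in auto)
    with v0 show ?thesis by simp
  qed
  show "e = (1, 0) \<Longrightarrow> (v has_derivative (\<lambda>h. \<tau> * fst h)) (at (0, 0))"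
    "e = (0, 1) \<Longrightarrow> (v has_derivative (\<lambda>h. \<tau> * snd h)) (at (0, 0))"
    "e = (1, 0) \<or> e = (0, 1) \<Longrightarrow> v (0, 0) = 0"
    using * by auto
qed

lemma has_vector_derivative_compose_pair:
  assumes "(v has_derivative v') (at (0, 0))"
    and "(f has_vector_derivative a) (at 0)" "(g has_vector_derivative b) (at 0)"
    and "f (0 :: real) = 0" "g (0 :: real) = 0"
  shows "((\<lambda>s. v (f s, g s)) has_vector_derivative v' (a, b)) (at 0)"
proof -
  have "((\<lambda>s. (f s, g s)) has_derivative (\<lambda>s. (s *\<^sub>R a, s *\<^sub>R b))) (at 0)"
    using assms(2,3) unfolding has_vector_derivative_def by (rule has_derivative_Pair)
  moreover have "(v has_derivative v') (at (f 0, g 0))" using assms by simp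
  ultimately have "((\<lambda>s. v (f s, g s)) has_derivative (\<lambda>s. v' (s *\<^sub>R a, s *\<^sub>R b))) (at 0)"
    by (rule has_derivative_compose)
  moreover have "v' (s *\<^sub>R a, s *\<^sub>R b) = s *\<^sub>R v' (a, b)" for s
    using linear_scale[OF bounded_linear.linear[OF has_derivative_bounded_linear[OF assms(1)]],
        of s "(a, b)"] by simp
  ultimately show ?thesis by (simp add: has_vector_derivative_def)
qed

text \<open>A curve in \<open>X\<close> with a given tangent velocity is moved by \<open>M\<close>
  to another curve in \<open>X\<close>; differentiating the two equations of the graph along the
  image puts its velocity in the tangent plane.\<close>

lemma tangent_plane:
  assumes "Ghol X \<tau>1 \<tau>2" "M \<in> Aut X"
  obtains w' where "map_matrix of_rat M *v emb \<tau>1 \<tau>2 w = emb \<tau>1 \<tau>2 w'"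
proof -
  obtain v1 v2 where graph: "germ_eq X {x. x $ 2 = v1 (x $ 1, x $ 3) \<and> x $ 4 = v2 (x $ 1, x $ 3)}"
    and v: "cusp_expansion \<tau>1 (1, 0) v1" "cusp_expansion \<tau>2 (0, 1) v2"
    using assms(1) unfolding Ghol_def by blast
  note v1' = cusp_expansion_has_derivative(1)[OF v(1) refl]
  note v2' = cusp_expansion_has_derivative(2)[OF v(2) refl]
  have v0: "v1 (0, 0) = 0" "v2 (0, 0) = 0"
    using cusp_expansion_has_derivative(3)[OF v(1)] cusp_expansion_has_derivative(3)[OF v(2)]
    by auto
  define C where "C = (map_matrix of_rat M :: complex^4^4)"
  define x where "x = emb \<tau>1 \<tau>2 w"
  have x: "x $ 2 = \<tau>1 * x $ 1" "x $ 4 = \<tau>2 * x $ 3" by (simp_all add: x_def emb_def)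
  \<comment> \<open>The lift to the graph of a real line in the \<open>(u1, u2)\<close> plane; its
    velocity at 0 is \<open>x\<close>.\<close>
  define p :: "real \<Rightarrow> complex^4" where "p = (\<lambda>s. vector [s *\<^sub>R x $ 1, v1 (s *\<^sub>R x $ 1, s *\<^sub>R x $ 3),
      s *\<^sub>R x $ 3, v2 (s *\<^sub>R x $ 1, s *\<^sub>R x $ 3)])"
  have lin: "((\<lambda>s. s *\<^sub>R a) has_vector_derivative a) (at 0)" for a :: complex
    by (auto intro!: derivative_eq_intros)
  have p': "((\<lambda>s. p s $ i) has_vector_derivative x $ i) (at 0)" for i
  proof -
    have "\<forall>i. ((\<lambda>s. p s $ i) has_vector_derivative x $ i) (at 0)"
      using has_vector_derivative_compose_pair[OF v1' lin lin, of "x $ 1" "x $ 3"]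
        has_vector_derivative_compose_pair[OF v2' lin lin, of "x $ 1" "x $ 3"]
      by (simp add: forall_4 p_def lin x)
    then show ?thesis by blast
  qed
  have p0: "p 0 = 0" by (simp add: p_def vec_eq_iff forall_4 v0)
  define q where "q = (\<lambda>s. C *v p s)"
  have q': "((\<lambda>s. q s $ i) has_vector_derivative (C *v x) $ i) (at 0)" for i
    unfolding q_def matrix_vector_mult_def
    by (auto intro!: has_vector_derivative_sum has_vector_derivative_mult_right p')
  have q0: "q 0 = 0" by (simp add: q_def p0)
  have p_tendsto: "(p \<longlongrightarrow> 0) (at 0)"
  proof (rule vec_tendstoI)
    show "((\<lambda>s. p s $ i) \<longlongrightarrow> 0 $ i) (at 0)" for i
      using has_vector_derivative_continuous[OF p'[of i]] p0
      by (simp add: continuous_within)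
  qed
  have q_tendsto: "(q \<longlongrightarrow> 0) (at 0)"
    unfolding q_def by (rule filterlim_compose[OF tendsto_matrix_vector_mult_0 p_tendsto])
  have X: "\<forall>\<^sub>F x in nhds 0. x \<in> X \<longleftrightarrow> x $ 2 = v1 (x $ 1, x $ 3) \<and> x $ 4 = v2 (x $ 1, x $ 3)"
    using graph unfolding germ_eq_def by simp
  have MX: "\<forall>\<^sub>F x in nhds 0. x \<in> X \<longleftrightarrow> C *v x \<in> X"
    using assms(2) mem_Aut_iff[OF invertible_of_Aut[OF assms(2)]] unfolding C_def by blast
  have "\<forall>\<^sub>F s in at 0. q s $ 2 = v1 (q s $ 1, q s $ 3) \<and> q s $ 4 = v2 (q s $ 1, q s $ 3)"
    using eventually_compose_filterlim[OF X p_tendsto] eventually_compose_filterlim[OF MX p_tendsto]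
      eventually_compose_filterlim[OF X q_tendsto]
    by eventually_elim (simp add: q_def, simp add: p_def)
  \<comment> \<open>The equations also hold at \<open>s = 0\<close>, so the punctured filter can be
    enlarged; the comparison of derivatives below requires this.\<close>
  then have q: "\<forall>\<^sub>F s in nhds 0. q s $ 2 = v1 (q s $ 1, q s $ 3) \<and> q s $ 4 = v2 (q s $ 1, q s $ 3)"
    unfolding eventually_at_filter
    by eventually_elim (use q0 v0 in fastforce)
  have "((\<lambda>s. v1 (q s $ 1, q s $ 3)) has_vector_derivative \<tau>1 * (C *v x) $ 1) (at 0)"
    "((\<lambda>s. v2 (q s $ 1, q s $ 3)) has_vector_derivative \<tau>2 * (C *v x) $ 3) (at 0)"
    using has_vector_derivative_compose_pair[OF v1' q' q', of 1 3]
      has_vector_derivative_compose_pair[OF v2' q' q', of 1 3] q0 by simp_all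
  moreover have "((\<lambda>s. v1 (q s $ 1, q s $ 3)) has_vector_derivative (C *v x) $ 2) (at 0) \<longleftrightarrow>
      ((\<lambda>s. q s $ 2) has_vector_derivative (C *v x) $ 2) (at 0)"
    "((\<lambda>s. v2 (q s $ 1, q s $ 3)) has_vector_derivative (C *v x) $ 4) (at 0) \<longleftrightarrow>
      ((\<lambda>s. q s $ 4) has_vector_derivative (C *v x) $ 4) (at 0)"
    by (rule has_vector_derivative_cong_ev; use q in \<open>auto simp: q0 v0 elim: eventually_mono\<close>)+
  ultimately have "(C *v x) $ 2 = \<tau>1 * (C *v x) $ 1" "(C *v x) $ 4 = \<tau>2 * (C *v x) $ 3"
    using q' vector_derivative_unique_at by blast+
  then have "C *v x = emb \<tau>1 \<tau>2 (vector [(C *v x) $ 1, (C *v x) $ 3])"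
    by (simp add: emb_def vec_eq_iff forall_4)
  then show ?thesis unfolding C_def x_def by (rule that)
qed

lemma Aut_block_acts:
  assumes "Ghol X \<tau>1 \<tau>2" "block A1 A2 A3 A4 \<in> Aut X"
  obtains l1 l2 l3 l4 where "acts \<tau>1 \<tau>1 A1 l1" "acts \<tau>2 \<tau>1 A2 l2" "acts \<tau>1 \<tau>2 A3 l3"
    "acts \<tau>2 \<tau>2 A4 l4"
proof -
  obtain a where a: "map_matrix of_rat (block A1 A2 A3 A4) *v emb \<tau>1 \<tau>2 (vector [1, 0]) = emb \<tau>1 \<tau>2 a"
    using tangent_plane[OF assms] by blast
  obtain b where b: "map_matrix of_rat (block A1 A2 A3 A4) *v emb \<tau>1 \<tau>2 (vector [0, 1]) = emb \<tau>1 \<tau>2 b"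
    using tangent_plane[OF assms] by blast
  show ?thesis
    by (rule that[of "a $ 1" "b $ 1" "a $ 2" "b $ 2"])
      (use a b in \<open>simp_all add: acts_def vec_eq_iff forall_4 emb_def matrix_vector_mult_def sum_4 mult.commute\<close>)
qed

lemma iota_Aut:
  assumes "Ghol X \<tau>1 \<tau>2"
  shows "iota \<in> Aut X"
proof -
  obtain v1 v2 where graph: "germ_eq X {x. x $ 2 = v1 (x $ 1, x $ 3) \<and> x $ 4 = v2 (x $ 1, x $ 3)}"
    and par: "\<forall>\<^sub>F (u1, u2) in nhds (0, 0).
           v1 (- u1, u2) = - v1 (u1, u2) \<and> v1 (u1, - u2) = v1 (u1, u2) \<and>
           v2 (- u1, u2) = v2 (u1, u2) \<and> v2 (u1, - u2) = - v2 (u1, u2)"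
    using assms unfolding Ghol_def by blast
  have X: "\<forall>\<^sub>F x in nhds 0. x \<in> X \<longleftrightarrow> x $ 2 = v1 (x $ 1, x $ 3) \<and> x $ 4 = v2 (x $ 1, x $ 3)"
    using graph unfolding germ_eq_def by simp
  have id: "((\<lambda>x. x) \<longlongrightarrow> 0) (nhds (0 :: complex^4))" by (rule filterlim_ident)
  have "((\<lambda>x :: complex^4. (x $ 1, x $ 3)) \<longlongrightarrow> ((0 :: complex^4) $ 1, (0 :: complex^4) $ 3)) (nhds 0)"
    by (intro tendsto_Pair tendsto_vec_nth id)
  then have "filterlim (\<lambda>x :: complex^4. (x $ 1, x $ 3)) (nhds (0, 0)) (nhds 0)" by simp
  note par' = eventually_compose_filterlim[OF par this]
  have "iota ** iota = mat 1"
    unfolding iota_def block_mult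
    by (simp add: vec_eq_iff forall_4 forall_2 mat_def matrix_matrix_mult_def sum_2)
  then have "invertible iota" unfolding invertible_def by blast
  moreover have "\<forall>\<^sub>F x in nhds 0. x \<in> X \<longleftrightarrow> map_matrix of_rat iota *v x \<in> X"
    using X eventually_compose_filterlim[OF X tendsto_matrix_vector_mult_0[of "map_matrix of_rat iota"]]
      par'
    by eventually_elim
      (auto simp: iota_def matrix_vector_mult_def sum_4 mat_def)
  ultimately show ?thesis by (simp add: mem_Aut_iff)
qed

section \<open>Finite groups containing a Type III matrix\<close>

text \<open>A rational square root of an integer is an algebraic integer, hence an integer. The
  values 2, 3 and 6 are the products of two different members of \<open>{1, 2, 3}\<close>, the range
  of both \<open>a + b\<close> and the discriminant parameter \<open>d\<close>.\<close>

lemma rat_square_ne: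
  assumes "r \<in> \<rat>"
  shows "r\<^sup>2 \<noteq> (2 :: real)" "r\<^sup>2 \<noteq> (3 :: real)" "r\<^sup>2 \<noteq> (6 :: real)"
proof -
  have *: "\<exists>k :: int. k\<^sup>2 = n" if "r\<^sup>2 = of_int n" for n
  proof -
    have "algebraic_int r"
      by (rule algebraic_int_root[of "of_int n" "monom 1 2"])
        (use that in \<open>auto simp: poly_monom degree_monom_eq\<close>)
    then have "r \<in> \<int>" using assms by (rule rational_algebraic_int_is_int)
    then obtain k where "r = of_int k" by (rule Ints_cases)
    with that have "k\<^sup>2 = n" by (metis of_int_eq_iff of_int_power)
    then show ?thesis by blast
  qed
  have **: "k\<^sup>2 \<noteq> 2 \<and> k\<^sup>2 \<noteq> 3 \<and> k\<^sup>2 \<noteq> 6" for k :: int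
  proof (cases "\<bar>k\<bar> \<le> 2")
    case True
    then have "k \<in> {-2, -1, 0, 1, 2}" by auto
    then show ?thesis by auto
  next
    case False
    then have "3\<^sup>2 \<le> \<bar>k\<bar>\<^sup>2" by (intro power_mono) auto
    then show ?thesis by auto
  qed
  show "r\<^sup>2 \<noteq> 2" using *[of 2] ** by auto
  show "r\<^sup>2 \<noteq> 3" using *[of 3] ** by auto
  show "r\<^sup>2 \<noteq> 6" using *[of 6] ** by auto
qed

text \<open>For the roots \<open>z1\<close>, \<open>z2\<close> one has
  \<open>z1\<^sup>2 + z2\<^sup>2 = t\<^sup>2 - 2 * d = c * d\<close>, and division by
  \<open>z1 * z2 = d\<close> gives \<open>c\<close> as the ratio plus its inverse. The irrational
  \<open>t\<close> itself disappears.\<close>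

lemma root_ratio_rat:
  fixes t d :: complex
  assumes roots: "\<And>z. z\<^sup>2 = t * z - d \<Longrightarrow> z ^ n = 1" and "n > 0"
    and "t\<^sup>2 = of_rat (c + 2) * d"
  shows "c \<in> {-2, -1, 0, 1, 2}" "d ^ n = 1"
proof -
  define e where "e = csqrt (t\<^sup>2 - 4 * d)"
  define z1 z2 where "z1 = (t + e) / 2" and "z2 = (t - e) / 2"
  have e: "e * e = t\<^sup>2 - 4 * d" unfolding e_def by (metis power2_csqrt power2_eq_square)
  have "4 * (z1 * z2) = t\<^sup>2 - e * e" by (simp add: z1_def z2_def power2_eq_square field_simps)
  then have prod: "z1 * z2 = d" unfolding e by simp
  have sum: "z1 + z2 = t" by (simp add: z1_def z2_def field_simps)
  have 1: "z1 ^ n = 1" by (rule roots) (simp add: power2_eq_square algebra_simps flip: sum prod)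
  have 2: "z2 ^ n = 1" by (rule roots) (simp add: power2_eq_square algebra_simps flip: sum prod)
  show "d ^ n = 1" unfolding prod[symmetric] power_mult_distrib 1 2 by simp
  have nz: "z1 \<noteq> 0" "z2 \<noteq> 0" using 1 2 \<open>n > 0\<close> by (auto simp: power_0_left)
  have "(z1 + z2)\<^sup>2 = of_rat (c + 2) * (z1 * z2)" using assms(3) unfolding prod sum .
  then have "z1\<^sup>2 + z2\<^sup>2 = of_rat c * (z1 * z2)"
    by (simp add: of_rat_add power2_eq_square algebra_simps)
  then have "z1 / z2 + inverse (z1 / z2) = of_rat c"
    using nz by (simp add: field_simps power2_eq_square)
  moreover have "(z1 / z2) ^ n = 1" by (simp add: power_divide 1 2)
  ultimately show "c \<in> {-2, -1, 0, 1, 2}" using \<open>n > 0\<close> by (intro root_of_unity_rat_trace)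
qed

text \<open>The analytic set is left behind here: only multipliers and finite orders remain. The
  order of \<open>iota ** (M ** M)\<close> guarantees that its minimal polynomial, which occurs in
  some hypotheses, exists.\<close>

locale finite_type_III =
  fixes \<tau>1 \<tau>2 :: complex and M :: "rat^4^4" and A1 A2 A3 A4 :: "rat^2^2" and l1 l2 l3 l4 :: complex
  assumes Im_pos: "Im \<tau>1 > 0" "Im \<tau>2 > 0"
    and acts: "acts \<tau>1 \<tau>1 A1 l1" "acts \<tau>2 \<tau>1 A2 l2" "acts \<tau>1 \<tau>2 A3 l3" "acts \<tau>2 \<tau>2 A4 l4"
    and M: "M = block A1 A2 A3 A4" and type_III: "type_III M"
    and order: "\<exists>n>0. ((**) M ^^ n) (mat 1) = mat 1"
    and order_iota: "\<exists>n>0. ((**) (iota ** M) ^^ n) (mat 1) = mat 1"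
    and order_iota_square: "\<exists>n>0. ((**) (iota ** (M ** M)) ^^ n) (mat 1) = mat 1"
begin

lemma Im_nz [simp]: "Im \<tau>1 \<noteq> 0" "Im \<tau>2 \<noteq> 0"
  using Im_pos by auto

lemma dets:
  "det A1 \<noteq> 0" "det A2 \<noteq> 0" "det A3 \<noteq> 0" "det A4 \<noteq> 0" "det A4 = det A1" "det A3 = det A2"
  "det A1 + det A2 = 1" "det A1 \<cdot> (matrix_inv A1 ** A2) = - (det A2 \<cdot> (matrix_inv A3 ** A4))"
  using type_III unfolding type_III_def M block_eq_iff by auto

lemma ev_nz [simp]: "l1 \<noteq> 0" "l2 \<noteq> 0" "l3 \<noteq> 0" "l4 \<noteq> 0"
proof -
  have "det (0 :: rat^2^2) = 0" by (simp add: det_2)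
  then have "A1 \<noteq> 0" "A2 \<noteq> 0" "A3 \<noteq> 0" "A4 \<noteq> 0" using dets by metis+
  then show "l1 \<noteq> 0" "l2 \<noteq> 0" "l3 \<noteq> 0" "l4 \<noteq> 0"
    using acts acts_ne_0 Im_nz by blast+
qed

definition p :: real where "p = of_rat (det A1)"
definition q :: real where "q = of_rat (det A2)"
text \<open>Up to sign, this is the determinant of the action on the tangent plane
  (\<open>det_N\<close>).\<close>

definition u :: complex where "u = l2 * l3 / of_real q"

lemma p_altdef: "p = (cmod l1)\<^sup>2"
  using acts_det[OF acts(1)] by (simp add: p_def)

lemma p_eq: "of_real p = l1 * cnj l1" "of_real p = cnj l1 * l1"
  by (simp_all only: p_altdef complex_norm_square mult.commute)

lemma p_q: "p + q = 1"
  using dets(7) by (metis p_def q_def of_rat_add of_rat_1)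

lemma p_q_pos: "p > 0" "q > 0"
proof -
  show "p > 0" by (simp add: p_altdef)
  have "q * Im \<tau>2 = (cmod l2)\<^sup>2 * Im \<tau>1"
    using acts_det[OF acts(2)] by (simp add: q_def)
  moreover have "(cmod l2)\<^sup>2 * Im \<tau>1 > 0" using Im_pos by simp
  ultimately have "q * Im \<tau>2 > 0" by simp
  then show "q > 0" using Im_pos by (simp add: zero_less_mult_iff)
qed

lemma l2_l3: "l2 * l3 = of_real q * u"
  using p_q_pos by (simp add: u_def)

text \<open>Multiplying the area identities of \<open>A2\<close> and \<open>A3\<close>, whose
  determinants agree, cancels \<open>Im \<tau>1 * Im \<tau>2\<close> and leaves
  \<open>cmod (l2 * l3) = q\<close>.\<close>

lemma cmod_u: "cmod u = 1"
proof -
  have 1: "q * Im \<tau>2 = (cmod l2)\<^sup>2 * Im \<tau>1" "q * Im \<tau>1 = (cmod l3)\<^sup>2 * Im \<tau>2"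
    using acts_det[OF acts(2)] acts_det[OF acts(3)] by (simp_all add: q_def dets(6))
  have "q\<^sup>2 * (Im \<tau>1 * Im \<tau>2) = (q * Im \<tau>2) * (q * Im \<tau>1)"
    by (simp add: power2_eq_square mult_ac)
  also have "\<dots> = (cmod (l2 * l3))\<^sup>2 * (Im \<tau>1 * Im \<tau>2)"
    unfolding 1 by (simp add: norm_mult power2_eq_square mult_ac)
  finally have "q\<^sup>2 = (cmod (l2 * l3))\<^sup>2" by simp
  then have "cmod (l2 * l3) = q" using p_q_pos by simp
  then show ?thesis using p_q_pos by (simp add: u_def norm_divide norm_mult)
qed

lemma u_cnj: "u * cnj u = 1" "cnj u * u = 1"
  using complex_norm_square[of u] by (simp_all add: cmod_u mult.commute)

lemma u_nz [simp]: "u \<noteq> 0"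
  using cmod_u by auto

text \<open>The last Type III equation, read on multipliers, is
  \<open>p * l2 / l1 = - q * l4 / l3\<close>. Insert \<open>p = l1 * cnj l1\<close> and
  \<open>l2 * l3 = q * u\<close>.\<close>

lemma l4_eq: "l4 = - u * cnj l1"
proof -
  have "acts \<tau>2 \<tau>1 (det A1 \<cdot> (matrix_inv A1 ** A2)) (of_rat (det A1) * (inverse l1 * l2))"
    using dets acts by (intro acts_smult acts_mult[OF acts_matrix_inv]) auto
  moreover have "acts \<tau>2 \<tau>1 (- (det A2 \<cdot> (matrix_inv A3 ** A4))) (- (of_rat (det A2) * (inverse l3 * l4)))"
    using dets acts by (intro acts_minus acts_smult acts_mult[OF acts_matrix_inv]) auto
  ultimately have "of_rat (det A1) * (inverse l1 * l2) = - (of_rat (det A2) * (inverse l3 * l4))"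
    unfolding dets(8) by (rule acts_unique)
  then have "of_real p * (inverse l1 * l2) = - (of_real q * (inverse l3 * l4))"
    by (simp add: p_def q_def complex_of_rat_eq)
  then have "of_real p * (l2 * l3) = - (of_real q * l1 * l4)"
    by (simp add: field_simps)
  then have "of_real q * l1 * (l4 + u * cnj l1) = 0"
    unfolding l2_l3 p_eq by (simp add: algebra_simps)
  then have "l4 + u * cnj l1 = 0" using p_q_pos by simp
  then show ?thesis by (simp add: eq_neg_iff_add_eq_0)
qed

text \<open>The multipliers of rational matrices preserving the line through
  \<open>(1, \<tau>1)\<close>: the field generated by \<open>\<tau>1\<close> if
  \<open>\<tau>1\<close> is quadratic, and the rationals otherwise. Describing it by matrices makes
  traces available.\<close>

definition E :: "complex set" where "E = {z. \<exists>A. acts \<tau>1 \<tau>1 A z}"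

lemma E_mult: "z \<in> E \<Longrightarrow> w \<in> E \<Longrightarrow> z * w \<in> E"
  and E_add: "z \<in> E \<Longrightarrow> w \<in> E \<Longrightarrow> z + w \<in> E"
  and E_minus: "z \<in> E \<Longrightarrow> - z \<in> E"
  and E_rat: "of_rat r \<in> E"
  unfolding E_def mem_Collect_eq using acts_mult acts_add acts_minus acts_mat by blast+

lemma E_Re_2: "z \<in> E \<Longrightarrow> \<exists>r. 2 * Re z = of_rat r"
  unfolding E_def using acts_trace Im_nz by blast

lemma E_Re: "z \<in> E \<Longrightarrow> Re z \<in> \<rat>"
proof -
  assume "z \<in> E"
  then obtain r where "2 * Re z = of_rat r" using E_Re_2 by blast
  then have "Re z = of_rat (r / 2)" by (simp add: of_rat_divide)
  then show ?thesis by simp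
qed

lemma E_cnj:
  assumes "z \<in> E"
  shows "cnj z \<in> E"
proof -
  obtain r where r: "2 * Re z = of_rat r" using E_Re_2 assms by blast
  have "cnj z = of_real (2 * Re z) + - z" by (simp add: complex_eq_iff)
  also have "of_real (2 * Re z) = (of_rat r :: complex)" by (simp only: r complex_of_rat_eq)
  finally show ?thesis using assms E_rat E_add E_minus by metis
qed

lemma E_Im:
  assumes "z \<in> E"
  obtains r where "r \<in> \<rat>" "Im z = r * Im \<tau>1"
proof -
  obtain A where "acts \<tau>1 \<tau>1 A z" using assms by (auto simp: E_def)
  then have "z = of_rat (A $ 1 $ 1) + of_rat (A $ 1 $ 2) * \<tau>1" by (simp add: acts_def)
  then have "Im z = of_rat (A $ 1 $ 2) * Im \<tau>1" by (simp add: complex_of_rat_eq)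
  then show ?thesis by (intro that[of "of_rat (A $ 1 $ 2)"]) auto
qed

text \<open>Both imaginary parts are rational multiples of \<open>Im \<tau>1\<close>. An irrational
  ratio is how impossible pairs \<open>(a, b)\<close> are refuted.\<close>

lemma E_Im_ratio:
  assumes "z \<in> E" "w \<in> E" "Im w \<noteq> 0"
  shows "Im z / Im w \<in> \<rat>"
proof -
  obtain r where r: "r \<in> \<rat>" "Im z = r * Im \<tau>1" using E_Im[OF assms(1)] .
  obtain s where s: "s \<in> \<rat>" "Im w = s * Im \<tau>1" using E_Im[OF assms(2)] .
  have "Im z / Im w = r / s" using assms(3) by (simp add: r s)
  then show ?thesis using r s by simp
qed

lemma l1_E: "l1 \<in> E"
  using acts unfolding E_def by blast

text \<open>\<open>A2\<close> and \<open>A3\<close> go between two different lines, but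
  \<open>A2 ** A3\<close> returns to the first; dividing by \<open>det A2\<close> turns its
  multiplier into \<open>u\<close>.\<close>

lemma u_E: "u \<in> E"
proof -
  have "acts \<tau>1 \<tau>1 (inverse (det A2) \<cdot> (A2 ** A3)) (of_rat (inverse (det A2)) * (l2 * l3))"
    by (intro acts_smult acts_mult[OF acts(2,3)])
  moreover have "of_rat (inverse (det A2)) * (l2 * l3) = u"
    by (simp add: u_def q_def of_rat_divide complex_of_rat_eq inverse_eq_divide)
  ultimately show ?thesis unfolding E_def by auto
qed

text \<open>
  On the tangent plane \<open>M\<close> has trace \<open>t\<close> and determinant \<open>- u\<close>, and \<open>iota ** M\<close> has trace
  \<open>s\<close> and determinant \<open>u\<close>.  As \<open>t\<^sup>2 = - a u\<close> and \<open>s\<^sup>2 = b u\<close>, the numbers \<open>a - 2\<close> and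
  \<open>b - 2\<close> are \<open>z + 1 / z\<close> for the ratio \<open>z\<close> of the two eigenvalues, a root of unity.
\<close>

definition w :: complex where "w = u * (cnj l1)\<^sup>2"
definition a :: real where "a = 2 * p - 2 * Re w"
definition b :: real where "b = 2 * p + 2 * Re w"
definition t :: complex where "t = l1 + l4"
definition s :: complex where "s = l1 - l4"

lemma w_E: "w \<in> E"
  unfolding w_def power2_eq_square by (intro E_mult u_E E_cnj l1_E)

lemma t_eq: "t = l1 - u * cnj l1" and s_eq: "s = l1 + u * cnj l1"
  unfolding t_def s_def using l4_eq by simp_all

lemma t_E: "t \<in> E"
  unfolding t_eq diff_conv_add_uminus by (intro E_add E_mult E_minus u_E E_cnj l1_E)

lemma w_eq: "w + cnj w = of_real (2 * Re w)" "w + l1\<^sup>2 * cnj u = of_real (2 * Re w)"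
  using complex_add_cnj[of w] by (simp_all add: w_def mult.commute)

text \<open>In fact \<open>cnj t = - cnj u * t\<close>, so \<open>t\<^sup>2\<close> is
  \<open>- u\<close> times the squared modulus of \<open>t\<close>. Thus \<open>a\<close> and
  \<open>b\<close> are the squared moduli of \<open>t\<close> and \<open>s\<close>, and
  \<open>a + b = 4 * p\<close> is the parallelogram law.\<close>

lemma t_square: "t\<^sup>2 = - of_real a * u"
proof -
  have "t\<^sup>2 = (l1 - u * cnj l1)\<^sup>2" by (simp only: t_eq)
  also have "\<dots> = l1\<^sup>2 * (cnj u * u) - 2 * u * (l1 * cnj l1) + u * w"
    unfolding u_cnj by (simp add: w_def power2_eq_square algebra_simps)
  also have "\<dots> = u * ((w + l1\<^sup>2 * cnj u) - 2 * of_real p)"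
    unfolding p_eq by (simp add: algebra_simps)
  finally show ?thesis unfolding w_eq a_def by (simp add: algebra_simps)
qed

lemma s_square: "s\<^sup>2 = of_real b * u"
proof -
  have "s\<^sup>2 = (l1 + u * cnj l1)\<^sup>2" by (simp only: s_eq)
  also have "\<dots> = l1\<^sup>2 * (cnj u * u) + 2 * u * (l1 * cnj l1) + u * w"
    unfolding u_cnj by (simp add: w_def power2_eq_square algebra_simps)
  also have "\<dots> = u * ((w + l1\<^sup>2 * cnj u) + 2 * of_real p)"
    unfolding p_eq by (simp add: algebra_simps)
  finally show ?thesis unfolding w_eq b_def by (simp add: algebra_simps)
qed

lemma det_N: "l1 * l4 - l2 * l3 = - u"
proof -
  have "l1 * l4 - l2 * l3 = - (of_real (p + q) * u)"
    unfolding l2_l3 l4_eq by (simp add: p_eq algebra_simps)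
  then show ?thesis by (simp add: p_q)
qed

abbreviation N :: "complex^2^2" where "N \<equiv> vector [vector [l1, l2], vector [l3, l4]]"
abbreviation N' :: "complex^2^2" where "N' \<equiv> vector [vector [l1, l2], vector [- l3, - l4]]"
abbreviation N'' :: "complex^2^2" where
  "N'' \<equiv> vector [vector [l1\<^sup>2 + l2 * l3, l2 * t], vector [- (l3 * t), - (l4\<^sup>2 + l2 * l3)]]"

lemma rep_M: "rep \<tau>1 \<tau>2 M N"
  unfolding M by (rule rep_block[OF acts])

lemma iota_block: "iota ** block B1 B2 B3 B4 = block B1 B2 (- B3) (- B4)"
proof -
  have "(- mat 1) ** B = - B" "0 ** B = 0" for B :: "rat^2^2"
    by (simp_all add: vec_eq_iff forall_2 matrix_matrix_mult_def sum_2 mat_def)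
  then show ?thesis unfolding iota_def block_mult by (simp add: block_eq_iff)
qed

lemma rep_iota_M: "rep \<tau>1 \<tau>2 (iota ** M) N'"
  unfolding M iota_block by (intro rep_block acts_minus acts)

lemma square_block:
  "M ** M = block (A1 ** A1 + A2 ** A3) (A1 ** A2 + A2 ** A4)
     (A3 ** A1 + A4 ** A3) (A3 ** A2 + A4 ** A4)"
  unfolding M block_mult ..

text \<open>The off-diagonal multipliers of the square carry the factor \<open>t\<close>, and the
  first diagonal one is \<open>l1\<^sup>2 + q * u\<close>. Hence the type of \<open>M ** M\<close>
  becomes a condition on these two numbers.\<close>

lemma acts_square:
  "acts \<tau>1 \<tau>1 (A1 ** A1 + A2 ** A3) (l1\<^sup>2 + l2 * l3)"
  "acts \<tau>2 \<tau>1 (A1 ** A2 + A2 ** A4) (l2 * t)"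
  "acts \<tau>1 \<tau>2 (A3 ** A1 + A4 ** A3) (l3 * t)"
  "acts \<tau>2 \<tau>2 (A3 ** A2 + A4 ** A4) (l4\<^sup>2 + l2 * l3)"
proof -
  have eq: "l2 * t = l1 * l2 + l2 * l4" "l3 * t = l3 * l1 + l4 * l3"
    "l4\<^sup>2 + l2 * l3 = l3 * l2 + l4 * l4" "l1\<^sup>2 + l2 * l3 = l1 * l1 + l2 * l3"
    by (simp_all add: t_def power2_eq_square algebra_simps)
  show "acts \<tau>1 \<tau>1 (A1 ** A1 + A2 ** A3) (l1\<^sup>2 + l2 * l3)"
    "acts \<tau>2 \<tau>1 (A1 ** A2 + A2 ** A4) (l2 * t)"
    "acts \<tau>1 \<tau>2 (A3 ** A1 + A4 ** A3) (l3 * t)"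
    "acts \<tau>2 \<tau>2 (A3 ** A2 + A4 ** A4) (l4\<^sup>2 + l2 * l3)"
    unfolding eq
    by (intro acts_add acts_mult[OF acts(1,1)] acts_mult[OF acts(1,2)] acts_mult[OF acts(2,3)]
        acts_mult[OF acts(2,4)] acts_mult[OF acts(3,1)] acts_mult[OF acts(3,2)]
        acts_mult[OF acts(4,3)] acts_mult[OF acts(4,4)])+
qed

lemma rep_iota_square: "rep \<tau>1 \<tau>2 (iota ** (M ** M)) N''"
  unfolding square_block iota_block by (intro rep_block acts_minus acts_square)

lemma a_b: "a \<in> {0, 1, 2, 3, 4}" "b \<in> {0, 1, 2, 3, 4}" and u_root_of_unity: "\<exists>n>0. u ^ n = 1"
proof -
  obtain r where r: "2 * Re w = of_rat r" using E_Re_2[OF w_E] by blast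
  define ca cb where "ca = 2 * det A1 - r - 2" and "cb = 2 * det A1 + r - 2"
  have a: "a = of_rat (ca + 2)" and b: "b = of_rat (cb + 2)"
    by (simp_all add: a_def b_def r ca_def cb_def p_def of_rat_add of_rat_diff of_rat_mult)
  obtain n where n: "n > 0" "((**) M ^^ n) (mat 1) = mat 1" using order by blast
  have "z ^ n = 1" if "z\<^sup>2 = t * z - (- u)" for z
    using eigenvalue_of_finite_order[OF rep_M n(2), of z] that
    by (simp add: t_def det_2 det_N)
  from root_ratio_rat[of t "- u" n ca, OF this n(1)] t_square
  have ca: "ca \<in> {-2, -1, 0, 1, 2}" and u: "(- u) ^ n = 1"
    by (simp_all add: a complex_of_rat_eq)
  \<comment> \<open>The determinant of the action is \<open>- u\<close>; doubling the exponent
    removes the sign.\<close>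
  have "u ^ (2 * n) = ((- u) ^ n)\<^sup>2" by (simp add: power_mult power_mult_distrib mult.commute flip: power_mult)
  then have "u ^ (2 * n) = 1" by (simp add: u)
  then show "\<exists>n>0. u ^ n = 1" using n(1) by (intro exI[of _ "2 * n"]) auto
  obtain m where m: "m > 0" "((**) (iota ** M) ^^ m) (mat 1) = mat 1" using order_iota by blast
  have "z ^ m = 1" if "z\<^sup>2 = s * z - u" for z
    using eigenvalue_of_finite_order[OF rep_iota_M m(2), of z] that det_N
    by (simp add: s_def det_2 algebra_simps)
  from root_ratio_rat[of s u m cb, OF this m(1)] s_square
  have cb: "cb \<in> {-2, -1, 0, 1, 2}" by (simp_all add: b complex_of_rat_eq)
  show "a \<in> {0, 1, 2, 3, 4}" "b \<in> {0, 1, 2, 3, 4}"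
    using ca cb by (auto simp: a b)
qed

lemma a_plus_b: "a + b = 4 * p" "a + b \<in> {1, 2, 3}"
proof -
  show eq: "a + b = 4 * p" by (simp add: a_def b_def)
  have "0 < a + b" "a + b < 4" using p_q p_q_pos eq by auto
  then show "a + b \<in> {1, 2, 3}" using a_b by auto
qed

text \<open>The product is \<open>4 * p\<^sup>2 - 4 * (Re w)\<^sup>2\<close>, and
  \<open>cmod w = p\<close> since \<open>u\<close> has modulus 1.\<close>

lemma a_mult_b: "a * b = 4 * (Im w)\<^sup>2"
proof -
  have "cmod w = p" by (simp add: w_def norm_mult norm_power cmod_u p_altdef)
  then have "p\<^sup>2 = (Re w)\<^sup>2 + (Im w)\<^sup>2" by (metis cmod_power2)
  then show ?thesis by (simp add: a_def b_def power2_eq_square algebra_simps)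
qed

lemma Re_u: "2 * Re u \<in> {-2, -1, 0, 1, 2}"
proof -
  obtain r where r: "2 * Re u = of_rat r" using E_Re_2[OF u_E] by blast
  have "inverse u = cnj u" using u_cnj by (metis inverse_unique)
  then have "u + inverse u = of_rat r"
    using complex_add_cnj[of u] by (simp only: r complex_of_rat_eq)
  then have "r \<in> {-2, -1, 0, 1, 2}" using u_root_of_unity root_of_unity_rat_trace by blast
  then show ?thesis unfolding r by auto
qed

end

section \<open>Imaginary quadratic fields and the cusp shapes\<close>

lemma complex_subfield_rat_adjoin: "complex_subfield (rat_adjoin z)"
  by (auto simp: rat_adjoin_def complex_subfield_def)

lemma rat_adjoin_self: "z \<in> rat_adjoin z"
  by (auto simp: rat_adjoin_def)

lemma of_rat_in_complex_subfield:
  assumes K: "complex_subfield K"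
  shows "of_rat x \<in> K"
proof -
  have nat: "of_nat n \<in> K" for n
    by (induction n) (use K in \<open>auto simp: complex_subfield_def\<close>)
  have int: "of_int k \<in> K" for k
  proof (cases k rule: int_cases2)
    case (nonneg n)
    then show ?thesis using nat[of n] by simp
  next
    case (nonpos n)
    have "- of_nat n \<in> K" using nat[of n] K by (simp add: complex_subfield_def)
    then show ?thesis by (simp add: nonpos)
  qed
  obtain a b where "quotient_of x = (a, b)" by force
  then have "of_rat x = of_int a * inverse (of_int b :: complex)"
    using quotient_of_div[of x a b] by (simp add: of_rat_divide divide_inverse[symmetric])
  then show ?thesis using K int[of a] int[of b] by (simp add: complex_subfield_def)
qed

lemma complex_subfield_divide:
  "complex_subfield K \<Longrightarrow> x \<in> K \<Longrightarrow> y \<in> K \<Longrightarrow> x / y \<in> K"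
  by (simp add: complex_subfield_def divide_inverse)

lemma complex_subfield_diff:
  "complex_subfield K \<Longrightarrow> x \<in> K \<Longrightarrow> y \<in> K \<Longrightarrow> x - y \<in> K"
  unfolding diff_conv_add_uminus[of x y] complex_subfield_def by blast

lemma csqrt_minus_real: "d \<ge> 0 \<Longrightarrow> csqrt (- of_real d) = \<i> * of_real (sqrt d)"
  using csqrt_of_real_nonpos[of "- d"] by simp

text \<open>These combinations already form a subfield containing the square root; inverses exist
  because the norm \<open>x\<^sup>2 + d * y\<^sup>2\<close> is positive for
  \<open>d > 0\<close>.\<close>

lemma rat_adjoin_csqrt:
  assumes "d > 0" "z \<in> rat_adjoin (csqrt (- of_nat d))"
  obtains x y where "z = of_rat x + of_rat y * csqrt (- of_nat d)"
proof -
  define \<omega> where "\<omega> = csqrt (- of_nat d)"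
  have \<omega>2: "\<omega> * \<omega> = - of_nat d" unfolding \<omega>_def by (metis power2_csqrt power2_eq_square)
  define L where "L = {of_rat x + of_rat y * \<omega> | x y. True}"
  have L: "of_rat x + of_rat y * \<omega> \<in> L" for x y by (auto simp: L_def)
  have "complex_subfield L"
    unfolding complex_subfield_def
  proof (intro conjI ballI)
    show "0 \<in> L" "1 \<in> L" using L[of 0 0] L[of 1 0] by simp_all
    fix z z' assume "z \<in> L" "z' \<in> L"
    then obtain x y x' y' where z: "z = of_rat x + of_rat y * \<omega>" "z' = of_rat x' + of_rat y' * \<omega>"
      by (auto simp: L_def)
    show "z + z' \<in> L"
      using L[of "x + x'" "y + y'"] by (simp add: z of_rat_add algebra_simps)
    have "z * z' = of_rat x * of_rat x' + of_rat y * of_rat y' * (\<omega> * \<omega>) +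
        (of_rat x * of_rat y' + of_rat x' * of_rat y) * \<omega>"
      by (simp add: z algebra_simps)
    then show "z * z' \<in> L"
      using L[of "x * x' - y * y' * of_nat d" "x * y' + x' * y"]
      by (simp add: \<omega>2 of_rat_add of_rat_diff of_rat_mult)
  next
    fix z assume "z \<in> L"
    then obtain x y where z: "z = of_rat x + of_rat y * \<omega>" by (auto simp: L_def)
    show "- z \<in> L" using L[of "- x" "- y"] by (simp add: z of_rat_minus)
    show "inverse z \<in> L"
    proof (cases "x = 0 \<and> y = 0")
      case True
      then show ?thesis using L[of 0 0] by (simp add: z)
    next
      case False
      define n where "n = x * x + y * y * of_nat d"
      have "n > 0"
      proof (cases "x = 0")
        case True
        then have "y * y > 0" using False by (auto simp: zero_less_mult_iff linorder_neq_iff)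
        then show ?thesis using True assms(1) by (simp add: n_def)
      next
        case False
        then have "x * x > 0" by (auto simp: zero_less_mult_iff linorder_neq_iff)
        moreover have "y * y * of_nat d \<ge> 0" by simp
        ultimately show ?thesis unfolding n_def by linarith
      qed
      have "z * (of_rat x - of_rat y * \<omega>) = of_rat x * of_rat x - of_rat y * of_rat y * (\<omega> * \<omega>)"
        by (simp add: z algebra_simps)
      also have "\<dots> = of_rat n" by (simp add: \<omega>2 n_def of_rat_add of_rat_mult)
      finally have "z * ((of_rat x - of_rat y * \<omega>) / of_rat n) = 1" using \<open>n > 0\<close> by simp
      then have "inverse z = (of_rat x - of_rat y * \<omega>) / of_rat n" by (rule inverse_unique)
      also have "\<dots> = of_rat (x / n) + of_rat (- y / n) * \<omega>"
        using \<open>n > 0\<close> by (simp add: of_rat_divide of_rat_minus field_simps)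
      finally show ?thesis using L by simp
    qed
  qed
  moreover have "\<omega> \<in> L" using L[of 0 1] by simp
  ultimately have "z \<in> L" using assms(2) unfolding rat_adjoin_def \<omega>_def[symmetric] by blast
  then show ?thesis using that unfolding L_def \<omega>_def by blast
qed

text \<open>Multiplying by \<open>d\<close> makes \<open>e * d\<close> a rational square, which
  distinct \<open>e\<close> and \<open>d\<close> forbid. This is how an integer is matched to its
  field.\<close>

lemma rat_square_ratio:
  assumes "r \<in> \<rat>" "d \<in> {1, 2, 3}" "e \<in> {1, 2, 3}" "r\<^sup>2 * of_nat d = (e :: real)"
  shows "e = of_nat d"
proof (rule ccontr)
  assume "e \<noteq> of_nat d"
  have "(r * of_nat d)\<^sup>2 = (r\<^sup>2 * of_nat d) * of_nat d" by (simp add: power2_eq_square mult_ac)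
  also have "\<dots> = e * of_nat d" by (simp only: assms(4))
  finally have "(r * of_nat d)\<^sup>2 = e * of_nat d" .
  moreover have "e * of_nat d \<in> {2, 3, 6}" using assms(2,3) \<open>e \<noteq> of_nat d\<close> by auto
  moreover have "r * of_nat d \<in> \<rat>" using assms(1) by simp
  ultimately show False using rat_square_ne[of "r * of_nat d"] by auto
qed

context finite_type_III
begin

lemma E_Im_square:
  assumes "\<tau>1 \<in> rat_adjoin (csqrt (- of_nat d))" "d > 0" "z \<in> E"
  obtains r where "r \<in> \<rat>" "(Im z)\<^sup>2 = r\<^sup>2 * of_nat d"
proof -
  obtain r where r: "r \<in> \<rat>" "Im z = r * Im \<tau>1" using E_Im[OF assms(3)] .
  obtain x y where "\<tau>1 = of_rat x + of_rat y * csqrt (- of_nat d)"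
    using rat_adjoin_csqrt[OF assms(2,1)] .
  then have "Im \<tau>1 = of_rat y * sqrt (of_nat d)"
    using csqrt_minus_real[of "of_nat d"] by (simp add: complex_of_rat_eq)
  then have "(Im z)\<^sup>2 = (r * of_rat y)\<^sup>2 * of_nat d" by (simp add: r power_mult_distrib)
  then show ?thesis using r(1) by (intro that[of "r * of_rat y"]) auto
qed

text \<open>A nonreal \<open>z\<close> in \<open>E\<close> is a rational affine function of
  \<open>\<tau>1\<close> and can be solved for \<open>\<tau>1\<close>. Then \<open>\<tau>2\<close>
  is the image of \<open>\<tau>1\<close> under the fractional linear map given by \<open>A3\<close>,
  with denominator \<open>l3 \<noteq> 0\<close>.\<close>

lemma cusps_in_rat_adjoin:
  assumes "z \<in> E" "r \<in> \<rat>" "r \<noteq> 0" "d > 0" "(Im z)\<^sup>2 = r\<^sup>2 * of_nat d"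
  shows "\<tau>1 \<in> rat_adjoin (csqrt (- of_nat d)) \<and> \<tau>2 \<in> rat_adjoin (csqrt (- of_nat d))"
proof -
  define K where "K = rat_adjoin (csqrt (- of_nat d))"
  have K: "complex_subfield K" and dK: "csqrt (- of_nat d) \<in> K"
    by (simp_all add: K_def complex_subfield_rat_adjoin rat_adjoin_self)
  have add_mult: "x + y \<in> K" "x * y \<in> K" if "x \<in> K" "y \<in> K" for x y
    using K that by (auto simp: complex_subfield_def)
  note closed = add_mult complex_subfield_divide[OF K] complex_subfield_diff[OF K]
    of_rat_in_complex_subfield[OF K]
  have "(Im z)\<^sup>2 = (r * sqrt (of_nat d))\<^sup>2" by (simp add: assms(5) power_mult_distrib)
  then have "Im z = r * sqrt (of_nat d) \<or> Im z = (- r) * sqrt (of_nat d)"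
    by (auto simp: power2_eq_iff)
  then obtain r' where r': "r' \<in> \<rat>" "r' \<noteq> 0" "Im z = r' * sqrt (of_nat d)"
    using assms(2,3) by (metis Rats_minus_iff neg_equal_0_iff_equal)
  then obtain y where y: "r' = of_rat y" by (auto elim: Rats_cases)
  obtain x where x: "Re z = of_rat x" using E_Re[OF assms(1)] by (auto elim: Rats_cases)
  have "z = of_rat x + of_rat y * csqrt (- of_nat d)"
    using csqrt_minus_real[of "of_nat d"] r' x y by (simp add: complex_eq_iff complex_of_rat_eq)
  then have "z \<in> K" using closed dK by simp
  obtain A where A: "acts \<tau>1 \<tau>1 A z" using assms(1) by (auto simp: E_def)
  then have zA: "z = of_rat (A $ 1 $ 1) + of_rat (A $ 1 $ 2) * \<tau>1" by (simp add: acts_def)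
  have "Im z \<noteq> 0" using r' assms(4) by simp
  then have "A $ 1 $ 2 \<noteq> 0" unfolding zA by (auto simp: complex_of_rat_eq)
  then have "\<tau>1 = (z - of_rat (A $ 1 $ 1)) / of_rat (A $ 1 $ 2)"
    unfolding zA by (simp add: field_simps)
  then have 1: "\<tau>1 \<in> K" using closed \<open>z \<in> K\<close> by metis
  have "l3 = of_rat (A3 $ 1 $ 1) + of_rat (A3 $ 1 $ 2) * \<tau>1"
    "of_rat (A3 $ 2 $ 1) + of_rat (A3 $ 2 $ 2) * \<tau>1 = l3 * \<tau>2"
    using acts(3) by (simp_all add: acts_def)
  then have "\<tau>2 = (of_rat (A3 $ 2 $ 1) + of_rat (A3 $ 2 $ 2) * \<tau>1) /
      (of_rat (A3 $ 1 $ 1) + of_rat (A3 $ 1 $ 2) * \<tau>1)"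
    by (metis ev_nz(3) nonzero_mult_div_cancel_left)
  then have "\<tau>2 \<in> K" using closed 1 by metis
  with 1 show ?thesis by (simp add: K_def)
qed

lemma a_b_cases:
  obtains "a = 1" "b = 0" | "a = 2" "b = 0" | "a = 3" "b = 0" | "a = 0" "b = 1" | "a = 0" "b = 2"
  | "a = 0" "b = 3" | "a = 1" "b = 1" | "a = 1" "b = 2" | "a = 2" "b = 1"
  using a_b a_plus_b(2) by auto

lemma u_norm: "(Re u)\<^sup>2 + (Im u)\<^sup>2 = 1"
  using cmod_u cmod_power2[of u] by simp

lemma p_norm: "p = (Re l1)\<^sup>2 + (Im l1)\<^sup>2"
  by (simp add: p_altdef cmod_power2)

text \<open>A nonreal element of \<open>E\<close> is sought among \<open>w\<close>,
  \<open>u\<close>, \<open>l1\<close>. If \<open>w\<close> is nonreal, \<open>a * b\<close> is 1 or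
  2. If only \<open>w\<close> is real, \<open>u\<close> is a root of unity of order 3, 4 or 6. If
  both are real, \<open>l1\<close> is imaginary with
  \<open>4 * (Im l1)\<^sup>2 = a + b\<close>.\<close>

lemma cusp_field:
  assumes "Im l1 \<noteq> 0"
  shows "\<exists>d\<in>{1, 2, 3 :: nat}. \<tau>1 \<in> rat_adjoin (csqrt (- of_nat d)) \<and> \<tau>2 \<in> rat_adjoin (csqrt (- of_nat d))"
proof (cases "Im w = 0")
  case False
  then have "a * b \<noteq> 0" using a_mult_b by simp
  then have "a * b = of_nat 1 \<or> a * b = of_nat 2" by (cases rule: a_b_cases) auto
  then obtain d where d: "d \<in> {1, 2 :: nat}" "a * b = of_nat d" by auto
  then have "(Im w)\<^sup>2 = (1/2)\<^sup>2 * of_nat d" using a_mult_b by (simp add: power2_eq_square)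
  from cusps_in_rat_adjoin[OF w_E _ _ _ this] d(1) show ?thesis by auto
next
  case w: True
  show ?thesis
  proof (cases "Im u = 0")
    case False
    then have "Re u \<noteq> 1" "Re u \<noteq> -1" using u_norm by auto
    with Re_u have "2 * Re u = -1 \<or> Re u = 0 \<or> 2 * Re u = 1" by auto
    then have "Re u = -1/2 \<or> Re u = 0 \<or> Re u = 1/2" by auto
    then have "(Im u)\<^sup>2 = (1/2)\<^sup>2 * of_nat 3 \<or> (Im u)\<^sup>2 = 1\<^sup>2 * of_nat 1"
      using u_norm by (elim disjE) (simp_all add: power2_eq_square)
    then show ?thesis
      using cusps_in_rat_adjoin[OF u_E, of "1/2" 3] cusps_in_rat_adjoin[OF u_E, of 1 1] by auto
  next
    case True
    then have "Re u \<noteq> 0" using u_norm by auto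
    have "Im w = Re u * (- 2 * Re l1 * Im l1)"
      using True by (simp add: w_def power2_eq_square)
    then have "Re l1 = 0" using w \<open>Re u \<noteq> 0\<close> assms by simp
    then have "4 * (Im l1)\<^sup>2 \<in> {1, 2, 3}" using a_plus_b p_norm by simp
    then obtain d where d: "d \<in> {1, 2, 3 :: nat}" "4 * (Im l1)\<^sup>2 = of_nat d" by force
    then have "(Im l1)\<^sup>2 = (1/2)\<^sup>2 * of_nat d" by (simp add: power2_eq_square)
    from cusps_in_rat_adjoin[OF l1_E _ _ _ this] d(1) show ?thesis by auto
  qed
qed

section \<open>Recognising the blocks\<close>

lemma acts_inv: "acts \<tau>1 \<tau>2 (matrix_inv A2) (inverse l2)" "acts \<tau>1 \<tau>1 (matrix_inv A1) (inverse l1)"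
  by (intro acts_matrix_inv acts dets ev_nz)+

text \<open>Recognition by multipliers: \<open>l3 = q * u / l2\<close>, and the inverse of
  \<open>A2\<close> has multiplier \<open>1 / l2\<close>. So \<open>A3\<close> is explicit when
  \<open>q * u\<close> is rational, or, in the next lemma, a rational multiple of
  \<open>l1\<^sup>2\<close>.\<close>

lemma A3_eqI: "of_real q * u = of_rat c \<Longrightarrow> A3 = c \<cdot> matrix_inv A2"
proof -
  assume "of_real q * u = of_rat c"
  then have "l3 = of_rat c * inverse l2" using l2_l3 by (simp add: field_simps)
  with acts_smult[OF acts_inv(1), of c] acts(3) show ?thesis using acts_inj Im_nz by metis
qed

lemma A3_eqI':
  "of_real q * u = of_rat c * l1\<^sup>2 \<Longrightarrow> A3 = c \<cdot> (matrix_inv A2 ** A1 ** A1)"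
proof -
  assume "of_real q * u = of_rat c * l1\<^sup>2"
  then have "l3 = of_rat c * (inverse l2 * l1 * l1)"
    using l2_l3 by (simp add: field_simps power2_eq_square)
  with acts_smult[OF acts_mult[OF acts_mult[OF acts_inv(1) acts(1)] acts(1)], of c] acts(3)
  show ?thesis using acts_inj Im_nz by metis
qed

text \<open>Conjugation by \<open>A2\<close> carries \<open>A1\<close> to the second line with the
  same multiplier, so comparing \<open>l4\<close> with \<open>l1\<close> identifies
  \<open>A4\<close>.\<close>

lemma acts_conj: "acts \<tau>2 \<tau>2 (matrix_inv A2 ** A1 ** A2) l1"
  using acts_mult[OF acts_mult[OF acts_inv(1) acts(1)] acts(2)] by (simp add: field_simps)

lemma A4_eqI: "l4 = l1 \<Longrightarrow> A4 = matrix_inv A2 ** A1 ** A2"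
  using acts_conj acts(4) acts_inj Im_nz by metis

lemma A4_eqI_minus: "l4 = - l1 \<Longrightarrow> A4 = - (matrix_inv A2 ** A1 ** A2)"
  using acts_minus[OF acts_conj] acts(4) acts_inj Im_nz by metis

lemma A4_eqI_inv:
  "l4 * l1 = of_rat c \<Longrightarrow> A4 = c \<cdot> (matrix_inv A2 ** matrix_inv A1 ** A2)"
proof -
  assume "l4 * l1 = of_rat c"
  then have "l4 = of_rat c * (inverse l2 * inverse l1 * l2)" by (simp add: field_simps)
  with acts_smult[OF acts_mult[OF acts_mult[OF acts_inv] acts(2)], of c] acts(4)
  show ?thesis using acts_inj Im_nz by metis
qed

lemma A1_scalar_iff: "(\<exists>c. A1 = mat c) \<longleftrightarrow> Im l1 = 0"
  using acts_scalar_iff[OF _ acts(1)] by simp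

lemma minpoly_A1:
  assumes "Im l1 \<noteq> 0" "l1\<^sup>2 + of_rat c1 * l1 + of_rat c0 = 0"
  shows "minpoly A1 = [:c0, c1, 1:]"
proof (rule minpoly_quadratic)
  show "\<nexists>c. A1 = mat c" using A1_scalar_iff assms(1) by simp
  have "acts \<tau>1 \<tau>1 (A1 ** A1 + c1 \<cdot> A1 + c0 \<cdot> mat 1) (l1 * l1 + of_rat c1 * l1 + of_rat c0 * of_rat 1)"
    by (intro acts_add acts_smult acts_mat acts acts_mult[OF acts(1,1)])
  then show "A1 ** A1 + c1 \<cdot> A1 + c0 \<cdot> mat 1 = 0"
    using assms(2) acts_zero acts_inj[of \<tau>1] Im_nz by (metis mult.right_neutral of_rat_1 power2_eq_square)
qed

text \<open>The polynomial has the roots \<open>l1\<close> and \<open>cnj l1\<close>, of sum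
  \<open>2 * Re l1\<close> and product \<open>p\<close>.\<close>

lemma minpoly_A1_Re:
  assumes "Im l1 \<noteq> 0" "2 * Re l1 = - of_rat c1" "p = of_rat c0"
  shows "minpoly A1 = [:c0, c1, 1:]"
proof (rule minpoly_A1[OF assms(1)])
  have "of_rat c1 = (- of_real (2 * Re l1) :: complex)" "of_rat c0 = l1 * cnj l1"
    using assms(2,3) p_eq(1) by (simp_all add: complex_of_rat_eq)
  then show "l1\<^sup>2 + of_rat c1 * l1 + of_rat c0 = 0"
    by (simp add: complex_eq_iff power2_eq_square algebra_simps)
qed

section \<open>Minimal polynomials and types of squares in terms of \<open>t\<close>,
  \<open>s\<close> and \<open>u\<close>\<close>

lemma annihilator_iff:
  "matrix_poly [:c0, c1, c2, c3, c4:] M = 0 \<longleftrightarrow>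
    of_rat c1 + of_rat c2 * t + of_rat c3 * (t\<^sup>2 + u) + of_rat c4 * (t ^ 3 + 2 * t * u) = 0 \<and>
    of_rat c0 + of_rat c2 * u + of_rat c3 * t * u + of_rat c4 * (t\<^sup>2 * u + u\<^sup>2) = 0"
  using matrix_poly_eq_0_iff_rep[OF Im_nz rep_M, of c0 c1 c2 c3 c4] det_N
  by (simp add: det_2 flip: t_def)

text \<open>The action of \<open>iota ** (M ** M)\<close> has trace
  \<open>l1\<^sup>2 - l4\<^sup>2 = t * s\<close> and determinant \<open>- u\<^sup>2\<close>; it is
  nonscalar because of the entry \<open>l2 * t\<close>.\<close>

lemma annihilator_iota_square_iff:
  assumes "t \<noteq> 0"
  shows "matrix_poly [:c0, c1, c2, c3, c4:] (iota ** (M ** M)) = 0 \<longleftrightarrow>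
    of_rat c1 + of_rat c2 * (t * s) + of_rat c3 * ((t * s)\<^sup>2 + u\<^sup>2) +
      of_rat c4 * ((t * s) ^ 3 + 2 * (t * s) * u\<^sup>2) = 0 \<and>
    of_rat c0 + of_rat c2 * u\<^sup>2 + of_rat c3 * (t * s) * u\<^sup>2 +
      of_rat c4 * ((t * s)\<^sup>2 * u\<^sup>2 + (u\<^sup>2)\<^sup>2) = 0"
proof -
  have tr: "N'' $ 1 $ 1 + N'' $ 2 $ 2 = t * s"
    by (simp add: t_def s_def power2_eq_square algebra_simps)
  have "- det N'' = (l1 * l4 - l2 * l3)\<^sup>2"
    by (simp add: det_2 t_def power2_eq_square algebra_simps)
  then have det: "- det N'' = u\<^sup>2" by (simp add: det_N)
  have "N'' $ 1 $ 2 \<noteq> 0" using assms by simp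
  from matrix_poly_eq_0_iff_rep[OF Im_nz rep_iota_square this, of c0 c1 c2 c3 c4]
  show ?thesis unfolding tr det .
qed

lemma is_minpoly_M: "is_minpoly (minpoly M) M"
  using order is_minpoly_minpoly matrix_poly_annihilator_of_order by metis

lemma annihilator_M: "minpoly M = f \<Longrightarrow> matrix_poly f M = 0"
  using is_minpoly_M by (auto simp: is_minpoly_def)

lemma annihilator_iota_square:
  "minpoly (iota ** (M ** M)) = f \<Longrightarrow> matrix_poly f (iota ** (M ** M)) = 0"
  using order_iota_square is_minpoly_minpoly matrix_poly_annihilator_of_order
  unfolding is_minpoly_def by metis

text \<open>The characteristic polynomial of \<open>N\<close> is then rational and annihilates
  \<open>M\<close>. This discards the rational solutions for \<open>t\<close> and \<open>u\<close>
  in the cubic and quartic cases.\<close>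

lemma degree_minpoly_M:
  assumes "t = of_rat x" "u = of_rat y"
  shows "degree (minpoly M) \<le> 2"
proof -
  have "[:- y, - x, 1:] = [:- y, - x, 1, 0, 0:]" by simp
  moreover have "matrix_poly [:- y, - x, 1, 0, 0:] M = 0"
    unfolding annihilator_iff by (simp add: assms of_rat_minus)
  ultimately have "degree (minpoly M) \<le> degree [:- y, - x, 1:]"
    using is_minpoly_M unfolding is_minpoly_def by (metis pCons_eq_0_iff one_neq_zero)
  then show ?thesis by simp
qed

lemma type_I_squareD: "type_I (M ** M) \<Longrightarrow> t = 0"
proof -
  assume "type_I (M ** M)"
  then have "A1 ** A2 + A2 ** A4 = 0"
    unfolding type_I_def square_block block_eq_iff by auto
  then have "l2 * t = 0" using acts_square(2) acts_zero acts_unique by metis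
  then show "t = 0" by simp
qed

lemma acts_det_ne_0: "acts \<sigma> \<tau> A z \<Longrightarrow> Im \<sigma> \<noteq> 0 \<Longrightarrow> det A \<noteq> 0 \<Longrightarrow> z \<noteq> 0"
  using acts_ne_0[of \<sigma> \<tau> A z] det_2[of "0 :: rat^2^2"] by auto

lemma type_II_squareD: "type_II (M ** M) \<Longrightarrow> t \<noteq> 0 \<and> l1\<^sup>2 + of_real q * u = 0"
proof -
  assume "type_II (M ** M)"
  then have *: "A1 ** A1 + A2 ** A3 = 0" "det (A1 ** A2 + A2 ** A4) \<noteq> 0"
    unfolding type_II_def square_block block_eq_iff by auto
  have "l1\<^sup>2 + l2 * l3 = 0" using *(1) acts_square(1) acts_zero acts_unique by metis
  moreover have "l2 * t \<noteq> 0" using *(2) acts_square(2) acts_det_ne_0 Im_nz by blast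
  ultimately show ?thesis by (simp add: l2_l3)
qed

lemma type_III_squareD: "type_III (M ** M) \<Longrightarrow> t \<noteq> 0 \<and> l1\<^sup>2 + of_real q * u \<noteq> 0"
proof -
  assume "type_III (M ** M)"
  then have *: "det (A1 ** A1 + A2 ** A3) \<noteq> 0" "det (A1 ** A2 + A2 ** A4) \<noteq> 0"
    unfolding type_III_def square_block block_eq_iff by auto
  have "l1\<^sup>2 + l2 * l3 \<noteq> 0" using *(1) acts_square(1) acts_det_ne_0 Im_nz by blast
  moreover have "l2 * t \<noteq> 0" using *(2) acts_square(2) acts_det_ne_0 Im_nz by blast
  ultimately show ?thesis by (simp add: l2_l3)
qed

section \<open>Normal forms determined by \<open>u\<close>, \<open>a\<close> and
  \<open>b\<close>\<close>

lemma q_eq: "q = 1 - p"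
  using p_q by simp

lemma a_b_of_u_1: "u = 1 \<Longrightarrow> a = 4 * (Im l1)\<^sup>2" "u = 1 \<Longrightarrow> b = 4 * (Re l1)\<^sup>2"
  and a_b_of_u_minus_1: "u = -1 \<Longrightarrow> a = 4 * (Re l1)\<^sup>2" "u = -1 \<Longrightarrow> b = 4 * (Im l1)\<^sup>2"
  by (simp_all add: a_def b_def w_def p_norm power2_eq_square)

text \<open>Both \<open>l4 = cnj l1\<close> and \<open>l4 = - l1\<close> hold, so \<open>l1\<close>
  is purely imaginary. The coefficient \<open>c - 1\<close> is \<open>q * u = - q\<close>.\<close>

lemma normal_form_u_minus_1_t_0:
  assumes "Im l1 \<noteq> 0" "u = -1" "t = 0" "p = of_rat c"
  shows "M = block A1 A2 ((c - 1) \<cdot> matrix_inv A2) (- (matrix_inv A2 ** A1 ** A2))"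
    "minpoly A1 = [:c, 0, 1:]"
proof -
  have "l4 = - l1" using assms(3) by (simp add: t_def add_eq_0_iff)
  have "l4 = cnj l1" using l4_eq assms(2) by simp
  with \<open>l4 = - l1\<close> have "Re l1 = 0" by (simp add: complex_eq_iff)
  with assms show "minpoly A1 = [:c, 0, 1:]" by (intro minpoly_A1_Re) simp_all
  have "of_real q * u = of_rat (c - 1)"
    by (simp add: assms q_eq of_rat_diff complex_of_rat_eq)
  from A3_eqI[OF this] A4_eqI_minus[OF \<open>l4 = - l1\<close>]
  show "M = block A1 A2 ((c - 1) \<cdot> matrix_inv A2) (- (matrix_inv A2 ** A1 ** A2))"
    by (simp only: M)
qed

lemma normal_form_u_1_Re_0:
  assumes "Im l1 \<noteq> 0" "u = 1" "Re l1 = 0" "p = of_rat c"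
  shows "M = block A1 A2 ((1 - c) \<cdot> matrix_inv A2) (matrix_inv A2 ** A1 ** A2)"
    "minpoly A1 = [:c, 0, 1:]"
proof -
  have "l4 = l1" using l4_eq assms(2,3) by (simp add: complex_eq_iff)
  show "minpoly A1 = [:c, 0, 1:]" using assms by (intro minpoly_A1_Re) simp_all
  have "of_real q * u = of_rat (1 - c)"
    by (simp add: assms q_eq of_rat_diff complex_of_rat_eq)
  from A3_eqI[OF this] A4_eqI[OF \<open>l4 = l1\<close>]
  show "M = block A1 A2 ((1 - c) \<cdot> matrix_inv A2) (matrix_inv A2 ** A1 ** A2)"
    by (simp only: M)
qed

text \<open>Since \<open>l4 * l1 = - u * p\<close>, a rational \<open>u\<close> makes
  \<open>l4\<close> a rational multiple of \<open>1 / l1\<close>, whence the inverse of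
  \<open>A1\<close> in the last block.\<close>

lemma normal_form_u_minus_1:
  assumes "Im l1 \<noteq> 0" "u = -1" "2 * Re l1 = - of_rat e" "p = of_rat c"
  shows "M = block A1 A2 ((c - 1) \<cdot> matrix_inv A2) (c \<cdot> (matrix_inv A2 ** matrix_inv A1 ** A2))"
    "minpoly A1 = [:c, e, 1:]"
proof -
  have "l4 * l1 = of_real p" using l4_eq assms(2) by (simp add: p_eq)
  then have "l4 * l1 = of_rat c" using assms by (simp add: complex_of_rat_eq)
  show "minpoly A1 = [:c, e, 1:]" using assms by (intro minpoly_A1_Re)
  have "of_real q * u = of_rat (c - 1)"
    by (simp add: assms q_eq of_rat_diff complex_of_rat_eq)
  from A3_eqI[OF this] A4_eqI_inv[OF \<open>l4 * l1 = of_rat c\<close>]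
  show "M = block A1 A2 ((c - 1) \<cdot> matrix_inv A2) (c \<cdot> (matrix_inv A2 ** matrix_inv A1 ** A2))"
    by (simp only: M)
qed

lemma normal_form_u_1:
  assumes "Im l1 \<noteq> 0" "u = 1" "2 * Re l1 = - of_rat e" "p = of_rat c"
  shows "M = block A1 A2 ((1 - c) \<cdot> matrix_inv A2) ((- c) \<cdot> (matrix_inv A2 ** matrix_inv A1 ** A2))"
    "minpoly A1 = [:c, e, 1:]"
proof -
  have "l4 * l1 = - of_real p" using l4_eq assms(2) by (simp add: p_eq)
  then have "l4 * l1 = of_rat (- c)" using assms by (simp add: complex_of_rat_eq of_rat_minus)
  show "minpoly A1 = [:c, e, 1:]" using assms by (intro minpoly_A1_Re)
  have "of_real q * u = of_rat (1 - c)"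
    by (simp add: assms q_eq of_rat_diff complex_of_rat_eq)
  from A3_eqI[OF this] A4_eqI_inv[OF \<open>l4 * l1 = of_rat (- c)\<close>]
  show "M = block A1 A2 ((1 - c) \<cdot> matrix_inv A2) ((- c) \<cdot> (matrix_inv A2 ** matrix_inv A1 ** A2))"
    by (simp only: M)
qed

lemma t_of_b_0:
  assumes "b = 0"
  shows "t = 2 * l1"
proof -
  have "l1 - l4 = 0" using s_square assms unfolding s_def by simp
  then show ?thesis unfolding t_def by simp
qed

text \<open>From \<open>s = 0\<close> come \<open>l4 = l1\<close>, \<open>a = 4 * p\<close> and
  \<open>u = - l1\<^sup>2 / p\<close>. The coefficient \<open>1 - 4 / c\<close> is
  \<open>- q / p\<close>.\<close>

lemma normal_form_b_0:
  assumes "b = 0" "a = of_rat c"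
  shows "M = block A1 A2 ((1 - 4 / c) \<cdot> (matrix_inv A2 ** A1 ** A1)) (matrix_inv A2 ** A1 ** A2)"
proof -
  have "l4 = l1" using s_square assms(1) by (simp add: s_def)
  have "c \<noteq> 0" using a_plus_b assms by auto
  have p: "p = of_rat c / 4" using a_plus_b assms by simp
  have "4 * l1\<^sup>2 = - of_rat c * u"
    using t_square t_of_b_0[OF assms(1)] assms(2) by (simp add: power_mult_distrib complex_of_rat_eq)
  then have l1: "l1\<^sup>2 = - of_rat c * u / 4" by (simp add: field_simps)
  have q': "of_real q = (1 - of_rat c / 4 :: complex)"
    unfolding q_eq p complex_of_rat_eq by simp
  have "of_real q * u = of_rat (1 - 4 / c) * l1\<^sup>2"
    unfolding l1 q' using \<open>c \<noteq> 0\<close> by (simp add: of_rat_diff of_rat_divide field_simps)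
  from A3_eqI'[OF this] A4_eqI[OF \<open>l4 = l1\<close>] show ?thesis by (simp only: M)
qed

text \<open>Dually, \<open>t = 0\<close> gives \<open>l4 = - l1\<close>, \<open>b = 4 * p\<close>
  and \<open>u = l1\<^sup>2 / p\<close>, so \<open>4 / c - 1\<close> is \<open>q / p\<close>. The
  real part of \<open>l1\<close> follows from that of \<open>l1\<^sup>2\<close> and from
  \<open>p\<close>.\<close>

lemma normal_form_a_0:
  assumes "a = 0" "b = of_rat c"
  shows "M = block A1 A2 ((4 / c - 1) \<cdot> (matrix_inv A2 ** A1 ** A1)) (- (matrix_inv A2 ** A1 ** A2))"
    and "(2 * Re l1)\<^sup>2 = b / 2 * (Re u + 1)" and "p = b / 4"
proof -
  have "l4 = - l1" using t_square assms(1) by (simp add: t_def add_eq_0_iff)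
  have "c \<noteq> 0" using a_plus_b assms by auto
  show p: "p = b / 4" using a_plus_b assms by simp
  have "s = 2 * l1" unfolding s_def using \<open>l4 = - l1\<close> by simp
  then have l1: "l1\<^sup>2 = of_rat c * u / 4"
    using s_square assms(2) by (simp add: power_mult_distrib complex_of_rat_eq field_simps)
  have q': "of_real q = (1 - of_rat c / 4 :: complex)"
    unfolding q_eq p assms(2) complex_of_rat_eq by simp
  have "of_real q * u = of_rat (4 / c - 1) * l1\<^sup>2"
    unfolding l1 q' using \<open>c \<noteq> 0\<close> by (simp add: of_rat_diff of_rat_divide field_simps)
  from A3_eqI'[OF this] A4_eqI_minus[OF \<open>l4 = - l1\<close>]
  show "M = block A1 A2 ((4 / c - 1) \<cdot> (matrix_inv A2 ** A1 ** A1)) (- (matrix_inv A2 ** A1 ** A2))"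
    by (simp only: M)
  have "Re (l1\<^sup>2) = b * Re u / 4" unfolding l1 assms(2) by (simp add: complex_of_rat_eq)
  then show "(2 * Re l1)\<^sup>2 = b / 2 * (Re u + 1)"
    using p p_norm by (simp add: power2_eq_square algebra_simps)
qed

lemma minpoly_M_quadratic:
  assumes "minpoly M = [:c, e, 1:]"
  shows "t = - of_rat e" "u = - of_rat c"
proof -
  have "matrix_poly [:c, e, 1, 0, 0:] M = 0" using annihilator_M[OF assms] by simp
  then show "t = - of_rat e" "u = - of_rat c"
    unfolding annihilator_iff by (simp_all add: eq_neg_iff_add_eq_0 add.commute)
qed

lemma minpoly_M_cubic:
  assumes "minpoly M = [:c0, c1, c2, 1:]"
  shows "of_rat c1 + of_rat c2 * t + (t\<^sup>2 + u) = 0" "of_rat c0 + of_rat c2 * u + t * u = 0"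
    "t = of_rat x \<Longrightarrow> u = of_rat y \<Longrightarrow> False"
proof -
  have "matrix_poly [:c0, c1, c2, 1, 0:] M = 0" using annihilator_M[OF assms] by simp
  then show "of_rat c1 + of_rat c2 * t + (t\<^sup>2 + u) = 0" "of_rat c0 + of_rat c2 * u + t * u = 0"
    unfolding annihilator_iff by simp_all
  show "t = of_rat x \<Longrightarrow> u = of_rat y \<Longrightarrow> False"
    using degree_minpoly_M[of x y] assms by simp
qed

text \<open>For \<open>t \<noteq> 0\<close> the first equation divided by \<open>t\<close> gives
  \<open>t\<^sup>2\<close>; substituted into the second, it leaves
  \<open>1 - u\<^sup>2 = 0\<close>.\<close>

lemma minpoly_M_biquadratic:
  assumes "minpoly M = [:1, 0, c, 0, 1:]"
  shows "t = 0 \<Longrightarrow> 1 + of_rat c * u + u\<^sup>2 = 0"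
    "t \<noteq> 0 \<Longrightarrow> (u = 1 \<or> u = -1) \<and> t\<^sup>2 = - of_rat c - 2 * u"
proof -
  have *: "of_rat c * t + (t ^ 3 + 2 * t * u) = 0" "1 + of_rat c * u + (t\<^sup>2 * u + u\<^sup>2) = 0"
    using annihilator_M[OF assms] unfolding annihilator_iff by simp_all
  show "t = 0 \<Longrightarrow> 1 + of_rat c * u + u\<^sup>2 = 0" using *(2) by simp
  assume "t \<noteq> 0"
  have "t * (of_rat c + t\<^sup>2 + 2 * u) = 0"
    using *(1) by (simp add: power2_eq_square power3_eq_cube algebra_simps)
  with \<open>t \<noteq> 0\<close> have "of_rat c + t\<^sup>2 + 2 * u = 0" using mult_eq_0_iff by blast
  then have "t\<^sup>2 = - of_rat c - 2 * u" by algebra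
  moreover from this *(2) have "u\<^sup>2 = 1" by algebra
  ultimately show "(u = 1 \<or> u = -1) \<and> t\<^sup>2 = - of_rat c - 2 * u" by (simp add: power2_eq_1_iff)
qed

lemma t_u_minus_1:
  assumes "u = -1"
  obtains x where "t = of_rat x"
proof -
  have "t = of_real (2 * Re l1)" using assms by (simp add: t_eq complex_eq_iff)
  moreover obtain x where "2 * Re l1 = of_rat x" using E_Re_2[OF l1_E] by blast
  ultimately show ?thesis using that by (simp only: complex_of_rat_eq)
qed

text \<open>For \<open>u = -1\<close> the trace \<open>t = 2 * Re l1\<close> would be rational, and
  the minimal polynomial would have degree at most 2.\<close>

lemma minpoly_M_biquadratic_u:
  assumes "minpoly M = [:1, 0, c, 0, 1:]" "t \<noteq> 0"
  shows "u = 1" "t\<^sup>2 = - of_rat c - 2"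
proof -
  have "u \<noteq> -1"
  proof
    assume u: "u = -1"
    then obtain x where "t = of_rat x" using t_u_minus_1 by blast
    moreover have "u = of_rat (-1)" using u by simp
    ultimately show False using degree_minpoly_M[of x "-1"] assms(1) by simp
  qed
  with minpoly_M_biquadratic(2)[OF assms] show "u = 1" "t\<^sup>2 = - of_rat c - 2" by auto
qed

section \<open>The normal forms\<close>

text \<open>With \<open>t = 0\<close> and \<open>u = -1\<close>,
  \<open>b = 4 * (Im l1)\<^sup>2\<close> is a rational square times \<open>d\<close>. Both lie in
  \<open>{1, 2, 3}\<close>, so \<open>b = d\<close> and \<open>p = d / 4\<close>.\<close>

lemma type_x2_plus_1:
  assumes "Im l1 \<noteq> 0" "\<tau>1 \<in> rat_adjoin (csqrt (- of_nat d))" "d \<in> {1, 2, 3}"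
    and "minpoly M = [:1, 0, 1:]"
  shows "M = block A1 A2 ((of_nat d / 4 - 1) \<cdot> matrix_inv A2) (- (matrix_inv A2 ** A1 ** A2))"
    "minpoly A1 = [:of_nat d / 4, 0, 1:]"
proof -
  have t: "t = 0" and u: "u = -1" using minpoly_M_quadratic[OF assms(4)] by simp_all
  have a: "a = 0" using t_square t by simp
  have b: "b \<in> {1, 2, 3}" using a_plus_b(2) a by simp
  have "d > 0" using assms(3) by auto
  obtain r where r: "r \<in> \<rat>" "(Im l1)\<^sup>2 = r\<^sup>2 * of_nat d"
    using E_Im_square[OF assms(2) \<open>d > 0\<close> l1_E] .
  have "(2 * r)\<^sup>2 * of_nat d = b"
    using a_b_of_u_minus_1(2)[OF u] r(2) by (simp add: power_mult_distrib)
  then have "b = of_nat d"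
    using rat_square_ratio[of "2 * r" d b] r(1) assms(3) b by simp
  then have "p = of_rat (of_nat d / 4)" using a_plus_b(1) a by (simp add: of_rat_divide)
  from normal_form_u_minus_1_t_0[OF assms(1) u t this]
  show "M = block A1 A2 ((of_nat d / 4 - 1) \<cdot> matrix_inv A2) (- (matrix_inv A2 ** A1 ** A2))"
    "minpoly A1 = [:of_nat d / 4, 0, 1:]" .
qed

text \<open>The trace \<open>2 * Re l1 = - e\<close> gives \<open>a = 1\<close>, and again
  \<open>b = 4 * (Im l1)\<^sup>2\<close> must be \<open>d\<close>.\<close>

lemma type_x2_plus_x_plus_1:
  assumes "Im l1 \<noteq> 0" "\<tau>1 \<in> rat_adjoin (csqrt (- of_nat d))" "d \<in> {1, 2}" "e \<in> {1, -1}"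
    and "minpoly M = [:1, e, 1:]"
  shows "M = block A1 A2 (((1 + of_nat d) / 4 - 1) \<cdot> matrix_inv A2)
      (((1 + of_nat d) / 4) \<cdot> (matrix_inv A2 ** matrix_inv A1 ** A2))"
    "minpoly A1 = [:(1 + of_nat d) / 4, e, 1:]"
proof -
  have t: "t = - of_rat e" and u: "u = -1" using minpoly_M_quadratic[OF assms(5)] by simp_all
  have "t = of_real (2 * Re l1)" using u by (simp add: t_eq complex_eq_iff)
  then have "of_real (2 * Re l1) = (of_real (- of_rat e) :: complex)"
    using t by (simp add: complex_of_rat_eq)
  then have Re: "2 * Re l1 = - of_rat e" by (simp only: of_real_eq_iff)
  then have "Re l1 = - of_rat e / 2" by simp
  then have a: "a = 1"
    using a_b_of_u_minus_1(1)[OF u] assms(4) by (auto simp: power2_eq_square)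
  have b: "b = 4 * (Im l1)\<^sup>2" by (rule a_b_of_u_minus_1(2)[OF u])
  then have "b \<noteq> 0" using assms(1) by simp
  have "d > 0" using assms(3) by auto
  obtain r where r: "r \<in> \<rat>" "(Im l1)\<^sup>2 = r\<^sup>2 * of_nat d"
    using E_Im_square[OF assms(2) \<open>d > 0\<close> l1_E] .
  have "(2 * r)\<^sup>2 * of_nat d = b" using b r(2) by (simp add: power_mult_distrib)
  moreover have "b \<in> {1, 2, 3}" using \<open>b \<noteq> 0\<close> a a_plus_b(2) by auto
  ultimately have "b = of_nat d"
    using rat_square_ratio[of "2 * r" d b] r(1) assms(3) by auto
  then have "p = of_rat ((1 + of_nat d) / 4)"
    using a_plus_b(1) a by (simp add: of_rat_divide of_rat_add)
  from normal_form_u_minus_1[OF assms(1) u Re this]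
  show "M = block A1 A2 (((1 + of_nat d) / 4 - 1) \<cdot> matrix_inv A2)
      (((1 + of_nat d) / 4) \<cdot> (matrix_inv A2 ** matrix_inv A1 ** A2))"
    "minpoly A1 = [:(1 + of_nat d) / 4, e, 1:]" .
qed

text \<open>Otherwise \<open>(Im w)\<^sup>2 = b / 4\<close> with \<open>b\<close> equal to 1 or 2,
  and three times a rational ratio of imaginary parts would have square \<open>3 * b\<close>, that
  is 3 or 6.\<close>

lemma a_1_t_nonreal:
  assumes "(Im t)\<^sup>2 = 3 / 4" "a = 1"
  shows "b = 0"
proof (rule ccontr)
  assume "b \<noteq> 0"
  then have b: "b = 1 \<or> b = 2" using assms(2) by (cases rule: a_b_cases) auto
  have "Im t \<noteq> 0" using assms(1) by auto
  then have r: "Im w / Im t \<in> \<rat>" by (rule E_Im_ratio[OF w_E t_E])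
  have "(3 * (Im w / Im t))\<^sup>2 = 9 * ((Im w)\<^sup>2 / (Im t)\<^sup>2)" by (simp add: power_divide power_mult_distrib)
  also have "\<dots> = 3 * b" unfolding assms(1) using a_mult_b assms(2) by simp
  finally have "(3 * (Im w / Im t))\<^sup>2 = 3 * b" .
  moreover have "3 * (Im w / Im t) \<in> \<rat>" using r by (intro Rats_mult) auto
  note rat_square_ne[OF this]
  ultimately show False using b by auto
qed

text \<open>\<open>t\<close> is a sum of two of the three roots of the cubic. The conjugate pair has
  the rational sum \<open>e\<close> and is excluded by the degree, so \<open>t\<close> is a
  primitive cube or sixth root of unity.\<close>

lemma type_x3_plus_1:
  assumes "Im l1 \<noteq> 0" "e \<in> {1, -1}" "minpoly M = [:e, 0, 0, 1:]"
  shows "M = block A1 A2 ((-3) \<cdot> (matrix_inv A2 ** A1 ** A1)) (matrix_inv A2 ** A1 ** A2)"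
    "minpoly A1 = [:1/4, e * (1/2), 1:]"
proof -
  define \<epsilon> :: complex where "\<epsilon> = of_rat e"
  have \<epsilon>: "\<epsilon> = 1 \<or> \<epsilon> = -1" using assms(2) by (auto simp: \<epsilon>_def)
  have 1: "t\<^sup>2 + u = 0" "\<epsilon> + t * u = 0" using minpoly_M_cubic[OF assms(3)] by (simp_all add: \<epsilon>_def)
  then have u: "u = - t\<^sup>2" by (simp add: eq_neg_iff_add_eq_0 add.commute)
  with t_square have "of_real (a - 1) * u = 0" by (simp add: algebra_simps)
  then have a: "a = 1" by simp
  have "\<epsilon> - t ^ 3 = 0" using 1(2) by (simp add: u power2_eq_square power3_eq_cube mult.assoc)
  then have "(t - \<epsilon>) * (t\<^sup>2 + \<epsilon> * t + 1) = 0"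
    using \<epsilon> by (auto simp: power2_eq_square power3_eq_cube algebra_simps)
  moreover have "t \<noteq> \<epsilon>"
    using minpoly_M_cubic(3)[OF assms(3), of e "-1"] \<epsilon> u by (auto simp: \<epsilon>_def)
  ultimately have t: "t\<^sup>2 + \<epsilon> * t + 1 = 0" by simp
  have "(Im t)\<^sup>2 = 3 / 4"
  proof -
    have "(2 * t + \<epsilon>)\<^sup>2 = 4 * (t\<^sup>2 + \<epsilon> * t + 1) - 3"
      using \<epsilon> by (auto simp: power2_eq_square algebra_simps)
    then have *: "(2 * t + \<epsilon>)\<^sup>2 = - 3" by (simp add: t)
    have im: "Im (2 * t + \<epsilon>) = 2 * Im t" using \<epsilon> by auto
    have "Re ((2 * t + \<epsilon>)\<^sup>2) = -3" "Im ((2 * t + \<epsilon>)\<^sup>2) = 0" by (simp_all add: *)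
    then have "(Re (2 * t + \<epsilon>))\<^sup>2 - (2 * Im t)\<^sup>2 = - 3" "Re (2 * t + \<epsilon>) * (2 * Im t) = 0"
      unfolding im[symmetric] by (simp_all add: Re_power2 Im_power2 del: plus_complex.simps)
    then show ?thesis
      using zero_le_power2[of "Re (2 * t + \<epsilon>)"]
      by (cases "Im t = 0") (auto simp: power_mult_distrib)
  qed
  then have b: "b = 0" using a by (rule a_1_t_nonreal)
  have "a = of_rat 1" by (simp add: a)
  from normal_form_b_0[OF b this]
  show "M = block A1 A2 ((-3) \<cdot> (matrix_inv A2 ** A1 ** A1)) (matrix_inv A2 ** A1 ** A2)" by simp
  show "minpoly A1 = [:1/4, e * (1/2), 1:]"
  proof (rule minpoly_A1[OF assms(1)])
    have "4 * (l1\<^sup>2 + of_rat (e * (1/2)) * l1 + of_rat (1/4)) = t\<^sup>2 + \<epsilon> * t + 1"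
      unfolding t_of_b_0[OF b] \<epsilon>_def
      by (simp add: power_mult_distrib of_rat_mult of_rat_divide algebra_simps)
    then show "l1\<^sup>2 + of_rat (e * (1/2)) * l1 + of_rat (1/4) = 0"
      using t by (metis mult_eq_0_iff zero_neq_numeral)
  qed
qed

text \<open>The cubic is \<open>(x + e) * (x\<^sup>2 + e * x + 1)\<close>. The conjugate pair, with
  \<open>t = - e\<close> and \<open>u = -1\<close>, is excluded by the degree; the other pairs have
  the sums that solve \<open>t\<^sup>2 + 3 * e * t + 3 = 0\<close>.\<close>

lemma type_x3_plus_2x2:
  assumes "Im l1 \<noteq> 0" "e \<in> {1, -1}" "minpoly M = [:e, 2, e * 2, 1:]"
  shows "M = block A1 A2 ((-1/3) \<cdot> (matrix_inv A2 ** A1 ** A1)) (matrix_inv A2 ** A1 ** A2)"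
    "minpoly A1 = [:3/4, e * (3/2), 1:]"
proof -
  define \<epsilon> :: complex where "\<epsilon> = of_rat e"
  have \<epsilon>: "\<epsilon> = 1 \<or> \<epsilon> = -1" using assms(2) by (auto simp: \<epsilon>_def)
  have 1: "2 + \<epsilon> * 2 * t + (t\<^sup>2 + u) = 0" "\<epsilon> + \<epsilon> * 2 * u + t * u = 0"
    using minpoly_M_cubic[OF assms(3)] by (simp_all add: \<epsilon>_def of_rat_mult)
  from 1(1) have u: "u = - 2 - \<epsilon> * 2 * t - t\<^sup>2" by (simp add: algebra_simps eq_neg_iff_add_eq_0)
  have "(t + \<epsilon>) * (t\<^sup>2 + 3 * \<epsilon> * t + 3) = - (\<epsilon> + \<epsilon> * 2 * u + t * u)"
    unfolding u using \<epsilon> by (auto simp: power2_eq_square algebra_simps)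
  then have "(t + \<epsilon>) * (t\<^sup>2 + 3 * \<epsilon> * t + 3) = 0" by (simp add: 1)
  moreover have "t + \<epsilon> \<noteq> 0"
  proof
    assume "t + \<epsilon> = 0"
    then have t: "t = - \<epsilon>" by (simp add: eq_neg_iff_add_eq_0)
    then have "u = of_rat (-1)" using \<epsilon> u by auto
    moreover have "t = of_rat (- e)" using t by (simp add: \<epsilon>_def of_rat_minus)
    ultimately show False using minpoly_M_cubic(3)[OF assms(3)] by blast
  qed
  ultimately have t: "t\<^sup>2 + 3 * \<epsilon> * t + 3 = 0" by simp
  \<comment> \<open>This combination cancels the linear term, so that \<open>t_square\<close> yields
    \<open>a = 3\<close>.\<close>
  have "t\<^sup>2 + 3 * u = -2 * (t\<^sup>2 + 3 * \<epsilon> * t + 3)" by (simp add: u algebra_simps)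
  then have "t\<^sup>2 + 3 * u = 0" unfolding t by simp
  then have "of_real (a - 3) * u = 0" unfolding t_square by (simp add: algebra_simps)
  then have "a - 3 = 0" by (simp only: mult_eq_0_iff u_nz of_real_eq_0_iff simp_thms)
  then have a: "a = 3" by simp
  then have b: "b = 0" by (cases rule: a_b_cases) auto
  have "a = of_rat 3" by (simp add: a)
  from normal_form_b_0[OF b this]
  show "M = block A1 A2 ((-1/3) \<cdot> (matrix_inv A2 ** A1 ** A1)) (matrix_inv A2 ** A1 ** A2)" by simp
  show "minpoly A1 = [:3/4, e * (3/2), 1:]"
  proof (rule minpoly_A1[OF assms(1)])
    have "4 * (l1\<^sup>2 + of_rat (e * (3/2)) * l1 + of_rat (3/4)) = t\<^sup>2 + 3 * \<epsilon> * t + 3"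
      unfolding t_of_b_0[OF b] \<epsilon>_def
      by (simp add: power_mult_distrib of_rat_mult of_rat_divide algebra_simps)
    then show "l1\<^sup>2 + of_rat (e * (3/2)) * l1 + of_rat (3/4) = 0"
      using t by (metis mult_eq_0_iff zero_neq_numeral)
  qed
qed

text \<open>The cubic is \<open>(x + e) * (x\<^sup>2 + 1)\<close>. The conjugate pair, with
  \<open>t = 0\<close> and \<open>u = -1\<close>, is excluded by the degree. The other pairs give
  \<open>u\<^sup>2 = -1\<close> and \<open>a = 2\<close>; then \<open>b = 1\<close> would make the
  ratio of \<open>Im w\<close> to \<open>Im u\<close> have square 1/2.\<close>

lemma type_x3_plus_x2:
  assumes "Im l1 \<noteq> 0" "e \<in> {1, -1}" "minpoly M = [:e, 1, e, 1:]"
  shows "M = block A1 A2 (- (matrix_inv A2 ** A1 ** A1)) (matrix_inv A2 ** A1 ** A2)"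
    "minpoly A1 = [:1/2, e, 1:]"
proof -
  define \<epsilon> :: complex where "\<epsilon> = of_rat e"
  have \<epsilon>: "\<epsilon> = 1 \<or> \<epsilon> = -1" using assms(2) by (auto simp: \<epsilon>_def)
  have 1: "1 + \<epsilon> * t + (t\<^sup>2 + u) = 0" "\<epsilon> + \<epsilon> * u + t * u = 0"
    using minpoly_M_cubic[OF assms(3)] by (simp_all add: \<epsilon>_def)
  from 1(1) have u: "u = - 1 - \<epsilon> * t - t\<^sup>2" by (simp add: algebra_simps eq_neg_iff_add_eq_0)
  have "t * (t\<^sup>2 + 2 * \<epsilon> * t + 2) = - (\<epsilon> + \<epsilon> * u + t * u)"
    unfolding u using \<epsilon> by (auto simp: power2_eq_square algebra_simps)
  then have "t * (t\<^sup>2 + 2 * \<epsilon> * t + 2) = 0" by (simp add: 1)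
  moreover have "t \<noteq> 0" using minpoly_M_cubic(3)[OF assms(3), of 0 "-1"] u by auto
  ultimately have t: "t\<^sup>2 + 2 * \<epsilon> * t + 2 = 0" by simp
  have "t\<^sup>2 + 2 * u = - (t\<^sup>2 + 2 * \<epsilon> * t + 2)" by (simp add: u algebra_simps)
  then have "t\<^sup>2 + 2 * u = 0" unfolding t by simp
  then have "of_real (a - 2) * u = 0" unfolding t_square by (simp add: algebra_simps)
  then have "a - 2 = 0" by (simp only: mult_eq_0_iff u_nz of_real_eq_0_iff simp_thms)
  then have a: "a = 2" by simp
  have "u\<^sup>2 + 1 = (t\<^sup>2 + 2 * \<epsilon> * t + 2) * (t\<^sup>2 + 1)"
    unfolding u using \<epsilon> by (auto simp: power2_eq_square algebra_simps)
  then have u2: "u\<^sup>2 = -1" by (simp add: t eq_neg_iff_add_eq_0)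
  have b: "b = 0"
  proof (rule ccontr)
    assume "b \<noteq> 0"
    then have "b = 1" using a by (cases rule: a_b_cases) auto
    then have w: "(Im w)\<^sup>2 = 1/2" using a_mult_b a by simp
    have "Re (u\<^sup>2) = -1" "Im (u\<^sup>2) = 0" unfolding u2 by simp_all
    then have "(Re u)\<^sup>2 - (Im u)\<^sup>2 = -1" by (simp add: Re_power2)
    with u_norm have "(Im u)\<^sup>2 = 1" by simp
    then have "(2 * (Im w / Im u))\<^sup>2 = 2" using w by (simp add: power_divide power_mult_distrib)
    moreover have "2 * (Im w / Im u) \<in> \<rat>"
      using \<open>(Im u)\<^sup>2 = 1\<close> by (intro Rats_mult E_Im_ratio w_E u_E) auto
    ultimately show False using rat_square_ne(1) by blast
  qed
  have "a = of_rat 2" by (simp add: a)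
  from normal_form_b_0[OF b this]
  have "M = block A1 A2 ((-1) \<cdot> (matrix_inv A2 ** A1 ** A1)) (matrix_inv A2 ** A1 ** A2)" by simp
  moreover have "(-1) \<cdot> B = - B" for B :: "rat^2^2" by (simp add: vec_eq_iff)
  ultimately
  show "M = block A1 A2 (- (matrix_inv A2 ** A1 ** A1)) (matrix_inv A2 ** A1 ** A2)" by simp
  show "minpoly A1 = [:1/2, e, 1:]"
  proof (rule minpoly_A1[OF assms(1)])
    have "4 * (l1\<^sup>2 + of_rat e * l1 + of_rat (1/2)) = t\<^sup>2 + 2 * \<epsilon> * t + 2"
      unfolding t_of_b_0[OF b] \<epsilon>_def
      by (simp add: power_mult_distrib of_rat_mult of_rat_divide algebra_simps)
    then show "l1\<^sup>2 + of_rat e * l1 + of_rat (1/2) = 0"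
      using t by (metis mult_eq_0_iff zero_neq_numeral)
  qed
qed

lemma type_I_square_u:
  assumes "minpoly M = [:1, 0, c, 0, 1:]" "type_I (M ** M)"
  shows "t = 0" "1 + of_rat c * u + u\<^sup>2 = 0"
  using type_I_squareD[OF assms(2)] minpoly_M_biquadratic(1)[OF assms(1)] by blast+

lemma Re_u_of_quadratic:
  assumes "1 + of_rat c * u + u\<^sup>2 = 0"
  shows "2 * Re u = - of_rat c"
proof -
  have "(u + cnj u + of_rat c) * u = (cnj u * u - 1) + (1 + of_rat c * u + u\<^sup>2)"
    by (simp add: power2_eq_square algebra_simps)
  also have "\<dots> = 0" unfolding assms u_cnj by simp
  finally have "of_real (2 * Re u + of_rat c) = (of_real 0 :: complex)"
    unfolding complex_add_cnj by (simp add: complex_of_rat_eq)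
  then have "2 * Re u + of_rat c = 0" by (simp only: of_real_eq_iff)
  then show ?thesis by simp
qed

lemma minpoly_A1_abs_Re:
  assumes "Im l1 \<noteq> 0" "(2 * Re l1)\<^sup>2 = (of_rat c1)\<^sup>2" "p = of_rat c0"
  shows "\<exists>e\<in>{1, -1}. minpoly A1 = [:c0, e * c1, 1:]"
proof -
  from assms(2) have "2 * Re l1 = of_rat c1 \<or> 2 * Re l1 = - of_rat c1"
    unfolding power2_eq_iff .
  then have "2 * Re l1 = - of_rat (1 * c1) \<or> 2 * Re l1 = - of_rat (-1 * c1)"
    by (auto simp: of_rat_minus)
  then show ?thesis using minpoly_A1_Re[OF assms(1) _ assms(3)] by blast
qed

text \<open>Here \<open>t = 0\<close> and \<open>Re u + 1 = k / 2\<close>, so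
  \<open>(4 * Re l1)\<^sup>2 = b * k\<close> is a rational square. Both factors lie in
  \<open>{1, 2, 3}\<close>, hence \<open>b = k\<close>; \<open>c = 1, 0, -1\<close> give
  \<open>k = 1, 2, 3\<close>.\<close>

lemma type_I_square_normal_form:
  assumes "Im l1 \<noteq> 0" "minpoly M = [:1, 0, c, 0, 1:]" "type_I (M ** M)" "c \<in> {-1, 0, 1}"
  defines "k \<equiv> 2 - c"
  shows "M = block A1 A2 ((4 / k - 1) \<cdot> (matrix_inv A2 ** A1 ** A1)) (- (matrix_inv A2 ** A1 ** A2))"
    "\<exists>e\<in>{1, -1}. minpoly A1 = [:k / 4, e * (k / 2), 1:]"
proof -
  note tu = type_I_square_u[OF assms(2,3)]
  have a: "a = 0" using t_square tu(1) by simp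
  have "Re u = - of_rat c / 2" using Re_u_of_quadratic[OF tu(2)] by simp
  then have "Re u + 1 = of_rat k / 2" by (simp add: k_def of_rat_diff field_simps)
  obtain b' where b': "b = of_rat b'" "b' \<in> {1, 2, 3}"
  proof (cases rule: a_b_cases)
    assume "b = 1" then show ?thesis using that[of 1] by simp
  next
    assume "b = 2" then show ?thesis using that[of 2] by simp
  next
    assume "b = 3" then show ?thesis using that[of 3] by simp
  qed (use a in simp_all)
  note nf = normal_form_a_0[OF a b'(1)]
  have sq: "(4 * Re l1)\<^sup>2 = of_rat (b' * k)"
    using nf(2) unfolding \<open>Re u + 1 = _\<close> b'(1) by (simp add: power_mult_distrib of_rat_mult)
  have Re: "4 * Re l1 \<in> \<rat>" using E_Re[OF l1_E] by simp
  have "k \<in> {1, 2, 3}" using assms(4) by (auto simp: k_def)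
  have "b' = k"
  proof (rule ccontr)
    assume "b' \<noteq> k"
    then have "b' * k \<in> {2, 3, 6}" using b'(2) \<open>k \<in> {1, 2, 3}\<close> by auto
    then show False using rat_square_ne[OF Re] unfolding sq by auto
  qed
  then show "M = block A1 A2 ((4 / k - 1) \<cdot> (matrix_inv A2 ** A1 ** A1)) (- (matrix_inv A2 ** A1 ** A2))"
    using nf(1) by simp
  have "(2 * Re l1)\<^sup>2 = (of_rat (k / 2))\<^sup>2"
    using sq \<open>b' = k\<close> by (simp add: power_mult_distrib of_rat_mult of_rat_divide power2_eq_square)
  moreover have "p = of_rat (k / 4)" using nf(3) b' \<open>b' = k\<close> by (simp add: of_rat_divide)
  ultimately show "\<exists>e\<in>{1, -1}. minpoly A1 = [:k / 4, e * (k / 2), 1:]"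
    by (intro minpoly_A1_abs_Re assms(1))
qed

lemma a_of_biquadratic:
  assumes "minpoly M = [:1, 0, c, 0, 1:]" "t \<noteq> 0"
  shows "u = 1" "a = 2 + of_rat c" "a = 4 * (Im l1)\<^sup>2" "b = 4 * (Re l1)\<^sup>2"
proof -
  note tu = minpoly_M_biquadratic_u[OF assms]
  show "u = 1" by fact
  from a_b_of_u_1[OF this] show "a = 4 * (Im l1)\<^sup>2" "b = 4 * (Re l1)\<^sup>2" by blast+
  have "of_real (2 + of_rat c) = - t\<^sup>2" unfolding tu(2) by (simp add: complex_of_rat_eq)
  also have "\<dots> = of_real a" unfolding t_square tu(1) by simp
  finally show "a = 2 + of_rat c" by (simp only: of_real_eq_iff)
qed

lemma normal_form_biquadratic_b_0:
  assumes "Im l1 \<noteq> 0" "minpoly M = [:1, 0, c, 0, 1:]" "t \<noteq> 0" "b = 0"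
  shows "M = block A1 A2 ((1 - (2 + c) / 4) \<cdot> matrix_inv A2) (matrix_inv A2 ** A1 ** A2)"
    "minpoly A1 = [:(2 + c) / 4, 0, 1:]"
proof -
  note * = a_of_biquadratic[OF assms(2,3)]
  have "Re l1 = 0" using *(4) assms(4) by simp
  moreover have "p = of_rat ((2 + c) / 4)"
    using a_plus_b(1) *(2) assms(4) by (simp add: of_rat_divide of_rat_add)
  ultimately show "M = block A1 A2 ((1 - (2 + c) / 4) \<cdot> matrix_inv A2) (matrix_inv A2 ** A1 ** A2)"
    "minpoly A1 = [:(2 + c) / 4, 0, 1:]"
    using normal_form_u_1_Re_0[OF assms(1) *(1)] by blast+
qed

lemma normal_form_biquadratic_b_1:
  assumes "Im l1 \<noteq> 0" "minpoly M = [:1, 0, c, 0, 1:]" "t \<noteq> 0" "b = 1"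
  shows "M = block A1 A2 ((1 - (3 + c) / 4) \<cdot> matrix_inv A2)
      ((- ((3 + c) / 4)) \<cdot> (matrix_inv A2 ** matrix_inv A1 ** A2)) \<and>
    (\<exists>e\<in>{1, -1}. minpoly A1 = [:(3 + c) / 4, e, 1:])"
proof -
  note * = a_of_biquadratic[OF assms(2,3)]
  have p: "p = of_rat ((3 + c) / 4)"
    using a_plus_b(1) *(2) assms(4) by (simp add: of_rat_divide of_rat_add)
  have "(2 * Re l1)\<^sup>2 = 1" using *(4) assms(4) by (simp add: power_mult_distrib)
  then have "2 * Re l1 = 1 \<or> 2 * Re l1 = -1" unfolding power2_eq_1_iff .
  then have "2 * Re l1 = - of_rat 1 \<or> 2 * Re l1 = - of_rat (-1)" by auto
  then obtain e where "e \<in> {1, -1}" "2 * Re l1 = - of_rat e" by blast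
  with normal_form_u_1[OF assms(1) *(1) _ p] show ?thesis by blast
qed

lemma type_x4_plus_x2_plus_1:
  assumes "minpoly M = [:1, 0, 1, 0, 1:]" "t \<noteq> 0"
  shows "b = 0"
proof -
  have "a = 3" using a_of_biquadratic(2)[OF assms] by simp
  then show "b = 0" by (cases rule: a_b_cases) auto
qed

text \<open>The upper left block of \<open>M ** M\<close> vanishes and \<open>u = 1\<close>, so
  \<open>l1\<^sup>2 = - q\<close> is real and the nonreal \<open>l1\<close> is imaginary.\<close>

lemma type_x4_plus_1_II:
  assumes "Im l1 \<noteq> 0" "minpoly M = [:1, 0, 0, 0, 1:]" "type_II (M ** M)"
  shows "t \<noteq> 0" "b = 0"
proof -
  from type_II_squareD[OF assms(3)] have t: "t \<noteq> 0" and l1: "l1\<^sup>2 + of_real q * u = 0" by blast+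
  show "t \<noteq> 0" by fact
  note * = a_of_biquadratic[OF assms(2) t]
  have "Im (l1\<^sup>2 + of_real q * u) = 2 * Re l1 * Im l1" by (simp add: *(1) Im_power2)
  then have "Re l1 = 0" using assms(1) unfolding l1 by simp
  then show "b = 0" using *(4) by simp
qed

text \<open>With \<open>a = 2\<close>, the value \<open>b = 0\<close> would mean
  \<open>p = q = 1/2\<close> and \<open>l1\<^sup>2 + q * u = 0\<close>, so the upper left block of
  \<open>M ** M\<close> would vanish.\<close>

lemma type_x4_plus_1_III:
  assumes "minpoly M = [:1, 0, 0, 0, 1:]" "type_III (M ** M)"
  shows "t \<noteq> 0" "b = 1"
proof -
  from type_III_squareD[OF assms(2)] have t: "t \<noteq> 0" and l1: "l1\<^sup>2 + of_real q * u \<noteq> 0" by blast+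
  show "t \<noteq> 0" by fact
  note * = a_of_biquadratic[OF assms(1) t]
  have a: "a = 2" using *(2) by simp
  have "b \<noteq> 0"
  proof
    assume b: "b = 0"
    then have Re: "Re l1 = 0" using *(4) by simp
    have "p = 1/2" using a_plus_b(1) a b by simp
    then have "q = 1/2" "(Im l1)\<^sup>2 = 1/2" using q_eq p_norm Re by simp_all
    then have "l1\<^sup>2 + of_real q * u = 0"
      using Re *(1) by (simp add: complex_eq_iff Re_power2 Im_power2)
    with l1 show False by simp
  qed
  with a show "b = 1" by (cases rule: a_b_cases) auto
qed

text \<open>The trace \<open>t * s\<close> must vanish for \<open>x\<^sup>2 - 1\<close>, while
  \<open>s = 0\<close> contradicts \<open>x\<^sup>4 - x\<^sup>2 + 1\<close> at \<open>u = 1\<close>.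
  As \<open>a = 1\<close>, this leaves \<open>b\<close> equal to 1 or 2, and 2 would make
  \<open>2 * Re l1\<close> a square root of 2.\<close>

lemma type_x4_minus_x2_plus_1:
  assumes "minpoly M = [:1, 0, -1, 0, 1:]" "t \<noteq> 0"
  shows "minpoly (iota ** (M ** M)) = [:-1, 0, 1:] \<Longrightarrow> b = 0"
    "minpoly (iota ** (M ** M)) = [:1, 0, -1, 0, 1:] \<Longrightarrow> b = 1"
proof -
  note * = a_of_biquadratic[OF assms]
  have a: "a = 1" using *(2) by simp
  {
    assume "minpoly (iota ** (M ** M)) = [:-1, 0, 1:]"
    then have "matrix_poly [:-1, 0, 1, 0, 0:] (iota ** (M ** M)) = 0"
      using annihilator_iota_square by simp
    then have "t * s = 0" unfolding annihilator_iota_square_iff[OF assms(2)] by simp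
    then have "s = 0" using assms(2) by simp
    then show "b = 0" using s_square by simp
  }
  {
    assume "minpoly (iota ** (M ** M)) = [:1, 0, -1, 0, 1:]"
    then have "matrix_poly [:1, 0, -1, 0, 1:] (iota ** (M ** M)) = 0"
      using annihilator_iota_square by simp
    then have "s \<noteq> 0"
      unfolding annihilator_iota_square_iff[OF assms(2)] by (auto simp: *(1) of_rat_minus)
    then have "b \<noteq> 0" using s_square by auto
    moreover have "b \<noteq> 2"
    proof
      assume "b = 2"
      then have "(2 * Re l1)\<^sup>2 = 2" using *(4) by (simp add: power_mult_distrib)
      moreover have "2 * Re l1 \<in> \<rat>" using E_Re[OF l1_E] by simp
      ultimately show False using rat_square_ne(1) by blast
    qed
    ultimately show "b = 1" using a by (cases rule: a_b_cases) auto
  }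
qed

lemma minpoly_M_eqI:
  assumes "t = - of_rat e" "u = - of_rat c"
  shows "minpoly M = [:c, e, 1:]"
proof (rule minpoly_quadratic)
  have "A2 \<noteq> 0" using dets(2) by (auto simp: det_2)
  then show "\<nexists>c. M = mat c"
    unfolding M by (auto simp: vec_eq_iff forall_4 forall_2 mat_def)
  have "matrix_poly [:c, e, 1, 0, 0:] M = 0" unfolding annihilator_iff by (simp add: assms)
  then show "M ** M + e \<cdot> M + c \<cdot> mat 1 = 0"
    unfolding matrix_poly_pCons_4 by (simp add: add_ac)
qed

text \<open>Now \<open>(2 * Re l1)\<^sup>2 = a + b\<close> is a rational square in
  \<open>{1, 2, 3}\<close>, hence 1, and \<open>l1\<close> is 1/2 up to sign. One of
  \<open>a\<close>, \<open>b\<close> vanishes, so \<open>w\<close> and with it \<open>u\<close> is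
  real. The value \<open>u = 1\<close> gives trace 0, and \<open>u = -1\<close> gives trace
  \<open>2 * l1\<close>.\<close>

lemma scalar_normal_form:
  assumes "Im l1 = 0"
  shows "(minpoly M = [:-1, 0, 1:] \<and>
          (\<exists>s\<in>{1, -1}. \<exists>B. invertible B \<and> det B = 3/4 \<and>
             M = block (mat (s * (1/2))) B ((3/4) \<cdot> matrix_inv B) (mat (- s * (1/2))))) \<or>
       (minpoly M = [:1, 1, 1:] \<and>
          (\<exists>B. invertible B \<and> det B = 3/4 \<and>
             M = block (mat (-1/2)) B ((-3/4) \<cdot> matrix_inv B) (mat (-1/2)))) \<or>
       (minpoly M = [:1, -1, 1:] \<and>
          (\<exists>B. invertible B \<and> det B = 3/4 \<and>
             M = block (mat (1/2)) (- B) ((3/4) \<cdot> matrix_inv B) (mat (1/2))))"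
proof -
  have sq: "(2 * Re l1)\<^sup>2 = a + b" using a_plus_b(1) p_norm assms by (simp add: power_mult_distrib)
  have "2 * Re l1 \<in> \<rat>" using E_Re[OF l1_E] by simp
  from rat_square_ne[OF this] have ab: "a + b = 1" using a_plus_b(2) unfolding sq by auto
  then have "a * b = 0" using a_b by auto
  then have "Im w = 0" using a_mult_b by simp
  moreover have "Im w = Im u * (Re l1)\<^sup>2" using assms by (simp add: w_def power2_eq_square)
  ultimately have "Im u = 0" using ab sq by auto
  with u_norm have "Re u = 1 \<or> Re u = -1" by (simp add: power2_eq_1_iff)
  with \<open>Im u = 0\<close> have u: "u = 1 \<or> u = -1" by (simp add: complex_eq_iff)
  have "2 * Re l1 = 1 \<or> 2 * Re l1 = -1" using sq unfolding ab power2_eq_1_iff .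
  then obtain e :: rat where e: "e = 1 \<or> e = -1" "2 * Re l1 = of_rat e"
    by (metis of_rat_1 of_rat_minus)
  have l1: "l1 = of_rat (e * (1/2))"
    using e(2) assms by (simp add: complex_eq_iff complex_of_rat_eq of_rat_mult of_rat_divide)
  have A1: "A1 = mat (e * (1/2))" using acts(1) acts_mat acts_inj Im_nz unfolding l1 by metis
  have p: "p = 1/4" using a_plus_b(1) ab by simp
  then have q: "q = 3/4" using q_eq by simp
  then have "of_rat (det A2) = (of_rat (3/4) :: real)" by (simp add: q_def of_rat_divide)
  then have det: "det A2 = 3/4" by (simp only: of_rat_eq_iff)
  then have inv: "invertible A2" by (simp add: invertible_det_nz)
  show ?thesis
  proof (cases "u = 1")
    case True
    have "l4 = - l1" using l4_eq assms True by (simp add: complex_eq_iff)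
    then have "l4 = of_rat (- e * (1/2))" unfolding l1 by (simp add: of_rat_minus)
    then have A4: "A4 = mat (- e * (1/2))" using acts(4) acts_mat acts_inj Im_nz by metis
    have "of_real q * u = of_rat (3/4)" by (simp add: True q complex_of_rat_eq of_rat_divide)
    then have A3: "A3 = (3/4) \<cdot> matrix_inv A2" by (rule A3_eqI)
    have "t = 0" unfolding t_def using \<open>l4 = - l1\<close> by simp
    then have "minpoly M = [:-1, 0, 1:]" using True by (intro minpoly_M_eqI) (simp_all add: of_rat_minus)
    moreover have "M = block (mat (e * (1/2))) A2 ((3/4) \<cdot> matrix_inv A2) (mat (- e * (1/2)))"
      unfolding M A1 A3 A4 ..
    ultimately show ?thesis using e(1) det inv by blast
  next
    case False
    with u have um: "u = -1" by simp
    have "l4 = l1" using l4_eq assms um by (simp add: complex_eq_iff)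
    then have A4: "A4 = mat (e * (1/2))" using acts(4) acts_mat acts_inj Im_nz unfolding l1 by metis
    have "of_real q * u = of_rat (-3/4)" by (simp add: um q complex_of_rat_eq of_rat_divide of_rat_minus)
    then have A3: "A3 = (-3/4) \<cdot> matrix_inv A2" by (rule A3_eqI)
    have "t = 2 * l1" unfolding t_def using \<open>l4 = l1\<close> by simp
    then have "t = - of_rat (- e)" unfolding l1 by (simp add: of_rat_mult of_rat_divide of_rat_minus)
    then have mp: "minpoly M = [:1, - e, 1:]" using um by (intro minpoly_M_eqI) simp_all
    have M': "M = block (mat (e * (1/2))) A2 ((-3/4) \<cdot> matrix_inv A2) (mat (e * (1/2)))"
      unfolding M A1 A3 A4 ..
    from e(1) show ?thesis
    proof
      assume e: "e = -1"
      have "minpoly M = [:1, 1, 1:]" using mp e by simp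
      moreover have "M = block (mat (-1/2)) A2 ((-3/4) \<cdot> matrix_inv A2) (mat (-1/2))"
        using M' e by simp
      ultimately show ?thesis using det inv by blast
    next
      assume e: "e = 1"
      \<comment> \<open>The third form is written with \<open>- B\<close>, so the witness is
        \<open>- A2\<close>; its inverse is again recognised by the multiplier.\<close>
      have det': "det (- A2) = det A2" by (simp add: det_2)
      have "acts \<tau>2 \<tau>1 (- A2) (- l2)" by (intro acts_minus acts)
      then have "acts \<tau>1 \<tau>2 (matrix_inv (- A2)) (inverse (- l2))"
        by (rule acts_matrix_inv) (simp_all add: det' det)
      moreover have "acts \<tau>1 \<tau>2 (- matrix_inv A2) (- inverse l2)" by (intro acts_minus acts_inv)
      ultimately have "matrix_inv (- A2) = - matrix_inv A2" using acts_inj Im_nz by (metis inverse_minus_eq)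
      then have "(3/4) \<cdot> matrix_inv (- A2) = (-3/4) \<cdot> matrix_inv A2" by (simp add: vec_eq_iff)
      then have "M = block (mat (1/2)) (- (- A2)) ((3/4) \<cdot> matrix_inv (- A2)) (mat (1/2))"
        using M' e by simp
      moreover have "minpoly M = [:1, -1, 1:]" using mp e by simp
      moreover have "det (- A2) = 3/4" "invertible (- A2)"
        using det' det by (simp_all add: invertible_det_nz)
      ultimately show ?thesis by blast
    qed
  qed
qed

end

section \<open>Type III automorphisms as instances of the locale, and the theorem\<close>

lemma finite_type_III_Aut:
  assumes "Ghol X \<tau>1 \<tau>2" "M \<in> Aut X" "type_III M" "M = block A1 A2 A3 A4"
  obtains l1 l2 l3 l4 where "finite_type_III \<tau>1 \<tau>2 M A1 A2 A3 A4 l1 l2 l3 l4"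
proof -
  obtain l1 l2 l3 l4 where l: "acts \<tau>1 \<tau>1 A1 l1" "acts \<tau>2 \<tau>1 A2 l2" "acts \<tau>1 \<tau>2 A3 l3"
    "acts \<tau>2 \<tau>2 A4 l4"
    using Aut_block_acts assms(1,2) unfolding assms(4) by blast
  note iota = iota_Aut[OF assms(1)]
  have "finite_type_III \<tau>1 \<tau>2 M A1 A2 A3 A4 l1 l2 l3 l4"
  proof
    show "Im \<tau>1 > 0" "Im \<tau>2 > 0" using assms(1) by (simp_all add: Ghol_def)
    show "\<exists>n>0. ((**) M ^^ n) (mat 1) = mat 1" "\<exists>n>0. ((**) (iota ** M) ^^ n) (mat 1) = mat 1"
      "\<exists>n>0. ((**) (iota ** (M ** M)) ^^ n) (mat 1) = mat 1"
      using Aut_finite_order[OF assms(1)] Aut_mult assms(2) iota by metis+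
  qed (fact l assms)+
  then show ?thesis by (rule that)
qed

theorem theorem9p5:
  fixes X :: "(complex^4) set" and \<tau>1 \<tau>2 :: complex and K :: "complex set"
    and M :: "rat^4^4" and A1 A2 A3 A4 :: "rat^2^2"
  assumes "Ghol X \<tau>1 \<tau>2"
    and "quadratic_field K" and "\<tau>1 \<in> K" and "\<tau>2 \<in> K"
    and "M \<in> Aut X" and "type_III M"
    and "M = block A1 A2 A3 A4"
  shows
    "((\<nexists>c. A1 = mat c) \<longrightarrow>
       invertible A1 \<and> invertible A2 \<and>
       (\<exists>z\<in>{csqrt (-3), csqrt (-2), csqrt (-1)}. \<tau>1 \<in> rat_adjoin z \<and> \<tau>2 \<in> rat_adjoin z) \<and>

       (\<tau>1 \<in> rat_adjoin (csqrt (-3)) \<and> \<tau>2 \<in> rat_adjoin (csqrt (-3)) \<longrightarrow>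
         (minpoly M = [:1, 0, 1:] \<longrightarrow>
            M = block A1 A2 ((-1/4) \<cdot> matrix_inv A2) (- (matrix_inv A2 ** A1 ** A2)) \<and>
            minpoly A1 = [:3/4, 0, 1:]) \<and>
         (minpoly M = [:1, 0, 1, 0, 1:] \<and> type_III (M ** M) \<longrightarrow>
            M = block A1 A2 ((1/4) \<cdot> matrix_inv A2) (matrix_inv A2 ** A1 ** A2) \<and>
            minpoly A1 = [:3/4, 0, 1:]) \<and>

         (\<forall>s\<in>{1, -1}. minpoly M = [:s, 0, 0, 1:] \<longrightarrow>
            M = block A1 A2 ((-3) \<cdot> (matrix_inv A2 ** A1 ** A1)) (matrix_inv A2 ** A1 ** A2) \<and>
            minpoly A1 = [:1/4, s * (1/2), 1:]) \<and>
         (minpoly M = [:1, 0, 1, 0, 1:] \<and> type_I (M ** M) \<longrightarrow>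
            M = block A1 A2 (3 \<cdot> (matrix_inv A2 ** A1 ** A1)) (- (matrix_inv A2 ** A1 ** A2)) \<and>
            (\<exists>s\<in>{1, -1}. minpoly A1 = [:1/4, s * (1/2), 1:])) \<and>

         (\<forall>s\<in>{1, -1}. minpoly M = [:s, 2, s * 2, 1:] \<longrightarrow>
            M = block A1 A2 ((-1/3) \<cdot> (matrix_inv A2 ** A1 ** A1)) (matrix_inv A2 ** A1 ** A2) \<and>
            minpoly A1 = [:3/4, s * (3/2), 1:]) \<and>
         (minpoly M = [:1, 0, -1, 0, 1:] \<and> type_I (M ** M) \<longrightarrow>
            M = block A1 A2 ((1/3) \<cdot> (matrix_inv A2 ** A1 ** A1)) (- (matrix_inv A2 ** A1 ** A2)) \<and>
            (\<exists>s\<in>{1, -1}. minpoly A1 = [:3/4, s * (3/2), 1:]))) \<and>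

       (\<tau>1 \<in> rat_adjoin (csqrt (-2)) \<and> \<tau>2 \<in> rat_adjoin (csqrt (-2)) \<longrightarrow>
         (minpoly M = [:1, 0, 1:] \<longrightarrow>
            M = block A1 A2 ((-1/2) \<cdot> matrix_inv A2) (- (matrix_inv A2 ** A1 ** A2)) \<and>
            minpoly A1 = [:1/2, 0, 1:]) \<and>
         (minpoly M = [:1, 0, 0, 0, 1:] \<and> type_II (M ** M) \<longrightarrow>
            M = block A1 A2 ((1/2) \<cdot> matrix_inv A2) (matrix_inv A2 ** A1 ** A2) \<and>
            minpoly A1 = [:1/2, 0, 1:]) \<and>

         (\<forall>s\<in>{1, -1}. minpoly M = [:1, s, 1:] \<longrightarrow>
            M = block A1 A2 ((-1/4) \<cdot> matrix_inv A2)
                  ((3/4) \<cdot> (matrix_inv A2 ** matrix_inv A1 ** A2)) \<and>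
            minpoly A1 = [:3/4, s, 1:]) \<and>
         (minpoly M = [:1, 0, 0, 0, 1:] \<and> type_III (M ** M) \<longrightarrow>
            M = block A1 A2 ((1/4) \<cdot> matrix_inv A2)
                  ((-3/4) \<cdot> (matrix_inv A2 ** matrix_inv A1 ** A2)) \<and>
            (\<exists>s\<in>{1, -1}. minpoly A1 = [:3/4, s, 1:]))) \<and>

       (\<tau>1 \<in> rat_adjoin (csqrt (-1)) \<and> \<tau>2 \<in> rat_adjoin (csqrt (-1)) \<longrightarrow>
         (minpoly M = [:1, 0, 1:] \<longrightarrow>
            M = block A1 A2 ((-3/4) \<cdot> matrix_inv A2) (- (matrix_inv A2 ** A1 ** A2)) \<and>
            minpoly A1 = [:1/4, 0, 1:]) \<and>
         (minpoly M = [:1, 0, -1, 0, 1:] \<and> type_III (M ** M) \<and>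
            minpoly (iota ** (M ** M)) = [:-1, 0, 1:] \<longrightarrow>
            M = block A1 A2 ((3/4) \<cdot> matrix_inv A2) (matrix_inv A2 ** A1 ** A2) \<and>
            minpoly A1 = [:1/4, 0, 1:]) \<and>

         (\<forall>s\<in>{1, -1}. minpoly M = [:s, 1, s, 1:] \<longrightarrow>
            M = block A1 A2 (- (matrix_inv A2 ** A1 ** A1)) (matrix_inv A2 ** A1 ** A2) \<and>
            minpoly A1 = [:1/2, s, 1:]) \<and>
         (minpoly M = [:1, 0, 0, 0, 1:] \<and> type_I (M ** M) \<longrightarrow>
            M = block A1 A2 (matrix_inv A2 ** A1 ** A1) (- (matrix_inv A2 ** A1 ** A2)) \<and>
            (\<exists>s\<in>{1, -1}. minpoly A1 = [:1/2, s, 1:])) \<and>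

         (\<forall>s\<in>{1, -1}. minpoly M = [:1, s, 1:] \<longrightarrow>
            M = block A1 A2 ((-1/2) \<cdot> matrix_inv A2)
                  ((1/2) \<cdot> (matrix_inv A2 ** matrix_inv A1 ** A2)) \<and>
            minpoly A1 = [:1/2, s, 1:]) \<and>
         (minpoly M = [:1, 0, -1, 0, 1:] \<and> type_III (M ** M) \<and>
            minpoly (iota ** (M ** M)) = [:1, 0, -1, 0, 1:] \<longrightarrow>
            M = block A1 A2 ((1/2) \<cdot> matrix_inv A2)
                  ((-1/2) \<cdot> (matrix_inv A2 ** matrix_inv A1 ** A2)) \<and>
            (\<exists>s\<in>{1, -1}. minpoly A1 = [:1/2, s, 1:]))))
     \<and>
     ((\<exists>c. A1 = mat c) \<longrightarrow>
       (minpoly M = [:-1, 0, 1:] \<and>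
          (\<exists>s\<in>{1, -1}. \<exists>B. invertible B \<and> det B = 3/4 \<and>
             M = block (mat (s * (1/2))) B ((3/4) \<cdot> matrix_inv B) (mat (- s * (1/2))))) \<or>
       (minpoly M = [:1, 1, 1:] \<and>
          (\<exists>B. invertible B \<and> det B = 3/4 \<and>
             M = block (mat (-1/2)) B ((-3/4) \<cdot> matrix_inv B) (mat (-1/2)))) \<or>
       (minpoly M = [:1, -1, 1:] \<and>
          (\<exists>B. invertible B \<and> det B = 3/4 \<and>
             M = block (mat (1/2)) (- B) ((3/4) \<cdot> matrix_inv B) (mat (1/2)))))"
proof -
  obtain l1 l2 l3 l4 where "finite_type_III \<tau>1 \<tau>2 M A1 A2 A3 A4 l1 l2 l3 l4"
    using finite_type_III_Aut assms(1,5,6,7) by blast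
  then interpret finite_type_III \<tau>1 \<tau>2 M A1 A2 A3 A4 l1 l2 l3 l4 .
  \<comment> \<open>Naturals in place of numerals let the lemmas parametrised by \<open>d\<close>
    serve all three fields.\<close>
  have csqrt: "csqrt (-3) = csqrt (- of_nat 3)" "csqrt (-2) = csqrt (- of_nat 2)"
    "csqrt (-1) = csqrt (- of_nat 1)"
    by simp_all
  show ?thesis
  proof (intro conjI impI ballI)
    assume "\<exists>c. A1 = mat c"
    then show "(minpoly M = [:-1, 0, 1:] \<and>
          (\<exists>s\<in>{1, -1}. \<exists>B. invertible B \<and> det B = 3/4 \<and>
             M = block (mat (s * (1/2))) B ((3/4) \<cdot> matrix_inv B) (mat (- s * (1/2))))) \<or>
       (minpoly M = [:1, 1, 1:] \<and>
          (\<exists>B. invertible B \<and> det B = 3/4 \<and>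
             M = block (mat (-1/2)) B ((-3/4) \<cdot> matrix_inv B) (mat (-1/2)))) \<or>
       (minpoly M = [:1, -1, 1:] \<and>
          (\<exists>B. invertible B \<and> det B = 3/4 \<and>
             M = block (mat (1/2)) (- B) ((3/4) \<cdot> matrix_inv B) (mat (1/2))))"
      using A1_scalar_iff by (intro scalar_normal_form) blast
  next
    show "invertible A1" "invertible A2" using dets by (simp_all add: invertible_det_nz)
  next
    assume "\<nexists>c. A1 = mat c"
    then have nr: "Im l1 \<noteq> 0" using A1_scalar_iff by blast
    show "\<exists>z\<in>{csqrt (-3), csqrt (-2), csqrt (-1)}. \<tau>1 \<in> rat_adjoin z \<and> \<tau>2 \<in> rat_adjoin z"
      using cusp_field[OF nr] unfolding csqrt by blast
    {
      assume "\<tau>1 \<in> rat_adjoin (csqrt (-3)) \<and> \<tau>2 \<in> rat_adjoin (csqrt (-3))"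
      then have \<tau>: "\<tau>1 \<in> rat_adjoin (csqrt (- of_nat 3))" unfolding csqrt by blast
      {
        assume "minpoly M = [:1, 0, 1:]"
        from type_x2_plus_1[OF nr \<tau> _ this]
        show "M = block A1 A2 ((-1/4) \<cdot> matrix_inv A2) (- (matrix_inv A2 ** A1 ** A2))"
          "minpoly A1 = [:3/4, 0, 1:]" by simp_all
      }
      {
        assume *: "minpoly M = [:1, 0, 1, 0, 1:] \<and> type_III (M ** M)"
        then have mp: "minpoly M = [:1, 0, 1, 0, 1:]" and t: "t \<noteq> 0"
          using type_III_squareD by blast+
        from normal_form_biquadratic_b_0[OF nr mp t type_x4_plus_x2_plus_1[OF mp t]]
        show "M = block A1 A2 ((1/4) \<cdot> matrix_inv A2) (matrix_inv A2 ** A1 ** A2)"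
          "minpoly A1 = [:3/4, 0, 1:]" by simp_all
      }
      {
        fix s :: rat assume s: "s \<in> {1, -1}"
        {
          assume "minpoly M = [:s, 0, 0, 1:]"
          from type_x3_plus_1[OF nr s this]
          show "M = block A1 A2 ((-3) \<cdot> (matrix_inv A2 ** A1 ** A1)) (matrix_inv A2 ** A1 ** A2)"
            "minpoly A1 = [:1/4, s * (1/2), 1:]" .
        }
        {
          assume "minpoly M = [:s, 2, s * 2, 1:]"
          from type_x3_plus_2x2[OF nr s this]
          show "M = block A1 A2 ((-1/3) \<cdot> (matrix_inv A2 ** A1 ** A1)) (matrix_inv A2 ** A1 ** A2)"
            "minpoly A1 = [:3/4, s * (3/2), 1:]" .
        }
      }
      {
        assume "minpoly M = [:1, 0, 1, 0, 1:] \<and> type_I (M ** M)"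
        then have "minpoly M = [:1, 0, 1, 0, 1:]" "type_I (M ** M)" by blast+
        from type_I_square_normal_form[OF nr this]
        show "M = block A1 A2 (3 \<cdot> (matrix_inv A2 ** A1 ** A1)) (- (matrix_inv A2 ** A1 ** A2))"
          "\<exists>s\<in>{1, -1}. minpoly A1 = [:1/4, s * (1/2), 1:]" by simp_all
      }
      {
        assume "minpoly M = [:1, 0, -1, 0, 1:] \<and> type_I (M ** M)"
        then have "minpoly M = [:1, 0, -1, 0, 1:]" "type_I (M ** M)" by blast+
        from type_I_square_normal_form[OF nr this]
        show "M = block A1 A2 ((1/3) \<cdot> (matrix_inv A2 ** A1 ** A1)) (- (matrix_inv A2 ** A1 ** A2))"
          "\<exists>s\<in>{1, -1}. minpoly A1 = [:3/4, s * (3/2), 1:]" by simp_all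
      }
    }
    {
      assume "\<tau>1 \<in> rat_adjoin (csqrt (-2)) \<and> \<tau>2 \<in> rat_adjoin (csqrt (-2))"
      then have \<tau>: "\<tau>1 \<in> rat_adjoin (csqrt (- of_nat 2))" unfolding csqrt by blast
      {
        assume "minpoly M = [:1, 0, 1:]"
        from type_x2_plus_1[OF nr \<tau> _ this]
        show "M = block A1 A2 ((-1/2) \<cdot> matrix_inv A2) (- (matrix_inv A2 ** A1 ** A2))"
          "minpoly A1 = [:1/2, 0, 1:]" by simp_all
      }
      {
        assume "minpoly M = [:1, 0, 0, 0, 1:] \<and> type_II (M ** M)"
        then have mp: "minpoly M = [:1, 0, 0, 0, 1:]" and ty: "type_II (M ** M)" by blast+
        from normal_form_biquadratic_b_0[OF nr mp type_x4_plus_1_II[OF nr mp ty]]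
        show "M = block A1 A2 ((1/2) \<cdot> matrix_inv A2) (matrix_inv A2 ** A1 ** A2)"
          "minpoly A1 = [:1/2, 0, 1:]" by simp_all
      }
      {
        fix s :: rat assume s: "s \<in> {1, -1}" and mp: "minpoly M = [:1, s, 1:]"
        from type_x2_plus_x_plus_1[OF nr \<tau> _ s mp]
        show "M = block A1 A2 ((-1/4) \<cdot> matrix_inv A2)
            ((3/4) \<cdot> (matrix_inv A2 ** matrix_inv A1 ** A2))"
          "minpoly A1 = [:3/4, s, 1:]" by simp_all
      }
      {
        assume "minpoly M = [:1, 0, 0, 0, 1:] \<and> type_III (M ** M)"
        then have mp: "minpoly M = [:1, 0, 0, 0, 1:]" and ty: "type_III (M ** M)" by blast+
        from normal_form_biquadratic_b_1[OF nr mp type_x4_plus_1_III[OF mp ty]]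
        show "M = block A1 A2 ((1/4) \<cdot> matrix_inv A2)
            ((-3/4) \<cdot> (matrix_inv A2 ** matrix_inv A1 ** A2))"
          "\<exists>s\<in>{1, -1}. minpoly A1 = [:3/4, s, 1:]" by simp_all
      }
    }
    {
      assume "\<tau>1 \<in> rat_adjoin (csqrt (-1)) \<and> \<tau>2 \<in> rat_adjoin (csqrt (-1))"
      then have \<tau>: "\<tau>1 \<in> rat_adjoin (csqrt (- of_nat 1))" unfolding csqrt by blast
      {
        assume "minpoly M = [:1, 0, 1:]"
        from type_x2_plus_1[OF nr \<tau> _ this]
        show "M = block A1 A2 ((-3/4) \<cdot> matrix_inv A2) (- (matrix_inv A2 ** A1 ** A2))"
          "minpoly A1 = [:1/4, 0, 1:]" by simp_all
      }
      {
        assume *: "minpoly M = [:1, 0, -1, 0, 1:] \<and> type_III (M ** M) \<and>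
            minpoly (iota ** (M ** M)) = [:-1, 0, 1:]"
        then have mp: "minpoly M = [:1, 0, -1, 0, 1:]" and t: "t \<noteq> 0"
          using type_III_squareD by blast+
        then have "b = 0" using type_x4_minus_x2_plus_1(1) * by blast
        from normal_form_biquadratic_b_0[OF nr mp t this]
        show "M = block A1 A2 ((3/4) \<cdot> matrix_inv A2) (matrix_inv A2 ** A1 ** A2)"
          "minpoly A1 = [:1/4, 0, 1:]" by simp_all
      }
      {
        fix s :: rat assume s: "s \<in> {1, -1}" and mp: "minpoly M = [:s, 1, s, 1:]"
        from type_x3_plus_x2[OF nr s mp]
        show "M = block A1 A2 (- (matrix_inv A2 ** A1 ** A1)) (matrix_inv A2 ** A1 ** A2)"
          "minpoly A1 = [:1/2, s, 1:]" .
      }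
      {
        assume "minpoly M = [:1, 0, 0, 0, 1:] \<and> type_I (M ** M)"
        then have "minpoly M = [:1, 0, 0, 0, 1:]" "type_I (M ** M)" by blast+
        from type_I_square_normal_form[OF nr this]
        show "M = block A1 A2 (matrix_inv A2 ** A1 ** A1) (- (matrix_inv A2 ** A1 ** A2))"
          "\<exists>s\<in>{1, -1}. minpoly A1 = [:1/2, s, 1:]" by simp_all
      }
      {
        fix s :: rat assume s: "s \<in> {1, -1}" and mp: "minpoly M = [:1, s, 1:]"
        from type_x2_plus_x_plus_1[OF nr \<tau> _ s mp]
        show "M = block A1 A2 ((-1/2) \<cdot> matrix_inv A2)
            ((1/2) \<cdot> (matrix_inv A2 ** matrix_inv A1 ** A2))"
          "minpoly A1 = [:1/2, s, 1:]" by simp_all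
      }
      {
        assume *: "minpoly M = [:1, 0, -1, 0, 1:] \<and> type_III (M ** M) \<and>
            minpoly (iota ** (M ** M)) = [:1, 0, -1, 0, 1:]"
        then have mp: "minpoly M = [:1, 0, -1, 0, 1:]" and t: "t \<noteq> 0"
          using type_III_squareD by blast+
        then have "b = 1" using type_x4_minus_x2_plus_1(2) * by blast
        from normal_form_biquadratic_b_1[OF nr mp t this]
        show "M = block A1 A2 ((1/2) \<cdot> matrix_inv A2)
            ((-1/2) \<cdot> (matrix_inv A2 ** matrix_inv A1 ** A2))"
          "\<exists>s\<in>{1, -1}. minpoly A1 = [:1/2, s, 1:]" by simp_all
      }
    }
  qed
qed

end
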